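(* Fix $\alpha\in[0,\infty)$ and consider the random graph $\mathscr{G}(n,\alpha/n)$. For $r\ge 0$ let $\mathscr{V}_r$ denote the (random) set of vertices that belong to connected components having more than $r$ vertices. Then for every $\varrho\in[0,1]$, \[ \lim_{\epsilon\downarrow0}\ \lim_{n\to\infty}\ P_{n,\alpha}\bigl(|\mathscr{V}_{\epsilon n}|=\lfloor\varrho n\rfloor\bigr)^{1/n}=\mathrm{e}^{-\Phi(\varrho,\alpha)}, \] where \[ \Phi(\varrho,\alpha)=S(\varrho)-\varrho\log\pi_1(\alpha\varrho)-(1-\varrho)\log\bigl[1-\pi_1(\alpha\varrho)\bigr]-(1-\varrho)\Psi\bigl(\alpha(1-\varrho)\bigr). \]
   Context: $\mathscr{G}(n,p)$ is the random graph on vertex set $\{1,\dots,n\}$ in which each of the $\binom n2$ unordered pairs $\{k,l\}$ is an edge independently with probability $p$; here $p=\alpha/n$ (with $n>\alpha$), and $P_{n,\alpha}$ is the corresponding probability measure. The size of a component is its number of vertices. Notation: $S(\varrho)=\varrho\log\varrho+(1-\varrho)\log(1-\varrho)$; $\pi_1(x)=1-\mathrm{e}^{-x}$; $\Psi(x)=\bigl(\log x-\tfrac12[x-\tfrac1x]\bigr)\wedge 0$ for $x>0$ and $\Psi(0)=0$ (note $\Psi(x)<0$ iff $x>1$). Conventions: $0\log 0=0$, $\log 0=-\infty$ otherwise, $\mathrm{e}^{-\infty}=0$. *)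

theory Defs
  imports "HOL-Analysis.Analysis"
begin

definition vertices :: "nat \<Rightarrow> nat set" where
  "vertices n = {1..n}"

definition all_pairs :: "nat \<Rightarrow> nat set set" where
  "all_pairs n = {e. \<exists>k l. k \<in> vertices n \<and> l \<in> vertices n \<and> k \<noteq> l \<and> e = {k, l}}"

definition graph_prob :: "nat \<Rightarrow> real \<Rightarrow> nat set set \<Rightarrow> real" where
  "graph_prob n p E = p ^ card E * (1 - p) ^ (card (all_pairs n) - card E)"

definition P_event :: "nat \<Rightarrow> real \<Rightarrow> (nat set set \<Rightarrow> bool) \<Rightarrow> real" where
  "P_event n \<alpha> Q = (\<Sum>E\<in>{E. E \<subseteq> all_pairs n \<and> Q E}. graph_prob n (\<alpha> / real n) E)"

definition adj :: "nat set set \<Rightarrow> (nat \<times> nat) set" where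
  "adj E = {(u, w). {u, w} \<in> E}"

definition component :: "nat set set \<Rightarrow> nat \<Rightarrow> nat set" where
  "component E v = {w. (v, w) \<in> (adj E)\<^sup>*}"

definition bigV :: "nat \<Rightarrow> nat set set \<Rightarrow> real \<Rightarrow> nat set" where
  "bigV n E r = {v \<in> vertices n. real (card (component E v)) > r}"

text \<open>x * log y with conventions 0 log 0 = 0 (and 0 * log y = 0), log 0 = -infinity.\<close>
definition xlogy :: "real \<Rightarrow> real \<Rightarrow> ereal" where
  "xlogy x y = (if x = 0 then 0 else if y = 0 then - \<infinity> else ereal (x * ln y))"

definition S_ent :: "real \<Rightarrow> ereal" where
  "S_ent \<rho> = xlogy \<rho> \<rho> + xlogy (1 - \<rho>) (1 - \<rho>)"

definition pi1 :: "real \<Rightarrow> real" where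
  "pi1 x = 1 - exp (- x)"

definition Psi :: "real \<Rightarrow> real" where
  "Psi x = (if x > 0 then min (ln x - (x - 1 / x) / 2) 0 else 0)"

definition Phi :: "real \<Rightarrow> real \<Rightarrow> ereal" where
  "Phi \<rho> \<alpha> = S_ent \<rho> - xlogy \<rho> (pi1 (\<alpha> * \<rho>))
      - xlogy (1 - \<rho>) (1 - pi1 (\<alpha> * \<rho>)) - ereal ((1 - \<rho>) * Psi (\<alpha> * (1 - \<rho>)))"

definition exp_neg :: "ereal \<Rightarrow> real" where
  "exp_neg x = (if x = \<infinity> then 0 else exp (- real_of_ereal x))"

end

theory Submission
  imports Defs
begin

text \<open>
  Write \<open>p = \<alpha> / n\<close>, \<open>q = 1 - p\<close>. Summing over the set of the \<open>m = \<lfloor>\<rho> n\<rfloor>\<close> vertices in large components, the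
  probability factorises into \<open>n choose m\<close>, \<open>q ^ (m (n - m))\<close>, the probability that all components of
  \<open>G(m, p)\<close> are large, and the probability that all components of \<open>G(n - m, p)\<close> are small.

  An exploration recursion gives \<open>(1 - q ^ k) ^ (k - 1) / k \<le> P(G(k, p) connected) \<le> (1 - q ^ k) ^ (k - 1)\<close>.
  Since \<open>(1 - q ^ k) + q ^ k (1 - q ^ (m - k)) = 1 - q ^ m\<close>, the binomial theorem shows that splitting
  into boundedly many large components gains only a polynomial factor over being connected.

  The small part is a coefficient of \<open>exp (\<Sum>k\<le>\<epsilon>n. w k x ^ k)\<close>. It is bounded above by evaluating at the
  radius of convergence \<open>1 / e\<close> of the tree function, where \<open>\<Sum>k. k ^ (k - 2) e ^ (- k) / k! = 1 / 2\<close>, and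
  bounded below by a single configuration of trees of bounded size.

  For fixed \<open>\<epsilon>\<close>, components with sizes of order \<open>n\<close> below \<open>\<epsilon> n\<close> do improve the exponent, so the limit in \<open>n\<close>
  is a supremum over finite lists of such sizes; the improvement vanishes as \<open>\<epsilon>\<close> tends to 0.
\<close>

section \<open>Connection probabilities\<close>

text \<open>The factor \<open>1 / k\<close> is a ballot factor: an exploration that ignores whether
  its active set is empty finds each vertex independently, and demanding that the set never dies out
  too early costs at most the factor \<open>(t - m) / t\<close>. The kink in \<open>Psi\<close>
  comes from trees: at the radius of convergence they carry a mass of at most
  \<open>1 / \<alpha>\<close>, so for \<open>\<alpha> * x > 1\<close> the rate is affine in
  \<open>x\<close>, with intercept \<open>1 / (2 * \<alpha>)\<close>. The lower bound must put the
  surplus \<open>x - 1 / \<alpha>\<close> somewhere; trees of one large bounded size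
  \<open>R\<close> take it, at a cost per vertex of order \<open>ln R / R\<close>. The inner limit
  has to exist for every small fixed \<epsilon>, which is why the supremum over configurations is
  carried along. It is never evaluated: its existence as a limit follows by peeling off macroscopic
  components one at a time with a polynomial loss for each, and its behaviour for small \<epsilon>
  by bounding the same coefficient directly.\<close>

text \<open>Both sides sum \<open>g\<close> over the ways to split an \<open>m\<close>-set into
  classes of sizes \<open>i\<close>, \<open>j\<close>, \<open>l\<close>; the left side chooses the
  union of the first two classes first, the right side the class of size \<open>i\<close>. This is
  the one rearrangement behind the inductions on explorations and on forests.\<close>

lemma binomial_sum_reassoc:
  fixes g :: "nat \<Rightarrow> nat \<Rightarrow> nat \<Rightarrow> real"
  shows "(\<Sum>j\<le>m. real (m choose j) * (\<Sum>i\<le>j. real (j choose i) * g i (j - i) (m - j)))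
       = (\<Sum>i\<le>m. real (m choose i) * (\<Sum>j\<le>m - i. real ((m - i) choose j) * g i j (m - i - j)))"
proof -
  have "(\<Sum>(j, i)\<in>Sigma {..m} (\<lambda>j. {..j}).
           real (m choose j) * real (j choose i) * g i (j - i) (m - j))
      = (\<Sum>(i, j)\<in>Sigma {..m} (\<lambda>i. {..m - i}).
           real (m choose i) * real ((m - i) choose j) * g i j (m - i - j))"
    by (rule sum.reindex_bij_witness[of _ "\<lambda>(i, j). (i + j, i)" "\<lambda>(j, i). (i, j - i)"])
       (auto simp: choose_mult simp flip: of_nat_mult)
  then show ?thesis
    by (simp add: sum.Sigma sum_distrib_left mult.assoc)
qed

lemma sum_index_binomial:
  fixes a b :: real
  shows "(\<Sum>j\<le>m. real (m choose j) * real j * a ^ j * b ^ (m - j)) = real m * a * (a + b) ^ (m - 1)"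
proof -
  have "(\<Sum>j\<le>m. real (m choose j) * real j * a ^ j * b ^ (m - j))
      = a * (\<Sum>j\<le>m. real j * real (m choose j) * a ^ (j - 1) * b ^ (m - j))"
    unfolding sum_distrib_left
  proof (rule sum.cong)
    fix j assume "j \<in> {..m}"
    show "real (m choose j) * real j * a ^ j * b ^ (m - j)
        = a * (real j * real (m choose j) * a ^ (j - 1) * b ^ (m - j))"
      by (cases j) (auto simp: algebra_simps)
  qed simp
  then show ?thesis
    using binomial_deriv1[of m a b] by simp
qed

text \<open>\<open>reach p t m\<close> is the probability that an exploration of \<open>t\<close> vertices started from
  \<open>t - m\<close> active ones discovers the remaining \<open>m\<close>; one vertex is processed per step.\<close>

primrec reach :: "real \<Rightarrow> nat \<Rightarrow> nat \<Rightarrow> real" where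
  "reach p 0 m = (if m = 0 then 1 else 0)"
| "reach p (Suc t) m =
     (if m \<le> t then \<Sum>j\<le>m. real (m choose j) * p ^ j * (1 - p) ^ (m - j) * reach p t (m - j) else 0)"

lemma reach_nonneg: "0 \<le> p \<Longrightarrow> p \<le> 1 \<Longrightarrow> 0 \<le> reach p t m"
  by (induction t arbitrary: m) (auto intro!: sum_nonneg)

lemma reach_0 [simp]: "reach p t 0 = 1"
  by (induction t) auto

text \<open>Total probability over the \<open>j\<close> vertices, out of \<open>m\<close>, that an
  exploration from \<open>a\<close> active ones eventually finds: they are all reached, and none of
  the \<open>(j + a) * (m - j)\<close> pairs leading to the rest is an edge. The induction processes
  one active vertex, whose \<open>i\<close> new neighbours become active.\<close>

lemma reach_total:
  "(\<Sum>j\<le>m. real (m choose j) * reach p (a + j) j * (1 - p) ^ ((j + a) * (m - j))) = 1"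
proof (induction "m + a" arbitrary: m a)
  case 0
  then show ?case by simp
next
  case (Suc s)
  show ?case
  proof (cases a)
    case 0
    \<comment> \<open>Without active vertices nothing is found, so only \<open>j = 0\<close>
      contributes.\<close>
    have z: "reach p j j = 0" if "j > 0" for j
      using that by (cases j) auto
    have "(\<Sum>j\<le>m. real (m choose j) * reach p (a + j) j * (1 - p) ^ ((j + a) * (m - j)))
        = (\<Sum>j\<in>{0}. real (m choose j) * reach p (a + j) j * (1 - p) ^ ((j + a) * (m - j)))"
      using 0 by (intro sum.mono_neutral_right) (auto simp: z)
    then show ?thesis using 0 by simp
  next
    case (Suc a')
    \<comment> \<open>\<open>i\<close> counts the neighbours of the processed vertex,
      \<open>j\<close> the vertices found later, \<open>l\<close> those never found;
      \<open>(1 - p) ^ (j + l)\<close> accounts for the non-neighbours of the processed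
      vertex.\<close>
    define g where "g i j l = p ^ i * (1 - p) ^ (j + l) * reach p (a' + i + j) j * (1 - p) ^ ((j + (a' + i)) * l)"
      for i j l
    have "(\<Sum>j\<le>m. real (m choose j) * reach p (a + j) j * (1 - p) ^ ((j + a) * (m - j)))
        = (\<Sum>j\<le>m. real (m choose j) * (\<Sum>i\<le>j. real (j choose i) * g i (j - i) (m - j)))"
    proof (rule sum.cong[OF refl])
      fix j assume "j \<in> {..m}"
      then have j: "j \<le> m" by simp
      have "reach p (a + j) j * (1 - p) ^ ((j + a) * (m - j))
          = (\<Sum>i\<le>j. real (j choose i) * p ^ i * (1 - p) ^ (j - i) * reach p (a' + j) (j - i)
              * (1 - p) ^ ((j + a) * (m - j)))"
        by (simp add: Suc sum_distrib_right)
      also have "\<dots> = (\<Sum>i\<le>j. real (j choose i) * g i (j - i) (m - j))"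
      proof (rule sum.cong[OF refl])
        fix i assume "i \<in> {..j}"
        then have i: "i \<le> j" by simp
        have e: "(j - i) + (j + a) * (m - j) = (j - i + (m - j)) + (j - i + (a' + i)) * (m - j)"
          using i by (simp add: Suc)
        have "(1 - p) ^ (j - i) * (1 - p) ^ ((j + a) * (m - j))
            = (1 - p) ^ (j - i + (m - j)) * (1 - p) ^ ((j - i + (a' + i)) * (m - j))"
          unfolding power_add[symmetric] e ..
        then show "real (j choose i) * p ^ i * (1 - p) ^ (j - i) * reach p (a' + j) (j - i)
              * (1 - p) ^ ((j + a) * (m - j)) = real (j choose i) * g i (j - i) (m - j)"
          using i by (simp add: g_def)
      qed
      finally show "real (m choose j) * reach p (a + j) j * (1 - p) ^ ((j + a) * (m - j))
          = real (m choose j) * (\<Sum>i\<le>j. real (j choose i) * g i (j - i) (m - j))"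
        by simp
    qed
    also have "\<dots> = (\<Sum>i\<le>m. real (m choose i) * (\<Sum>j\<le>m - i. real ((m - i) choose j) * g i j (m - i - j)))"
      by (rule binomial_sum_reassoc)
    also have "\<dots> = (\<Sum>i\<le>m. real (m choose i) * p ^ i * (1 - p) ^ (m - i))"
    proof (rule sum.cong)
      fix i assume i: "i \<in> {..m}"
      have "(\<Sum>j\<le>m - i. real ((m - i) choose j) * g i j (m - i - j))
          = (\<Sum>j\<le>m - i. p ^ i * (1 - p) ^ (m - i) * (real ((m - i) choose j) * reach p (a' + i + j) j
               * (1 - p) ^ ((j + (a' + i)) * (m - i - j))))"
      proof (rule sum.cong[OF refl])
        fix j assume "j \<in> {..m - i}"
        then have "j + (m - i - j) = m - i" by simp
        then show "real ((m - i) choose j) * g i j (m - i - j) = p ^ i * (1 - p) ^ (m - i) *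
            (real ((m - i) choose j) * reach p (a' + i + j) j * (1 - p) ^ ((j + (a' + i)) * (m - i - j)))"
          unfolding g_def by (simp only: mult_ac)
      qed
      also have "\<dots> = p ^ i * (1 - p) ^ (m - i)"
        unfolding sum_distrib_left[symmetric]
        using Suc.hyps(1)[of "m - i" "a' + i"] Suc.hyps(2) Suc i by simp
      finally show "real (m choose i) * (\<Sum>j\<le>m - i. real ((m - i) choose j) * g i j (m - i - j))
          = real (m choose i) * p ^ i * (1 - p) ^ (m - i)"
        by simp
    qed simp
    also have "\<dots> = (p + (1 - p)) ^ m"
      by (simp only: binomial_ring)
    finally show ?thesis by simp
  qed
qed

text \<open>If the exploration ran for all \<open>t\<close> steps even with no active vertex left,
  each of the \<open>m\<close> vertices would be found independently with probability
  \<open>1 - (1 - p) ^ t\<close>. In the recursion, \<open>p + (1 - p) * (1 - (1 - p) ^ t)\<close>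
  is this probability for \<open>t + 1\<close>.\<close>

lemma reach_le_power:
  assumes "0 \<le> p" "p \<le> 1"
  shows "reach p t m \<le> (1 - (1 - p) ^ t) ^ m"
proof (induction t arbitrary: m)
  case (Suc t)
  have "(\<Sum>j\<le>m. real (m choose j) * p ^ j * (1 - p) ^ (m - j) * reach p t (m - j))
      \<le> (\<Sum>j\<le>m. real (m choose j) * p ^ j * (1 - p) ^ (m - j) * (1 - (1 - p) ^ t) ^ (m - j))"
    using assms by (intro sum_mono mult_left_mono Suc) auto
  also have "\<dots> = (p + (1 - p) * (1 - (1 - p) ^ t)) ^ m"
    by (simp add: binomial_ring power_mult_distrib mult_ac)
  also have "\<dots> = (1 - (1 - p) ^ Suc t) ^ m"
    by (simp add: algebra_simps)
  finally show ?case
    using assms by (auto simp: power_le_one intro!: zero_le_power mult_le_one)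
qed auto

text \<open>The loss against \<open>reach_le_power\<close> is the ballot factor
  \<open>(t - m) / t\<close>. The splitting \<open>t - (m - j) = (t - m) + j\<close> turns the
  inductive bound into a binomial sum plus its first moment.\<close>

lemma reach_ge:
  assumes "0 \<le> p" "p \<le> 1" "m \<le> t"
  shows "(real t - real m) * (1 - (1 - p) ^ t) ^ m \<le> real t * reach p t m"
  using assms(3)
proof (induction t arbitrary: m)
  case (Suc t)
  show ?case
  proof (cases "m = Suc t \<or> m = 0")
    case False
    with Suc.prems have m: "m \<le> t" "m > 0" "t > 0" by auto
    define X where "X = 1 - (1 - p) ^ Suc t"
    have X: "p + (1 - p) * (1 - (1 - p) ^ t) = X"
      by (simp add: X_def algebra_simps)
    have X0: "0 \<le> X" using assms by (simp add: X_def power_le_one mult_le_one)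
    \<comment> \<open>Bernoulli's inequality closes the induction: the difference of the two sides
      is a nonnegative multiple of \<open>Suc t * p - X\<close>.\<close>
    have Xle: "X \<le> real (Suc t) * p"
      using Bernoulli_inequality[of "- p" "Suc t"] assms by (simp add: X_def)
    have "(real t - real m) * X ^ m + real m * p * X ^ (m - 1)
        = (\<Sum>j\<le>m. real (m choose j) * p ^ j * (1 - p) ^ (m - j) *
            ((real t - real (m - j)) * (1 - (1 - p) ^ t) ^ (m - j)))"
    proof -
      have "(\<Sum>j\<le>m. real (m choose j) * p ^ j * (1 - p) ^ (m - j) *
            ((real t - real (m - j)) * (1 - (1 - p) ^ t) ^ (m - j)))
          = (\<Sum>j\<le>m. (real t - real m) * (real (m choose j) * p ^ j * ((1 - p) * (1 - (1 - p) ^ t)) ^ (m - j))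
              + real (m choose j) * real j * p ^ j * ((1 - p) * (1 - (1 - p) ^ t)) ^ (m - j))"
      proof (rule sum.cong[OF refl])
        fix j assume "j \<in> {..m}"
        then have j: "real t - real (m - j) = (real t - real m) + real j" by auto
        show "real (m choose j) * p ^ j * (1 - p) ^ (m - j) *
              ((real t - real (m - j)) * (1 - (1 - p) ^ t) ^ (m - j))
            = (real t - real m) * (real (m choose j) * p ^ j * ((1 - p) * (1 - (1 - p) ^ t)) ^ (m - j))
              + real (m choose j) * real j * p ^ j * ((1 - p) * (1 - (1 - p) ^ t)) ^ (m - j)"
          unfolding j power_mult_distrib by (simp only: distrib_left distrib_right mult_ac)
      qed
      also have "\<dots> = (real t - real m) * X ^ m + real m * p * X ^ (m - 1)"
        unfolding sum.distrib sum_index_binomial sum_distrib_left[symmetric] binomial_ring[symmetric] X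
        by simp
      finally show ?thesis by simp
    qed
    also have "\<dots> \<le> (\<Sum>j\<le>m. real (m choose j) * p ^ j * (1 - p) ^ (m - j) * (real t * reach p t (m - j)))"
      using assms m by (intro sum_mono mult_left_mono Suc.IH) auto
    also have "\<dots> = real t * reach p (Suc t) m"
      using m by (simp add: sum_distrib_left mult_ac)
    finally have *: "(real t - real m) * X ^ m + real m * p * X ^ (m - 1) \<le> real t * reach p (Suc t) m" .
    have "real t * ((real (Suc t) - real m) * X ^ m)
        \<le> real (Suc t) * ((real t - real m) * X ^ m + real m * p * X ^ (m - 1))"
    proof -
      have e: "X ^ m = X * X ^ (m - 1)" using m by (cases m) auto
      have "real (Suc t) * ((real t - real m) * X ^ m + real m * p * X ^ (m - 1))
           - real t * ((real (Suc t) - real m) * X ^ m)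
          = real m * X ^ (m - 1) * (real (Suc t) * p - X)"
        unfolding e by (simp add: algebra_simps)
      also have "\<dots> \<ge> 0" using Xle X0 by simp
      finally show ?thesis by simp
    qed
    also have "\<dots> \<le> real (Suc t) * (real t * reach p (Suc t) m)"
      using * by (rule mult_left_mono) simp
    finally have "real t * ((real (Suc t) - real m) * X ^ m) \<le> real t * (real (Suc t) * reach p (Suc t) m)"
      by (simp only: mult_ac)
    then show ?thesis
      unfolding X_def using m by (simp only: mult_le_cancel_left_pos of_nat_0_less_iff)
  qed (use reach_nonneg[OF assms(1,2)] in auto)
qed auto

text \<open>Union bound over spanning forests: \<open>(t - m) * t ^ m / t\<close> is the number of
  forests on \<open>t\<close> vertices rooted at the \<open>t - m\<close> active ones, and each has
  \<open>m\<close> edges.\<close>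

lemma reach_le_forest:
  assumes "0 \<le> p" "p \<le> 1" "m \<le> t"
  shows "real t * reach p t m \<le> (real t - real m) * real t ^ m * p ^ m"
  using assms(3)
proof (induction t arbitrary: m)
  case (Suc t)
  show ?case
  proof (cases "m = Suc t \<or> m = 0")
    case False
    with Suc.prems have m: "m \<le> t" "m > 0" "t > 0" by auto
    have "real t * reach p (Suc t) m
        = (\<Sum>j\<le>m. real (m choose j) * p ^ j * (1 - p) ^ (m - j) * (real t * reach p t (m - j)))"
      using m by (simp add: sum_distrib_left mult_ac)
    also have "\<dots> \<le> (\<Sum>j\<le>m. real (m choose j) * p ^ j * 1 * 
        ((real t - real (m - j)) * real t ^ (m - j) * p ^ (m - j)))"
      using assms m reach_nonneg[OF assms(1,2)] 
      by (intro sum_mono mult_mono Suc.IH mult_nonneg_nonneg) (auto simp: power_le_one)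
    also have "\<dots> = (\<Sum>j\<le>m. p ^ m * ((real t - real m) * (real (m choose j) * 1 ^ j * real t ^ (m - j))
              + real (m choose j) * real j * 1 ^ j * real t ^ (m - j)))"
    proof (rule sum.cong[OF refl])
      fix j assume "j \<in> {..m}"
      then have j: "j \<le> m" "p ^ m = p ^ j * p ^ (m - j)" by (auto simp: power_add[symmetric])
      show "real (m choose j) * p ^ j * 1 * ((real t - real (m - j)) * real t ^ (m - j) * p ^ (m - j))
        = p ^ m * ((real t - real m) * (real (m choose j) * 1 ^ j * real t ^ (m - j))
              + real (m choose j) * real j * 1 ^ j * real t ^ (m - j))"
        unfolding j(2) using j(1) by (simp add: of_nat_diff algebra_simps)
    qed
    also have "\<dots> = p ^ m * ((real t - real m) * (1 + real t) ^ m + real m * 1 * (1 + real t) ^ (m - 1))"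
      unfolding sum_distrib_left[symmetric] sum.distrib sum_index_binomial binomial_ring[symmetric] by simp
    finally have *: "real t * reach p (Suc t) m
        \<le> p ^ m * ((real t - real m) * (1 + real t) ^ m + real m * 1 * (1 + real t) ^ (m - 1))" .
    have "real t * (real (Suc t) * reach p (Suc t) m)
       \<le> real (Suc t) * (p ^ m * ((real t - real m) * (1 + real t) ^ m + real m * 1 * (1 + real t) ^ (m - 1)))"
      using mult_left_mono[OF *, of "real (Suc t)"] by (simp only: mult_ac of_nat_0_le_iff)
    also have "\<dots> = real t * ((real (Suc t) - real m) * real (Suc t) ^ m * p ^ m)"
    proof -
      have "(1 + real t) ^ m = (1 + real t) * (1 + real t) ^ (m - 1)" using m by (cases m) auto
      then show ?thesis by (simp add: algebra_simps)
    qed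
    finally show ?thesis
      using m by (simp only: mult_le_cancel_left_pos of_nat_0_less_iff)
  qed auto
qed auto

text \<open>That this is the probability of connectedness is shown in
  \<open>subset_prob_connected\<close>; until then only the recursion is used.\<close>

definition conn :: "real \<Rightarrow> nat \<Rightarrow> real" where
  "conn p k = reach p k (k - 1)"

lemma conn_nonneg: "0 \<le> p \<Longrightarrow> p \<le> 1 \<Longrightarrow> 0 \<le> conn p k"
  by (simp add: conn_def reach_nonneg)

lemma conn_1 [simp]: "conn p (Suc 0) = 1"
  by (simp add: conn_def)

lemma conn_total:
  "(\<Sum>j\<le>m. real (m choose j) * conn p (Suc j) * (1 - p) ^ (Suc j * (m - j))) = 1"
  using reach_total[of m p 1] by (simp add: conn_def)

lemma conn_le_power: "0 \<le> p \<Longrightarrow> p \<le> 1 \<Longrightarrow> conn p k \<le> (1 - (1 - p) ^ k) ^ (k - 1)"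
  by (simp add: conn_def reach_le_power)

lemma conn_ge:
  assumes "0 \<le> p" "p \<le> 1" "k > 0"
  shows "(1 - (1 - p) ^ k) ^ (k - 1) / real k \<le> conn p k"
  using reach_ge[OF assms(1,2), of "k - 1" k] assms
  by (simp add: conn_def field_simps of_nat_diff)

lemma conn_le_trees:
  assumes "0 \<le> p" "p \<le> 1" "k > 0"
  shows "conn p k \<le> real k ^ (k - 2) * p ^ (k - 1)"
proof (cases "k = 1")
  case False
  with assms(3) have k: "k - 1 = Suc (k - 2)" "real k - real (k - 1) = 1" by auto
  have "real k * conn p k \<le> (real k - real (k - 1)) * real k ^ (k - 1) * p ^ (k - 1)"
    unfolding conn_def by (rule reach_le_forest[OF assms(1,2)]) simp
  also have "\<dots> = real k * (real k ^ (k - 2) * p ^ (k - 1))"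
    unfolding k(2) by (subst k(1)) simp
  finally have "real k * conn p k \<le> real k * (real k ^ (k - 2) * p ^ (k - 1))" .
  then show ?thesis using assms(3) by (simp only: mult_le_cancel_left_pos of_nat_0_less_iff)
qed simp

section \<open>Coefficients of exponentials\<close>

text \<open>\<open>expc w m\<close> is the coefficient of \<open>x ^ m\<close> in \<open>exp (\<Sum>k\<ge>1. w k * x ^ k)\<close>, computed from \<open>F' = G' F\<close>.\<close>

fun expc :: "(nat \<Rightarrow> real) \<Rightarrow> nat \<Rightarrow> real" where
  "expc w m = (if m = 0 then 1 else (\<Sum>k<m. real (Suc k) * w (Suc k) * expc w (m - Suc k)) / real m)"

declare expc.simps [simp del]

lemma expc_0 [simp]: "expc w 0 = 1"
  by (subst expc.simps) simp

lemma expc_rec: "real m * expc w m = (\<Sum>k\<in>{1..m}. real k * w k * expc w (m - k))"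
proof (cases "m = 0")
  case False
  then have "real m * expc w m = (\<Sum>k<m. real (Suc k) * w (Suc k) * expc w (m - Suc k))"
    by (subst expc.simps) simp
  also have "\<dots> = (\<Sum>k\<in>{1..m}. real k * w k * expc w (m - k))"
    by (rule sum.reindex_bij_witness[of _ "\<lambda>k. k - 1" Suc]) auto
  finally show ?thesis .
qed simp

lemma expc_nonneg: "(\<And>k. 0 \<le> w k) \<Longrightarrow> 0 \<le> expc w m"
proof (induction m rule: less_induct)
  case (less m)
  then show ?case by (subst expc.simps) (auto intro!: sum_nonneg divide_nonneg_nonneg mult_nonneg_nonneg)
qed

lemma expc_ge_part:
  assumes "\<And>k. 0 \<le> w k" "1 \<le> k" "k \<le> m"
  shows "real k / real m * w k * expc w (m - k) \<le> expc w m"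
proof -
  have "real k * w k * expc w (m - k) \<le> (\<Sum>k\<in>{1..m}. real k * w k * expc w (m - k))"
    using assms expc_nonneg[OF assms(1)] by (intro member_le_sum) auto
  also have "\<dots> = real m * expc w m" by (simp add: expc_rec)
  finally show ?thesis using assms by (simp add: field_simps)
qed

text \<open>The product is one term in the expansion of the exponential, with \<open>c k\<close>
  blocks of size \<open>k\<close>. The induction removes one block; summing \<open>k * c k\<close>
  over all sizes recovers the factor \<open>m\<close> of the recurrence.\<close>

lemma expc_ge_term:
  assumes "\<And>k. 0 \<le> w k" "finite K" "0 \<notin> K"
  shows "(\<Prod>k\<in>K. w k ^ c k / fact (c k)) \<le> expc w (\<Sum>k\<in>K. k * c k)"
proof (induction "\<Sum>k\<in>K. k * c k" arbitrary: c rule: less_induct)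
  case (less c)
  define B where "B d = (\<Prod>k\<in>K. w k ^ d k / fact (d k))" for d
  define m where "m = (\<Sum>k\<in>K. k * c k)"
  show ?case
  proof (cases "m = 0")
    case True
    then have "\<And>k. k \<in> K \<Longrightarrow> c k = 0" using assms by (auto simp: m_def)
    then show ?thesis by simp
  next
    case False
    have step: "real k * real (c k) * B c \<le> real k * w k * expc w (m - k)" if k: "k \<in> K" "c k > 0" for k
    proof -
      define d where "d = c(k := c k - 1)"
      have "k * c k = k * (c k - 1) + k" using k by (cases "c k") auto
      then have s: "(\<Sum>k\<in>K. k * d k) + k = m"
        unfolding m_def using k assms by (simp add: sum.remove[of K k] d_def)
      have "k > 0" using assms k by (cases k) auto
      then have "B d \<le> expc w (m - k)"
        unfolding B_def using less[of d] s m_def by (metis add_diff_cancel_right' less_add_same_cancel1)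
      moreover have "real (c k) * B c = w k * B d"
      proof -
        have "(\<Prod>k\<in>K - {k}. w k ^ d k / fact (d k)) = (\<Prod>k\<in>K - {k}. w k ^ c k / fact (c k))"
          by (intro prod.cong) (auto simp: d_def)
        moreover have "real (c k) * (w k ^ c k / fact (c k)) = w k * (w k ^ d k / fact (d k))"
          using k by (cases "c k") (auto simp: d_def simp del: of_nat_Suc)
        ultimately show ?thesis
          unfolding B_def prod.remove[OF assms(2) k(1)] by (metis (no_types, lifting) mult.assoc)
      qed
      ultimately show ?thesis
        using assms by (simp add: mult.assoc mult_left_mono)
    qed
    have "real m * B c = (\<Sum>k\<in>K. real k * real (c k) * B c)"
      by (simp add: m_def sum_distrib_right)
    also have "\<dots> \<le> (\<Sum>k\<in>K \<inter> {1..m}. real k * w k * expc w (m - k))"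
    proof -
      have "(\<Sum>k\<in>K. real k * real (c k) * B c) = (\<Sum>k\<in>K \<inter> {1..m}. real k * real (c k) * B c)"
      proof (rule sum.mono_neutral_right)
        have "k \<le> m" if "k \<in> K" "c k > 0" for k
        proof -
          have "k * 1 \<le> k * c k" using that by (intro mult_le_mono2) auto
          also have "\<dots> \<le> m" unfolding m_def using that assms by (intro member_le_sum) auto
          finally show ?thesis by simp
        qed
        moreover have "1 \<le> k" if "k \<in> K" for k
          using that assms by (cases k) auto
        ultimately show "\<forall>k\<in>K - K \<inter> {1..m}. real k * real (c k) * B c = 0"
          by force
      qed (use assms in auto)
      also have "\<dots> \<le> (\<Sum>k\<in>K \<inter> {1..m}. real k * w k * expc w (m - k))"
      proof (rule sum_mono)
        fix k assume "k \<in> K \<inter> {1..m}"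
        then show "real k * real (c k) * B c \<le> real k * w k * expc w (m - k)"
          using step[of k] expc_nonneg[OF assms(1)] assms(1)[of k] by (cases "c k = 0") auto
      qed
      finally show ?thesis .
    qed
    also have "\<dots> \<le> (\<Sum>k\<in>{1..m}. real k * w k * expc w (m - k))"
      using assms expc_nonneg[OF assms(1)] by (intro sum_mono2) auto
    also have "\<dots> = real m * expc w m"
      by (simp add: expc_rec)
    finally have "B c \<le> expc w m" using False by simp
    then show ?thesis unfolding B_def m_def .
  qed
qed

text \<open>For \<open>r \<le> s\<close> this is the coefficientwise form of
  \<open>exp (A + B) \<le> exp A + B * exp (A + B)\<close>, with the sizes up to \<open>r\<close> in
  \<open>A\<close> and those between \<open>r\<close> and \<open>s\<close> in \<open>B\<close>. It
  serves to peel off a single large block. The induction follows the recurrence and interchanges the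
  sums over a small and a large block.\<close>

lemma expc_split_le:
  fixes r s :: real
  assumes "\<And>k. 0 \<le> w k"
  defines "b \<equiv> \<lambda>r. expc (\<lambda>k. if real k \<le> r then w k else 0)"
  shows "b s m \<le> b r m + (\<Sum>k\<in>{k\<in>{1..m}. r < real k \<and> real k \<le> s}. w k * b s (m - k))"
proof (induction m rule: less_induct)
  case (less m)
  have b0: "0 \<le> b r m" for r m unfolding b_def using assms by (intro expc_nonneg) auto
  show ?case
  proof (cases "m = 0")
    case False
    define M where "M m = {k\<in>{1..m}. r < real k \<and> real k \<le> s}" for m
    define L where "L m = {k\<in>{1..m}. real k \<le> r \<and> real k \<le> s}" for m
    have fin: "finite (M m)" "finite (L m)" for m by (auto simp: M_def L_def)
    have rec: "real m * b s m = (\<Sum>k\<in>L m. real k * w k * b s (m - k)) + (\<Sum>k\<in>M m. real k * w k * b s (m - k))" for m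
    proof -
      have "real m * b s m = (\<Sum>k\<in>{1..m}. real k * (if real k \<le> s then w k else 0) * b s (m - k))"
        by (simp add: b_def expc_rec)
      also have "\<dots> = (\<Sum>k\<in>L m \<union> M m. real k * w k * b s (m - k))"
        by (intro sum.mono_neutral_cong_right) (auto simp: L_def M_def)
      also have "\<dots> = (\<Sum>k\<in>L m. real k * w k * b s (m - k)) + (\<Sum>k\<in>M m. real k * w k * b s (m - k))"
        by (rule sum.union_disjoint) (auto simp: L_def M_def)
      finally show ?thesis .
    qed
    have "(\<Sum>k\<in>L m. real k * w k * b s (m - k))
        \<le> (\<Sum>k\<in>L m. real k * w k * (b r (m - k) + (\<Sum>k'\<in>M (m - k). w k' * b s (m - k - k'))))"
    proof (intro sum_mono mult_left_mono)
      fix k assume "k \<in> L m"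
      then show "b s (m - k) \<le> b r (m - k) + (\<Sum>k'\<in>M (m - k). w k' * b s (m - k - k'))"
        unfolding M_def using less[of "m - k"] by (simp add: L_def)
    qed (use assms(1) in auto)
    also have "\<dots> = (\<Sum>k\<in>L m. real k * w k * b r (m - k))
        + (\<Sum>k\<in>L m. \<Sum>k'\<in>M (m - k). w k' * (real k * w k * b s (m - k - k')))"
      by (simp add: algebra_simps sum.distrib sum_distrib_left)
    also have "(\<Sum>k\<in>L m. real k * w k * b r (m - k)) \<le> real m * b r m"
    proof -
      have "(\<Sum>k\<in>L m. real k * w k * b r (m - k)) = (\<Sum>k\<in>L m. real k * (if real k \<le> r then w k else 0) * b r (m - k))"
        by (intro sum.cong) (auto simp: L_def)
      also have "\<dots> \<le> (\<Sum>k\<in>{1..m}. real k * (if real k \<le> r then w k else 0) * b r (m - k))"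
        using assms b0 by (intro sum_mono2) (auto simp: L_def)
      also have "\<dots> = real m * b r m" by (simp add: b_def expc_rec)
      finally show ?thesis .
    qed
    also have "(\<Sum>k\<in>L m. \<Sum>k'\<in>M (m - k). w k' * (real k * w k * b s (m - k - k')))
        = (\<Sum>k'\<in>M m. \<Sum>k\<in>L (m - k'). w k' * (real k * w k * b s (m - k' - k)))"
    proof -
      have "(\<Sum>(k, k')\<in>Sigma (L m) (\<lambda>k. M (m - k)). w k' * (real k * w k * b s (m - k - k')))
          = (\<Sum>(k', k)\<in>Sigma (M m) (\<lambda>k. L (m - k)). w k' * (real k * w k * b s (m - k' - k)))"
        by (rule sum.reindex_bij_witness[of _ prod.swap prod.swap])
           (auto simp: L_def M_def add.commute)
      then show ?thesis using fin by (simp add: sum.Sigma)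
    qed
    also have "\<dots> \<le> (\<Sum>k'\<in>M m. w k' * (real (m - k') * b s (m - k')))"
    proof (rule sum_mono)
      fix k' assume "k' \<in> M m"
      have "(\<Sum>k\<in>L (m - k'). real k * w k * b s (m - k' - k)) \<le> real (m - k') * b s (m - k')"
        unfolding rec using assms b0 by (simp add: sum_nonneg)
      then show "(\<Sum>k\<in>L (m - k'). w k' * (real k * w k * b s (m - k' - k))) \<le> w k' * (real (m - k') * b s (m - k'))"
        unfolding sum_distrib_left[symmetric] using assms by (simp add: mult_left_mono)
    qed
    finally have "(\<Sum>k\<in>L m. real k * w k * b s (m - k))
       \<le> real m * b r m + (\<Sum>k'\<in>M m. w k' * (real (m - k') * b s (m - k')))"
      by simp
    then have "real m * b s m \<le> real m * b r m + ((\<Sum>k'\<in>M m. w k' * (real (m - k') * b s (m - k')))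
        + (\<Sum>k\<in>M m. real k * w k * b s (m - k)))"
      using rec[of m] by simp
    also have "\<dots> = real m * (b r m + (\<Sum>k\<in>M m. w k * b s (m - k)))"
      unfolding sum.distrib[symmetric] distrib_left sum_distrib_left
      by (intro arg_cong2[of _ _ _ _ "(+)"] sum.cong) (auto simp: M_def of_nat_diff algebra_simps)
    finally have "b s m \<le> b r m + (\<Sum>k\<in>M m. w k * b s (m - k))"
      using False by simp
    then show ?thesis by (simp add: M_def)
  qed (simp add: b_def)
qed

text \<open>A nonnegative coefficient is bounded by the value of its series. Convergence is avoided
  by working with the truncation \<open>P\<close>: its derivative is \<open>G' * P\<close> with
  nonnegative terms dropped, so \<open>P * exp (- G)\<close> does not increase.\<close>

lemma expc_le_exp:
  assumes w: "\<And>k. 0 \<le> w k" and x: "0 \<le> x"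
  shows "x ^ m * expc w m \<le> exp (\<Sum>k\<in>{1..m}. w k * x ^ k)"
proof -
  define P where "P t = (\<Sum>i\<le>m. expc w i * t ^ i)" for t
  define P' where "P' t = (\<Sum>i\<le>m. expc w i * (real i * t ^ (i - 1)))" for t
  define G where "G t = (\<Sum>k\<in>{1..m}. w k * t ^ k)" for t
  define G' where "G' t = (\<Sum>k\<in>{1..m}. w k * (real k * t ^ (k - 1)))" for t
  note e0 = expc_nonneg[OF w]
  have dP: "(P has_real_derivative P' t) (at t)" for t
    unfolding P_def P'_def by (rule derivative_eq_intros refl | simp add: mult_ac)+
  have dG: "(G has_real_derivative G' t) (at t)" for t
    unfolding G_def G'_def by (rule derivative_eq_intros refl | simp add: mult_ac)+
  have le: "P' t \<le> G' t * P t" if t: "0 \<le> t" for t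
  proof -
    have "P' t = (\<Sum>i\<in>{1..m}. real i * expc w i * t ^ (i - 1))"
      unfolding P'_def by (intro sum.mono_neutral_cong_right) auto
    also have "\<dots> = (\<Sum>i\<in>{1..m}. \<Sum>k\<in>{1..i}. real k * w k * t ^ (k - 1) * (expc w (i - k) * t ^ (i - k)))"
    proof (rule sum.cong[OF refl])
      fix i assume i: "i \<in> {1..m}"
      show "real i * expc w i * t ^ (i - 1) = (\<Sum>k\<in>{1..i}. real k * w k * t ^ (k - 1) * (expc w (i - k) * t ^ (i - k)))"
        unfolding expc_rec sum_distrib_right
      proof (rule sum.cong[OF refl])
        fix k assume "k \<in> {1..i}"
        then have "t ^ (i - 1) = t ^ (k - 1) * t ^ (i - k)"
          by (simp add: power_add[symmetric])
        then show "real k * w k * expc w (i - k) * t ^ (i - 1) = real k * w k * t ^ (k - 1) * (expc w (i - k) * t ^ (i - k))"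
          by simp
      qed
    qed
    also have "\<dots> = (\<Sum>(i, k)\<in>Sigma {1..m} (\<lambda>i. {1..i}). real k * w k * t ^ (k - 1) * (expc w (i - k) * t ^ (i - k)))"
      by (simp add: sum.Sigma)
    also have "\<dots> = (\<Sum>(k, j)\<in>{(k, j). 1 \<le> k \<and> k + j \<le> m}. real k * w k * t ^ (k - 1) * (expc w j * t ^ j))"
      by (rule sum.reindex_bij_witness[of _ "\<lambda>(k, j). (k + j, k)" "\<lambda>(i, k). (k, i - k)"]) auto
    also have "\<dots> \<le> (\<Sum>(k, j)\<in>{1..m} \<times> {..m}. real k * w k * t ^ (k - 1) * (expc w j * t ^ j))"
      using t w e0 by (intro sum_mono2) auto
    also have "\<dots> = G' t * P t"
      unfolding G'_def P_def sum_product by (simp add: sum.cartesian_product mult_ac)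
    finally show ?thesis .
  qed
  have "P x * exp (- G x) \<le> P 0 * exp (- G 0)"
  proof (rule DERIV_nonpos_imp_nonincreasing[OF x])
    fix t assume t: "0 \<le> t" "t \<le> x"
    have "((\<lambda>t. P t * exp (- G t)) has_real_derivative (P' t - G' t * P t) * exp (- G t)) (at t)"
      by (rule derivative_eq_intros dP dG refl | simp add: algebra_simps)+
    moreover have "(P' t - G' t * P t) * exp (- G t) \<le> 0"
      using le[OF t(1)] by (simp add: mult_nonpos_nonneg)
    ultimately show "\<exists>y. DERIV (\<lambda>t. P t * exp (- G t)) t :> y \<and> y \<le> 0" by blast
  qed
  moreover have "P 0 = 1" unfolding P_def by (simp add: power_0_left sum.delta if_distrib cong: if_cong)
  moreover have "G 0 = 0" unfolding G_def by (intro sum.neutral) auto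
  ultimately have "P x \<le> exp (G x)" by (simp add: exp_minus field_simps)
  moreover have "expc w m * x ^ m \<le> P x"
    unfolding P_def using x e0 by (intro member_le_sum) auto
  ultimately show ?thesis by (simp add: G_def mult.commute)
qed

section \<open>Decomposition by components\<close>

definition pairs :: "nat set \<Rightarrow> nat set set" where
  "pairs A = {e. \<exists>k l. k \<in> A \<and> l \<in> A \<and> k \<noteq> l \<and> e = {k, l}}"

text \<open>Independent coins on an arbitrary ground set, so that the pairs inside any vertex subset
  form a model of their own.\<close>

definition subset_prob :: "real \<Rightarrow> 'a set \<Rightarrow> ('a set \<Rightarrow> bool) \<Rightarrow> real" where
  "subset_prob p S Q = (\<Sum>E\<in>{E. E \<subseteq> S \<and> Q E}. p ^ card E * (1 - p) ^ (card S - card E))"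

definition comps :: "(nat \<Rightarrow> bool) \<Rightarrow> nat set \<Rightarrow> nat set set \<Rightarrow> bool" where
  "comps P A E \<longleftrightarrow> (\<forall>v\<in>A. P (card (component E v)))"

lemma P_event_eq_subset_prob: "P_event n \<alpha> Q = subset_prob (\<alpha> / real n) (pairs (vertices n)) Q"
  by (simp add: P_event_def subset_prob_def graph_prob_def all_pairs_def pairs_def)

lemma subset_prob_True:
  assumes "finite S"
  shows "subset_prob p S (\<lambda>_. True) = 1"
proof -
  have "(\<Prod>i\<in>S. p + (1 - p)) = (\<Sum>X\<in>Pow S. (\<Prod>i\<in>X. p) * (\<Prod>i\<in>S - X. 1 - p))"
    by (rule prod_add) fact
  also have "\<dots> = subset_prob p S (\<lambda>_. True)"
    unfolding subset_prob_def using assms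
    by (intro sum.cong) (auto simp: card_Diff_subset finite_subset)
  finally show ?thesis by simp
qed

lemma subset_prob_cong: "(\<And>E. E \<subseteq> S \<Longrightarrow> Q E = Q' E) \<Longrightarrow> subset_prob p S Q = subset_prob p S Q'"
  unfolding subset_prob_def by (intro sum.cong) auto

lemma subset_prob_Union:
  assumes "finite S" "finite I" "\<And>i j E. i \<in> I \<Longrightarrow> j \<in> I \<Longrightarrow> E \<subseteq> S \<Longrightarrow> R i E \<Longrightarrow> R j E \<Longrightarrow> i = j"
  shows "subset_prob p S (\<lambda>E. \<exists>i\<in>I. R i E) = (\<Sum>i\<in>I. subset_prob p S (R i))"
proof -
  have "{E. E \<subseteq> S \<and> (\<exists>i\<in>I. R i E)} = (\<Union>i\<in>I. {E. E \<subseteq> S \<and> R i E})" by auto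
  then show ?thesis
    unfolding subset_prob_def using assms by (simp only:) (rule sum.UNION_disjoint, auto)
qed

text \<open>Independence of the coins in \<open>S1\<close> and in \<open>S2\<close>; the last factor
  is the probability that every other coin shows no edge.\<close>

lemma subset_prob_split:
  assumes "finite S" "S1 \<subseteq> S" "S2 \<subseteq> S" "S1 \<inter> S2 = {}"
  shows "subset_prob p S (\<lambda>E. E \<subseteq> S1 \<union> S2 \<and> Q1 (E \<inter> S1) \<and> Q2 (E \<inter> S2))
       = subset_prob p S1 Q1 * subset_prob p S2 Q2 * (1 - p) ^ (card S - card S1 - card S2)"
proof -
  have fin: "finite S1" "finite S2" using assms by (auto dest: finite_subset)
  have c12: "card S1 + card S2 \<le> card S"
    using assms fin by (metis Un_least card_Un_disjoint card_mono)
  have w: "p ^ card E * (1 - p) ^ (card S - card E)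
       = p ^ card (E \<inter> S1) * (1 - p) ^ (card S1 - card (E \<inter> S1)) *
         (p ^ card (E \<inter> S2) * (1 - p) ^ (card S2 - card (E \<inter> S2))) * (1 - p) ^ (card S - card S1 - card S2)"
    if E: "E \<subseteq> S1 \<union> S2" for E
  proof -
    have "E = (E \<inter> S1) \<union> (E \<inter> S2)" using E by auto
    then have "card E = card (E \<inter> S1) + card (E \<inter> S2)"
      using fin assms by (metis (no_types, lifting) card_Un_disjoint finite_Int inf_bot_right inf_sup_aci(3) inf_assoc)
    moreover have "card (E \<inter> S1) \<le> card S1" "card (E \<inter> S2) \<le> card S2"
      using fin by (auto intro: card_mono)
    ultimately have "card E = card (E \<inter> S1) + card (E \<inter> S2)"
      "card S - card E = (card S1 - card (E \<inter> S1)) + (card S2 - card (E \<inter> S2)) + (card S - card S1 - card S2)"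
      using c12 by auto
    then show ?thesis by (simp only: power_add mult_ac)
  qed
  have "subset_prob p S (\<lambda>E. E \<subseteq> S1 \<union> S2 \<and> Q1 (E \<inter> S1) \<and> Q2 (E \<inter> S2))
      = (\<Sum>(E1, E2)\<in>{E. E \<subseteq> S1 \<and> Q1 E} \<times> {E. E \<subseteq> S2 \<and> Q2 E}.
          p ^ card E1 * (1 - p) ^ (card S1 - card E1) * (p ^ card E2 * (1 - p) ^ (card S2 - card E2))
          * (1 - p) ^ (card S - card S1 - card S2))"
    unfolding subset_prob_def
  proof (rule sum.reindex_bij_witness[of _ "\<lambda>(E1, E2). E1 \<union> E2" "\<lambda>E. (E \<inter> S1, E \<inter> S2)"], goal_cases)
    case (4 x)
    have "(E1 \<union> E2) \<inter> S1 = E1" "(E1 \<union> E2) \<inter> S2 = E2" if "E1 \<subseteq> S1" "E2 \<subseteq> S2" for E1 E2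
      using that assms by auto
    then show ?case using 4 assms by auto
  next
    case (3 x)
    have "(E1 \<union> E2) \<inter> S1 = E1" "(E1 \<union> E2) \<inter> S2 = E2" if "E1 \<subseteq> S1" "E2 \<subseteq> S2" for E1 E2
      using that assms by auto
    then show ?case using 3 assms by auto
  next
    case (5 x)
    then show ?case using w[of x] by auto
  qed auto
  then show ?thesis
    unfolding subset_prob_def sum_product by (simp add: sum_distrib_right sum.cartesian_product case_prod_unfold)
qed

section \<open>Pairs, components and their restriction to vertex subsets\<close>

lemma pairs_mono: "B \<subseteq> A \<Longrightarrow> pairs B \<subseteq> pairs A"
  by (auto simp: pairs_def)

lemma pairs_disjoint: "B \<inter> C = {} \<Longrightarrow> pairs B \<inter> pairs C = {}"
  by (auto simp: pairs_def doubleton_eq_iff)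

lemma pairs_eq_subsets: "pairs A = {e. e \<subseteq> A \<and> card e = 2}"
  by (auto simp: pairs_def card_2_iff)

lemma finite_pairs: "finite A \<Longrightarrow> finite (pairs A)"
  by (simp add: pairs_eq_subsets)

lemma card_pairs: "finite A \<Longrightarrow> card (pairs A) = card A choose 2"
  by (simp add: pairs_eq_subsets n_subsets)

text \<open>Pairs inside a disjoint union lie in one part or go across. Hence powers of
  \<open>1 - p\<close> with exponent \<open>k choose 2\<close> can account for the absent edges
  between components.\<close>

lemma choose_two_add: "(b + c) choose 2 = (b choose 2) + (c choose 2) + b * (c::nat)"
  by (induction b) (auto simp: numeral_2_eq_2)

lemma adj_sym: "(u, w) \<in> adj E \<Longrightarrow> (w, u) \<in> adj E"
  by (simp add: adj_def insert_commute)

lemma component_self: "v \<in> component E v"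
  by (simp add: component_def)

lemma component_eq:
  assumes "w \<in> component E v"
  shows "component E w = component E v"
proof -
  have "sym ((adj E)\<^sup>*)" by (intro sym_rtrancl symI) (rule adj_sym)
  with assms show ?thesis
    unfolding component_def by (auto dest: symD intro: rtrancl_trans)
qed

lemma component_step: "u \<in> component E v \<Longrightarrow> {u, w} \<in> E \<Longrightarrow> w \<in> component E v"
  by (auto simp: component_def adj_def intro: rtrancl_into_rtrancl)

lemma component_restrict:
  assumes "E \<subseteq> pairs B \<union> pairs C" "B \<inter> C = {}" "v \<in> B"
  shows "component E v = component (E \<inter> pairs B) v" "component E v \<subseteq> B"
proof -
  have *: "w \<in> B \<and> (v, w) \<in> (adj (E \<inter> pairs B))\<^sup>*" if "(v, w) \<in> (adj E)\<^sup>*" for w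
    using that
  proof (induction rule: rtrancl_induct)
    case (step y z)
    then have yz: "{y, z} \<in> E" "y \<in> B" by (auto simp: adj_def)
    have "{y, z} \<in> pairs B"
    proof (rule ccontr)
      assume "{y, z} \<notin> pairs B"
      with yz assms have "{y, z} \<in> pairs C" by auto
      then have "y \<in> C" by (auto simp: pairs_def doubleton_eq_iff)
      with yz assms show False by auto
    qed
    then have "z \<in> B" "(y, z) \<in> adj (E \<inter> pairs B)"
      using yz by (auto simp: pairs_def doubleton_eq_iff adj_def)
    with step show ?case by (auto intro: rtrancl_into_rtrancl)
  qed (use assms in auto)
  moreover have "(adj (E \<inter> pairs B))\<^sup>* \<subseteq> (adj E)\<^sup>*"
    by (rule rtrancl_mono) (auto simp: adj_def)
  ultimately show "component E v = component (E \<inter> pairs B) v" "component E v \<subseteq> B"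
    by (auto simp: component_def)
qed

lemma component_subset: "E \<subseteq> pairs A \<Longrightarrow> v \<in> A \<Longrightarrow> component E v \<subseteq> A"
  using component_restrict(2)[of E A "{}"] by auto

lemma closed_split:
  assumes "E \<subseteq> pairs A" "\<And>u w. u \<in> B \<Longrightarrow> {u, w} \<in> E \<Longrightarrow> w \<in> B"
  shows "E \<subseteq> pairs B \<union> pairs (A - B)"
proof
  fix e assume e: "e \<in> E"
  then obtain k l where kl: "k \<in> A" "l \<in> A" "k \<noteq> l" "e = {k, l}" using assms by (auto simp: pairs_def)
  then have "k \<in> B \<longleftrightarrow> l \<in> B" using assms(2)[of k l] assms(2)[of l k] e by (auto simp: insert_commute)
  with kl show "e \<in> pairs B \<union> pairs (A - B)" unfolding pairs_def by blast
qed

lemma subset_prob_two_parts: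
  assumes "finite A" "B \<subseteq> A"
  shows "subset_prob p (pairs A) (\<lambda>E. E \<subseteq> pairs B \<union> pairs (A - B) \<and> Q1 (E \<inter> pairs B) \<and> Q2 (E \<inter> pairs (A - B)))
       = subset_prob p (pairs B) Q1 * subset_prob p (pairs (A - B)) Q2 * (1 - p) ^ (card B * card (A - B))"
proof -
  have fin: "finite B" "finite (A - B)" using assms finite_subset by auto
  then have "card A = card B + card (A - B)" using assms by (simp add: card_Diff_subset card_mono)
  then have "card (pairs A) - card (pairs B) - card (pairs (A - B)) = card B * card (A - B)"
    using fin assms by (simp add: card_pairs choose_two_add)
  then show ?thesis
    using subset_prob_split[of "pairs A" "pairs B" "pairs (A - B)" p Q1 Q2] assms
    by (simp add: finite_pairs pairs_mono pairs_disjoint)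
qed

text \<open>The event is cut along the component \<open>B\<close> of a fixed vertex. The conjuncts
  on the right look at disjoint sets of pairs, which is the form that
  \<open>subset_prob_two_parts\<close> factorises.\<close>

lemma comps_split:
  assumes "finite A" "v \<in> A" "E \<subseteq> pairs A"
  shows "comps P A E \<longleftrightarrow> (\<exists>B\<in>{B. B \<subseteq> A \<and> v \<in> B \<and> P (card B)}.
    E \<subseteq> pairs B \<union> pairs (A - B) \<and> component (E \<inter> pairs B) v = B \<and> comps P (A - B) (E \<inter> pairs (A - B)))"
    (is "?L \<longleftrightarrow> (\<exists>B\<in>?I. ?R B)")
proof
  assume L: ?L
  define B where "B = component E v"
  have B: "B \<subseteq> A" "v \<in> B" using assms component_subset[of E A v] by (auto simp: B_def component_self)
  have split: "E \<subseteq> pairs B \<union> pairs (A - B)"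
    using assms(3) by (rule closed_split) (auto simp: B_def intro: component_step)
  have "P (card B)" using L assms by (auto simp: comps_def B_def)
  moreover have "component (E \<inter> pairs B) v = B"
    using component_restrict(1)[OF split _ B(2)] by (auto simp: B_def)
  moreover have "comps P (A - B) (E \<inter> pairs (A - B))"
    unfolding comps_def
  proof
    fix u assume u: "u \<in> A - B"
    have "component E u = component (E \<inter> pairs (A - B)) u"
      by (rule component_restrict(1)[of _ _ B]) (use split u in auto)
    then show "P (card (component (E \<inter> pairs (A - B)) u))" using L u by (auto simp: comps_def)
  qed
  ultimately show "\<exists>B\<in>?I. ?R B" using B split by blast
next
  assume "\<exists>B\<in>?I. ?R B"
  then obtain B where B: "B \<in> ?I" "?R B" by blast
  then have split: "E \<subseteq> pairs B \<union> pairs (A - B)" by simp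
  have cv: "component E v = B" using component_restrict(1)[OF split, of v] B by auto
  show ?L
    unfolding comps_def
  proof
    fix u assume u: "u \<in> A"
    show "P (card (component E u))"
    proof (cases "u \<in> B")
      case True
      then have "component E u = B" using cv component_eq by auto
      then show ?thesis using B by simp
    next
      case False
      have "component E u = component (E \<inter> pairs (A - B)) u"
        by (rule component_restrict(1)[of _ _ B]) (use split u False in auto)
      then show ?thesis using B u False by (auto simp: comps_def)
    qed
  qed
qed

lemma subset_prob_comps_rec:
  assumes "finite A" "v \<in> A"
  shows "subset_prob p (pairs A) (comps P A) = (\<Sum>B\<in>{B. B \<subseteq> A \<and> v \<in> B \<and> P (card B)}.
     subset_prob p (pairs B) (\<lambda>E. component E v = B) * subset_prob p (pairs (A - B)) (comps P (A - B))
     * (1 - p) ^ (card B * card (A - B)))"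
proof -
  define R where "R B E \<longleftrightarrow> E \<subseteq> pairs B \<union> pairs (A - B) \<and> component (E \<inter> pairs B) v = B
      \<and> comps P (A - B) (E \<inter> pairs (A - B))" for B E
  define I where "I = {B. B \<subseteq> A \<and> v \<in> B \<and> P (card B)}"
  have "subset_prob p (pairs A) (comps P A) = subset_prob p (pairs A) (\<lambda>E. \<exists>B\<in>I. R B E)"
    unfolding I_def R_def using comps_split[OF assms] by (rule subset_prob_cong)
  also have "\<dots> = (\<Sum>B\<in>I. subset_prob p (pairs A) (R B))"
  proof (rule subset_prob_Union)
    fix B C E assume *: "B \<in> I" "C \<in> I" "R B E" "R C E"
    have "component E v = B" if "B \<in> I" "R B E" for B
      using that component_restrict(1)[of E B "A - B" v] by (auto simp: R_def I_def)
    with * show "B = C" by metis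
  qed (use assms in \<open>auto simp: I_def finite_pairs\<close>)
  also have "\<dots> = (\<Sum>B\<in>I. subset_prob p (pairs B) (\<lambda>E. component E v = B) * subset_prob p (pairs (A - B)) (comps P (A - B))
     * (1 - p) ^ (card B * card (A - B)))"
    unfolding R_def by (intro sum.cong subset_prob_two_parts refl) (use assms in \<open>auto simp: I_def\<close>)
  finally show ?thesis unfolding I_def .
qed

lemma sum_subsets_containing:
  fixes g :: "nat \<Rightarrow> real"
  assumes "finite A" "v \<in> A"
  shows "(\<Sum>B\<in>{B. B \<subseteq> A \<and> v \<in> B}. g (card B)) = (\<Sum>j\<le>card A - 1. real ((card A - 1) choose j) * g (Suc j))"
proof -
  have "(\<Sum>B\<in>{B. B \<subseteq> A \<and> v \<in> B}. g (card B)) = (\<Sum>C\<in>Pow (A - {v}). g (Suc (card C)))"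
  proof (rule sum.reindex_bij_witness[of _ "insert v" "\<lambda>B. B - {v}"], goal_cases)
    case (5 B)
    then have "finite B" using assms finite_subset by auto
    then have "card B = Suc (card (B - {v}))" using 5 by (intro card.remove) auto
    then show ?case by simp
  qed (use assms in auto)
  also have "\<dots> = (\<Sum>j\<in>{..card A - 1}. \<Sum>C\<in>{C \<in> Pow (A - {v}). card C = j}. g (Suc (card C)))"
  proof (rule sum.group[symmetric])
    show "card ` Pow (A - {v}) \<subseteq> {..card A - 1}"
    proof
      fix k assume "k \<in> card ` Pow (A - {v})"
      then obtain C where "C \<subseteq> A - {v}" "k = card C" by blast
      then have "k \<le> card (A - {v})" using assms card_mono[of "A - {v}" C] by blast
      then show "k \<in> {..card A - 1}" using assms by simp
    qed
  qed (use assms in auto)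
  also have "\<dots> = (\<Sum>j\<le>card A - 1. real ((card A - 1) choose j) * g (Suc j))"
  proof (rule sum.cong[OF refl])
    fix j
    have "(\<Sum>C\<in>{C \<in> Pow (A - {v}). card C = j}. g (Suc (card C)))
        = (\<Sum>C\<in>{C. C \<subseteq> A - {v} \<and> card C = j}. g (Suc j))"
      by (intro sum.cong) auto
    then show "(\<Sum>C\<in>{C \<in> Pow (A - {v}). card C = j}. g (Suc (card C)))
        = real ((card A - 1) choose j) * g (Suc j)"
      using assms n_subsets[of "A - {v}" j] by simp
  qed
  finally show ?thesis .
qed

text \<open>Both sides satisfy the same total probability identity over the component of
  \<open>v\<close>. By induction they agree on all proper subsets of \<open>B\<close>, so the
  remaining term, that of \<open>B\<close> itself, agrees too.\<close>

lemma subset_prob_connected: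
  assumes "finite B" "v \<in> B"
  shows "subset_prob p (pairs B) (\<lambda>E. component E v = B) = conn p (card B)"
  using assms
proof (induction "card B" arbitrary: B rule: less_induct)
  case less
  define c where "c C = subset_prob p (pairs C) (\<lambda>E. component E v = C)" for C
  define h where "h k = (1 - p) ^ (k * (card B - k))" for k
  define I where "I = {C. C \<subseteq> B \<and> v \<in> C}"
  have fI: "finite I" "B \<in> I" using less.prems by (auto simp: I_def)
  \<comment> \<open>A vacuous condition on the component sizes turns the decomposition into a
    statement about total mass.\<close>
  have True1: "subset_prob p (pairs C) (comps (\<lambda>_. True) C) = 1" if "finite C" for C
    using subset_prob_True[of "pairs C" p] that by (simp add: comps_def[abs_def] finite_pairs)
  have "1 = (\<Sum>C\<in>I. c C * h (card C))"
  proof -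
    have "1 = (\<Sum>C\<in>I. c C * subset_prob p (pairs (B - C)) (comps (\<lambda>_. True) (B - C)) * (1 - p) ^ (card C * card (B - C)))"
      using subset_prob_comps_rec[OF less.prems, of p "\<lambda>_. True"] True1[OF less.prems(1)] by (simp add: I_def c_def)
    also have "\<dots> = (\<Sum>C\<in>I. c C * h (card C))"
    proof (rule sum.cong[OF refl])
      fix C assume "C \<in> I"
      then have "card (B - C) = card B - card C"
        using less.prems by (intro card_Diff_subset) (auto simp: I_def finite_subset)
      then show "c C * subset_prob p (pairs (B - C)) (comps (\<lambda>_. True) (B - C)) * (1 - p) ^ (card C * card (B - C)) = c C * h (card C)"
        using True1[of "B - C"] less.prems by (simp add: h_def)
    qed
    finally show ?thesis .
  qed
  moreover have "1 = (\<Sum>C\<in>I. conn p (card C) * h (card C))"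
  proof -
    have "card B > 0" using less.prems card_gt_0_iff by auto
    then show ?thesis
      unfolding I_def sum_subsets_containing[OF less.prems, of "\<lambda>k. conn p k * h k"]
      using conn_total[of "card B - 1" p] by (simp add: h_def mult.assoc)
  qed
  moreover have "(\<Sum>C\<in>I - {B}. c C * h (card C)) = (\<Sum>C\<in>I - {B}. conn p (card C) * h (card C))"
  proof (intro sum.cong refl)
    fix C assume "C \<in> I - {B}"
    then have "C \<subset> B" "v \<in> C" "finite C" using less.prems by (auto simp: I_def finite_subset)
    then show "c C * h (card C) = conn p (card C) * h (card C)"
      using less.hyps[of C] less.prems by (simp add: c_def psubset_card_mono)
  qed
  ultimately have "c B * h (card B) = conn p (card B) * h (card B)"
    unfolding sum.remove[OF fI] by linarith
  then show ?case by (simp add: h_def c_def)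
qed

text \<open>The probability that every component of \<open>G(m, p)\<close> has a size satisfying \<open>P\<close>.\<close>
fun comps_prob :: "real \<Rightarrow> (nat \<Rightarrow> bool) \<Rightarrow> nat \<Rightarrow> real" where
  "comps_prob p P m = (if m = 0 then 1 else \<Sum>j<m. real ((m - 1) choose j) *
     (if P (Suc j) then conn p (Suc j) else 0) * (1 - p) ^ (Suc j * (m - Suc j)) * comps_prob p P (m - Suc j))"

declare comps_prob.simps [simp del]

lemma subset_prob_comps:
  assumes "finite A"
  shows "subset_prob p (pairs A) (comps P A) = comps_prob p P (card A)"
  using assms
proof (induction "card A" arbitrary: A rule: less_induct)
  case less
  show ?case
  proof (cases "A = {}")
    case True
    then show ?thesis using subset_prob_True[of "{}" p]
      by (simp add: comps_prob.simps pairs_def comps_def[abs_def])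
  next
    case False
    then obtain v where v: "v \<in> A" by auto
    define g where "g k = (if P k then conn p k else 0) * (1 - p) ^ (k * (card A - k)) * comps_prob p P (card A - k)" for k
    have cA: "card A > 0" using less.prems v card_gt_0_iff by auto
    have "subset_prob p (pairs A) (comps P A) = (\<Sum>B\<in>{B. B \<subseteq> A \<and> v \<in> B \<and> P (card B)}. g (card B))"
      unfolding subset_prob_comps_rec[OF less.prems v]
    proof (rule sum.cong[OF refl])
      fix B assume B: "B \<in> {B. B \<subseteq> A \<and> v \<in> B \<and> P (card B)}"
      then have fB: "finite B" using less.prems finite_subset by auto
      have "card (A - B) < card A" using B v less.prems by (intro psubset_card_mono) auto
      then have "subset_prob p (pairs (A - B)) (comps P (A - B)) = comps_prob p P (card (A - B))"
        using less by auto
      then show "subset_prob p (pairs B) (\<lambda>E. component E v = B) * subset_prob p (pairs (A - B)) (comps P (A - B))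
          * (1 - p) ^ (card B * card (A - B)) = g (card B)"
        using B fB subset_prob_connected[of B v p] by (simp add: g_def card_Diff_subset)
    qed
    also have "\<dots> = (\<Sum>B\<in>{B. B \<subseteq> A \<and> v \<in> B}. g (card B))"
      using less.prems by (intro sum.mono_neutral_left) (auto simp: g_def)
    also have "\<dots> = (\<Sum>j\<le>card A - 1. real ((card A - 1) choose j) * g (Suc j))"
      by (rule sum_subsets_containing[OF less.prems v])
    also have "\<dots> = comps_prob p P (card A)"
      using cA by (subst comps_prob.simps) (auto simp: g_def mult.assoc intro!: sum.cong)
    finally show ?thesis .
  qed
qed

lemma bigV_prob:
  assumes "m \<le> n"
  shows "P_event n \<alpha> (\<lambda>E. card (bigV n E r) = m)
    = real (n choose m) * (1 - \<alpha> / real n) ^ (m * (n - m))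
      * comps_prob (\<alpha> / real n) (\<lambda>k. r < real k) m * comps_prob (\<alpha> / real n) (\<lambda>k. real k \<le> r) (n - m)"
proof -
  define p A where "p = \<alpha> / real n" and "A = vertices n"
  define I where "I = {B. B \<subseteq> A \<and> card B = m}"
  define R where "R B E \<longleftrightarrow> E \<subseteq> pairs B \<union> pairs (A - B) \<and> comps (\<lambda>k. r < real k) B (E \<inter> pairs B)
      \<and> comps (\<lambda>k. real k \<le> r) (A - B) (E \<inter> pairs (A - B))" for B E
  have A: "finite A" "card A = n" by (auto simp: A_def vertices_def)
  \<comment> \<open>Disjointness: \<open>R B E\<close> forces \<open>B\<close> to be the set of
    vertices in large components.\<close>
  have bigR: "bigV n E r = B" if "B \<in> I" "R B E" for B E
  proof -
    have "component E v = component (E \<inter> pairs B) v" if "v \<in> B" for v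
      by (rule component_restrict(1)[of _ _ "A - B"]) (use \<open>R B E\<close> that in \<open>auto simp: R_def\<close>)
    then have gt: "r < real (card (component E v))" if "v \<in> B" for v
      using that \<open>R B E\<close> by (simp add: R_def comps_def)
    have "component E v = component (E \<inter> pairs (A - B)) v" if "v \<in> A - B" for v
      by (rule component_restrict(1)[of _ _ B]) (use \<open>R B E\<close> that in \<open>auto simp: R_def\<close>)
    then have le: "real (card (component E v)) \<le> r" if "v \<in> A - B" for v
      using that \<open>R B E\<close> by (simp add: R_def comps_def)
    have "B \<subseteq> A" using \<open>B \<in> I\<close> by (simp add: I_def)
    then show ?thesis
      unfolding bigV_def A_def[symmetric] using gt le by (force simp: not_less)
  qed
  \<comment> \<open>Exhaustiveness: that set always satisfies \<open>R\<close>.\<close>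
  have Rbig: "R (bigV n E r) E" if E: "E \<subseteq> pairs A" for E
  proof -
    define B where "B = bigV n E r"
    have B: "B \<subseteq> A" by (auto simp: B_def bigV_def A_def)
    have split: "E \<subseteq> pairs B \<union> pairs (A - B)"
      using E
    proof (rule closed_split)
      fix u w assume uw: "u \<in> B" "{u, w} \<in> E"
      then have "w \<in> component E u" by (metis component_self component_step)
      moreover from this have "w \<in> A" using component_subset[OF E, of u] uw B by auto
      ultimately show "w \<in> B"
        using uw component_eq[of w E u] by (auto simp: B_def bigV_def A_def)
    qed
    have c1: "component E v = component (E \<inter> pairs B) v" if "v \<in> B" for v
      by (rule component_restrict(1)[OF split _ that]) auto
    have c2: "component E v = component (E \<inter> pairs (A - B)) v" if "v \<in> A - B" for v
      by (rule component_restrict(1)[of _ _ B]) (use split that in auto)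
    have "r < real (card (component E v))" if "v \<in> B" for v
      using that by (simp add: B_def bigV_def)
    then have "comps (\<lambda>k. r < real k) B (E \<inter> pairs B)"
      unfolding comps_def using c1 by simp
    moreover have "real (card (component E v)) \<le> r" if "v \<in> A - B" for v
      using that by (simp add: B_def bigV_def A_def not_less)
    then have "comps (\<lambda>k. real k \<le> r) (A - B) (E \<inter> pairs (A - B))"
      unfolding comps_def using c2 by simp
    moreover note split
    ultimately show ?thesis by (simp add: R_def B_def)
  qed
  have "P_event n \<alpha> (\<lambda>E. card (bigV n E r) = m) = subset_prob p (pairs A) (\<lambda>E. \<exists>B\<in>I. R B E)"
    unfolding P_event_eq_subset_prob p_def[symmetric] A_def[symmetric]
  proof (rule subset_prob_cong)
    fix E assume E: "E \<subseteq> pairs A"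
    show "(card (bigV n E r) = m) = (\<exists>B\<in>I. R B E)"
    proof
      assume "card (bigV n E r) = m"
      then have "bigV n E r \<in> I" by (auto simp: I_def bigV_def A_def)
      then show "\<exists>B\<in>I. R B E" using Rbig[OF E] by blast
    next
      assume "\<exists>B\<in>I. R B E"
      then obtain B where "B \<in> I" "R B E" by blast
      then have "bigV n E r = B" by (rule bigR)
      with \<open>B \<in> I\<close> show "card (bigV n E r) = m" by (simp add: I_def)
    qed
  qed
  also have "\<dots> = (\<Sum>B\<in>I. subset_prob p (pairs A) (R B))"
  proof (rule subset_prob_Union)
    show "finite I" using A by (simp add: I_def)
  next
    fix B C E assume "B \<in> I" "C \<in> I" "R B E" "R C E"
    then show "B = C" using bigR by blast
  qed (use A in \<open>simp add: finite_pairs\<close>)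
  also have "\<dots> = (\<Sum>B\<in>I. comps_prob p (\<lambda>k. r < real k) m * comps_prob p (\<lambda>k. real k \<le> r) (n - m) * (1 - p) ^ (m * (n - m)))"
  proof (rule sum.cong[OF refl])
    fix B assume "B \<in> I"
    then have B: "B \<subseteq> A" "card B = m" "finite B" "card (A - B) = n - m"
      using A by (auto simp: I_def finite_subset card_Diff_subset)
    then show "subset_prob p (pairs A) (R B) = comps_prob p (\<lambda>k. r < real k) m * comps_prob p (\<lambda>k. real k \<le> r) (n - m) * (1 - p) ^ (m * (n - m))"
      unfolding R_def using subset_prob_two_parts[OF A(1) B(1), of p] A by (simp add: subset_prob_comps)
  qed
  also have "\<dots> = real (n choose m) * (comps_prob p (\<lambda>k. r < real k) m * comps_prob p (\<lambda>k. real k \<le> r) (n - m) * (1 - p) ^ (m * (n - m)))"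
    using n_subsets[OF A(1), of m] A by (simp add: I_def)
  finally show ?thesis by (simp add: p_def mult_ac)
qed

text \<open>Exponential formula. The factors for absent edges between components equal
  \<open>(1 - p) ^ (m choose 2)\<close> divided by \<open>(1 - p) ^ (k choose 2)\<close> for every
  component, so they split into a global factor and a change of the weights; \<open>p < 1\<close>
  permits the division.\<close>

lemma comps_prob_eq_expc:
  assumes "p < 1"
  shows "comps_prob p P m = fact m * (1 - p) ^ (m choose 2) *
    expc (\<lambda>k. if P k then conn p k / ((1 - p) ^ (k choose 2) * fact k) else 0) m"
proof (induction m rule: less_induct)
  case (less m)
  define w where "w k = (if P k then conn p k / ((1 - p) ^ (k choose 2) * fact k) else 0)" for k
  show ?case
  proof (cases "m = 0")
    case False
    have summand: "real ((m - 1) choose j) * (if P (Suc j) then conn p (Suc j) else 0) * (1 - p) ^ (Suc j * (m - Suc j)) * comps_prob p P (m - Suc j)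
        = fact (m - 1) * (1 - p) ^ (m choose 2) * (real (Suc j) * w (Suc j) * expc w (m - Suc j))" if j: "j < m" for j
    proof -
      have e: "m choose 2 = (Suc j choose 2) + ((m - Suc j) choose 2) + Suc j * (m - Suc j)"
        using j choose_two_add[of "Suc j" "m - Suc j"] by simp
      have wj: "(if P (Suc j) then conn p (Suc j) else 0) = w (Suc j) * ((1 - p) ^ (Suc j choose 2) * fact (Suc j))"
        using assms by (simp add: w_def)
      have b: "real ((m - 1) choose j) * fact (m - Suc j) = fact (m - 1) / fact j"
        using j by (simp add: binomial_fact)
      have "comps_prob p P (m - Suc j) = fact (m - Suc j) * (1 - p) ^ ((m - Suc j) choose 2) * expc w (m - Suc j)"
        unfolding w_def using j by (intro less) simp
      then have "real ((m - 1) choose j) * (if P (Suc j) then conn p (Suc j) else 0) * (1 - p) ^ (Suc j * (m - Suc j)) * comps_prob p P (m - Suc j)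
          = (real ((m - 1) choose j) * fact (m - Suc j)) * (w (Suc j) * ((1 - p) ^ (Suc j choose 2) * fact (Suc j)))
            * ((1 - p) ^ (Suc j * (m - Suc j)) * (1 - p) ^ ((m - Suc j) choose 2)) * expc w (m - Suc j)"
        unfolding wj by (simp only: mult_ac)
      also have "\<dots> = fact (m - 1) / fact j * (w (Suc j) * ((1 - p) ^ (Suc j choose 2) * fact (Suc j)))
            * ((1 - p) ^ (Suc j * (m - Suc j)) * (1 - p) ^ ((m - Suc j) choose 2)) * expc w (m - Suc j)"
        unfolding b ..
      also have "\<dots> = fact (m - 1) * (1 - p) ^ (m choose 2) * (real (Suc j) * w (Suc j) * expc w (m - Suc j))"
        unfolding e power_add by (simp add: fact_Suc del: of_nat_Suc)
      finally show ?thesis .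
    qed
    have "comps_prob p P m = (\<Sum>j<m. fact (m - 1) * (1 - p) ^ (m choose 2) * (real (Suc j) * w (Suc j) * expc w (m - Suc j)))"
      using False summand by (subst comps_prob.simps) (auto intro!: sum.cong)
    also have "\<dots> = fact (m - 1) * (1 - p) ^ (m choose 2) * (real m * expc w m)"
      unfolding sum_distrib_left[symmetric] using False by (subst (2) expc.simps) simp
    also have "\<dots> = fact m * (1 - p) ^ (m choose 2) * expc w m"
      using False by (simp add: fact_reduce)
    finally show ?thesis unfolding w_def .
  qed (simp add: comps_prob.simps numeral_2_eq_2)
qed

section \<open>The tree function\<close>

text \<open>Cayley's number of forests on \<open>m + b\<close> labelled vertices with
  \<open>b\<close> prescribed roots. For \<open>m = 0\<close> the truncated exponent would give
  \<open>b\<close> instead of 1.\<close>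

definition forest :: "nat \<Rightarrow> nat \<Rightarrow> real" where
  "forest m b = (if m = 0 then 1 else real b * real (m + b) ^ (m - 1))"

text \<open>Deleting one root makes its \<open>j\<close> children roots of the remaining
  forest.\<close>

lemma forest_rec: "forest m (Suc b) = (\<Sum>j\<le>m. real (m choose j) * forest (m - j) (b + j))"
proof (cases "m = 0")
  case False
  define s where "s = real (m + b)"
  have s: "s > 0" using False by (simp add: s_def)
  have f: "forest (m - j) (b + j) = (real b + real j) * s ^ (m - j) / s" if "j \<le> m" for j
  proof (cases "j = m")
    case True
    then show ?thesis using s by (simp add: forest_def s_def)
  next
    case False
    with that have "m - j = Suc (m - j - 1)" "m - j + (b + j) = m + b" by auto
    then have "s ^ (m - j) = s * s ^ (m - j - 1)" by (metis power_Suc)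
    then show ?thesis using s that False by (simp add: forest_def s_def)
  qed
  have "(\<Sum>j\<le>m. real (m choose j) * forest (m - j) (b + j))
      = (\<Sum>j\<le>m. (real b * (real (m choose j) * 1 ^ j * s ^ (m - j)) + real (m choose j) * real j * 1 ^ j * s ^ (m - j)) / s)"
  proof (rule sum.cong[OF refl])
    fix j assume "j \<in> {..m}"
    then have "j \<le> m" by simp
    then show "real (m choose j) * forest (m - j) (b + j)
        = (real b * (real (m choose j) * 1 ^ j * s ^ (m - j)) + real (m choose j) * real j * 1 ^ j * s ^ (m - j)) / s"
      by (simp only: f power_one) (simp add: distrib_left distrib_right mult_ac)
  qed
  also have "\<dots> = (real b * (1 + s) ^ m + real m * 1 * (1 + s) ^ (m - 1)) / s"
    unfolding sum_divide_distrib[symmetric] sum.distrib sum_index_binomial sum_distrib_left[symmetric]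
      binomial_ring[symmetric] by simp
  also have "(1 + s) ^ m = (1 + s) * (1 + s) ^ (m - 1)" using False by (cases m) auto
  also have "(real b * ((1 + s) * (1 + s) ^ (m - 1)) + real m * 1 * (1 + s) ^ (m - 1)) / s
      = (real b * (1 + s) + real m) * (1 + s) ^ (m - 1) / s"
    by (simp add: algebra_simps)
  also have "real b * (1 + s) + real m = s * real (Suc b)" by (simp add: s_def algebra_simps)
  also have "s * real (Suc b) * (1 + s) ^ (m - 1) / s = forest m (Suc b)"
    using s False by (simp add: forest_def s_def add_ac)
  finally show ?thesis ..
qed (simp add: forest_def)

text \<open>Abel's binomial theorem. Expanding \<open>forest j b\<close> by its recursion and
  regrouping moves the \<open>i\<close> children of the deleted root to the roots, after which the
  base \<open>m + a + b'\<close> no longer depends on \<open>i\<close>.\<close>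

lemma abel_identity:
  "(\<Sum>j\<le>m. real (m choose j) * (forest j b * real (m - j + a) ^ (m - j))) = real (m + a + b) ^ m"
proof (induction "m + b" arbitrary: m b)
  case 0
  then show ?case by (simp add: forest_def)
next
  case (Suc s)
  show ?case
  proof (cases b)
    case 0
    have "(\<Sum>j\<le>m. real (m choose j) * (forest j b * real (m - j + a) ^ (m - j)))
        = (\<Sum>j\<in>{0}. real (m choose j) * (forest j b * real (m - j + a) ^ (m - j)))"
      using 0 by (intro sum.mono_neutral_right) (auto simp: forest_def)
    then show ?thesis using 0 by (simp add: forest_def)
  next
    case (Suc b')
    define g where "g i j l = forest j (b' + i) * real (l + a) ^ l" for i j l
    have "(\<Sum>j\<le>m. real (m choose j) * (forest j b * real (m - j + a) ^ (m - j)))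
        = (\<Sum>j\<le>m. real (m choose j) * (\<Sum>i\<le>j. real (j choose i) * g i (j - i) (m - j)))"
      unfolding Suc forest_rec g_def by (simp add: sum_distrib_right mult.assoc)
    also have "\<dots> = (\<Sum>i\<le>m. real (m choose i) * (\<Sum>j\<le>m - i. real ((m - i) choose j) * g i j (m - i - j)))"
      by (rule binomial_sum_reassoc)
    also have "\<dots> = (\<Sum>i\<le>m. real (m choose i) * 1 ^ i * real (m + a + b') ^ (m - i))"
    proof (rule sum.cong[OF refl])
      fix i assume i: "i \<in> {..m}"
      have "(\<Sum>j\<le>m - i. real ((m - i) choose j) * g i j (m - i - j)) = real (m - i + a + (b' + i)) ^ (m - i)"
        unfolding g_def using i Suc.hyps(2) Suc by (intro Suc.hyps(1)) auto
      moreover have "m - i + a + (b' + i) = m + a + b'" using i by simp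
      ultimately show "real (m choose i) * (\<Sum>j\<le>m - i. real ((m - i) choose j) * g i j (m - i - j))
          = real (m choose i) * 1 ^ i * real (m + a + b') ^ (m - i)"
        by (simp only: power_one mult_1_right)
    qed
    also have "\<dots> = (1 + real (m + a + b')) ^ m"
      by (simp only: binomial_ring)
    also have "1 + real (m + a + b') = real (m + a + b)" using Suc by simp
    finally show ?thesis .
  qed
qed

section \<open>Power series of labelled trees\<close>

lemma power_div_fact_le_exp:
  assumes "0 \<le> (x::real)"
  shows "x ^ n / fact n \<le> exp x"
proof -
  have s: "(\<lambda>n. x ^ n / fact n) sums exp x" using exp_converges[of x] by (simp add: field_simps)
  have "(\<Sum>k\<in>{n}. x ^ k / fact k) \<le> (\<Sum>k. x ^ k / fact k)"
    using assms s by (intro sum_le_suminf) (auto simp: sums_iff)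
  then show ?thesis using s by (simp add: sums_iff)
qed

text \<open>Coefficients of the exponential generating function of unrooted labelled trees; for
  \<open>k = 1\<close> the truncated exponent is 0 and the value 1.\<close>

definition treec :: "nat \<Rightarrow> real" where
  "treec k = (if k = 0 then 0 else real k ^ (k - 2) / fact k)"

text \<open>Shifted coefficients of rooted trees: \<open>y\<close> times this series is the tree
  function.\<close>

definition treew :: "nat \<Rightarrow> real" where
  "treew m = forest m 1 / fact m"

lemma treec_nonneg: "0 \<le> treec k"
  by (simp add: treec_def)

lemma treec_Suc: "real (Suc m) * treec (Suc m) = treew m"
  by (cases m) (auto simp: treec_def treew_def forest_def field_simps simp del: of_nat_Suc)

lemma diffs_treec: "diffs treec = treew"
  by (simp add: diffs_def treec_Suc del: of_nat_Suc)

lemma diffs_treew: "diffs treew m = real (m + 2) ^ m / fact m"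
  unfolding diffs_def treew_def forest_def by (simp add: field_simps del: of_nat_Suc)

text \<open>Coefficients up to \<open>exp (m + 2)\<close> give a radius of convergence of at least
  \<open>exp (-1)\<close>, which serves for all the series of trees at once.\<close>

lemma summable_if_le_exp:
  fixes c :: "nat \<Rightarrow> real"
  assumes "\<And>m. \<bar>c m\<bar> \<le> exp (real m + 2)" "norm y < exp (-1)"
  shows "summable (\<lambda>m. c m * y ^ m)" "summable (\<lambda>m. norm (c m * y ^ m))"
proof -
  have g: "summable (\<lambda>m. exp 2 * (exp 1 * \<bar>y\<bar>) ^ m)"
    using assms(2) by (intro summable_mult summable_geometric) (simp add: exp_minus field_simps)
  have le: "norm (c m * y ^ m) \<le> exp 2 * (exp 1 * \<bar>y\<bar>) ^ m" for m
  proof -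
    have "norm (c m * y ^ m) = \<bar>c m\<bar> * \<bar>y\<bar> ^ m" by (simp add: abs_mult power_abs)
    also have "\<dots> \<le> exp (real m + 2) * \<bar>y\<bar> ^ m" using assms(1) by (intro mult_right_mono) auto
    also have "\<dots> = exp 2 * (exp 1 * \<bar>y\<bar>) ^ m"
      by (simp add: exp_add power_mult_distrib exp_of_nat_mult[symmetric])
    finally show ?thesis .
  qed
  show s: "summable (\<lambda>m. norm (c m * y ^ m))"
    by (rule summable_comparison_test'[OF g, of 0]) (use le in simp)
  then show "summable (\<lambda>m. c m * y ^ m)" by (rule summable_norm_cancel)
qed

lemma tree_coeff_bounds:
  "\<bar>diffs treew m\<bar> \<le> exp (real m + 2)" "\<bar>treew m\<bar> \<le> exp (real m + 2)" "\<bar>treec m\<bar> \<le> exp (real m + 2)"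
  "\<bar>real (m + 1) ^ m / fact m\<bar> \<le> exp (real m + 2)"
proof -
  have *: "real (m + 2) ^ m / fact m \<le> exp (real m + 2)" for m
    using power_div_fact_le_exp[of "real (m + 2)" m] by (simp add: add.commute)
  then show "\<bar>diffs treew m\<bar> \<le> exp (real m + 2)" by (simp add: diffs_treew)
  have d: "real (m + 1) ^ m / fact m \<le> real (m + 2) ^ m / fact m"
    by (intro divide_right_mono power_mono) auto
  then show "\<bar>real (m + 1) ^ m / fact m\<bar> \<le> exp (real m + 2)" using * by (simp add: order_trans)
  have w: "treew m \<le> exp (real m + 2)" for m
  proof -
    have "treew m \<le> real (m + 2) ^ m / fact m"
    proof -
      have "real (m + 1) ^ (m - 1) \<le> real (m + 1) ^ m" by (intro power_increasing) auto
      also have "\<dots> \<le> real (m + 2) ^ m" by (intro power_mono) auto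
      finally show ?thesis unfolding treew_def forest_def by (auto intro!: divide_right_mono)
    qed
    then show ?thesis using *[of m] by linarith
  qed
  have w0: "0 \<le> treew m" for m by (simp add: treew_def forest_def)
  show "\<bar>treew m\<bar> \<le> exp (real m + 2)" using w w0 by simp
  have "treec m \<le> exp (real m + 2)"
  proof (cases m)
    case (Suc j)
    have "treec m \<le> real (Suc j) * treec (Suc j)"
      using Suc treec_nonneg[of m] by (simp add: mult_le_cancel_right1)
    also have "\<dots> \<le> exp (real j + 2)" unfolding treec_Suc by (rule w)
    also have "\<dots> \<le> exp (real m + 2)" using Suc by simp
    finally show ?thesis .
  qed (simp add: treec_def)
  then show "\<bar>treec m\<bar> \<le> exp (real m + 2)" using treec_nonneg by simp
qed

text \<open>\<open>F\<close> is the tree function. With \<open>F = y * W\<close>, Abel's identity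
  becomes \<open>W' = W * F'\<close>, whence \<open>W = exp F\<close>. The series of unrooted trees
  and \<open>F - F\<^sup>2 / 2\<close> then share the derivative \<open>W\<close>.\<close>

lemma tree_functions:
  fixes y :: real
  assumes y: "\<bar>y\<bar> < exp (-1)"
  defines "F \<equiv> \<lambda>y. y * (\<Sum>m. treew m * y ^ m)"
  shows "isCont F y" and "F y = y * exp (F y)" and "(\<Sum>k. treec k * y ^ k) = F y - F y ^ 2 / 2"
proof -
  define W where "W y = (\<Sum>m. treew m * y ^ m)" for y
  define V where "V y = (\<Sum>m. diffs treew m * y ^ m)" for y
  define D where "D y = (\<Sum>m. real (m + 1) ^ m / fact m * y ^ m)" for y :: real
  define U where "U y = (\<Sum>m. treec m * y ^ m)" for y
  define B where "B = ball (0::real) (exp (-1))"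
  have F: "F y = y * W y" for y by (simp add: F_def W_def)
  note summ = summable_if_le_exp[OF tree_coeff_bounds(1)] summable_if_le_exp[OF tree_coeff_bounds(2)]
    summable_if_le_exp[OF tree_coeff_bounds(3)] summable_if_le_exp[OF tree_coeff_bounds(4)]
  have dW: "(W has_real_derivative V y) (at y)" if "y \<in> B" for y
    unfolding W_def V_def using that summ(3)
    by (intro termdiffs_strong'[where K = "exp (-1)"]) (auto simp: B_def dist_norm)
  have dU: "(U has_real_derivative W y) (at y)" if "y \<in> B" for y
    unfolding U_def W_def diffs_treec[symmetric] using that summ(5)
    by (intro termdiffs_strong'[where K = "exp (-1)"]) (auto simp: B_def dist_norm)
  have D_eq: "D y = W y + y * V y" if "y \<in> B" for y
  proof -
    have y: "norm y < exp (-1)" using that by (simp add: B_def)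
    have "(\<lambda>m. diffs treew m * y ^ m) sums V y" using summ(1)[OF y] by (simp add: V_def summable_sums)
    then have "(\<lambda>m. y * (diffs treew m * y ^ m)) sums (y * V y)" by (rule sums_mult)
    then have "(\<lambda>m. (case m of 0 \<Rightarrow> 0 | Suc m \<Rightarrow> y * (diffs treew m * y ^ m))) sums (y * V y)"
      by (subst sums_Suc_iff[symmetric, where f = "\<lambda>m. (case m of 0 \<Rightarrow> 0 | Suc m \<Rightarrow> y * (diffs treew m * y ^ m))", simplified]) simp
    moreover have "(\<lambda>m. treew m * y ^ m) sums W y" using summ(3)[OF y] by (simp add: W_def summable_sums)
    ultimately have "(\<lambda>m. treew m * y ^ m + (case m of 0 \<Rightarrow> 0 | Suc m \<Rightarrow> y * (diffs treew m * y ^ m))) sums (W y + y * V y)"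
      by (intro sums_add)
    moreover have "treew m * y ^ m + (case m of 0 \<Rightarrow> 0 | Suc m \<Rightarrow> y * (diffs treew m * y ^ m))
        = real (m + 1) ^ m / fact m * y ^ m" for m
    proof (cases m)
      case (Suc j)
      have "treew (Suc j) + real (j + 2) ^ j / fact j = real (j + 2) ^ Suc j / fact (Suc j)"
      proof -
        have "x / (c * f) + x / f = (c + 1) * x / (c * f)" if "c > 0" "f > 0" for x c f :: real
          using that by (simp add: field_simps)
        from this[of "real (Suc j)" "fact j" "real (j + 2) ^ j"] show ?thesis
          by (simp add: treew_def forest_def add.commute)
      qed
      then have "(treew (Suc j) + real (j + 2) ^ j / fact j) * y ^ Suc j = real (j + 2) ^ Suc j / fact (Suc j) * y ^ Suc j"
        by (rule arg_cong)
      then show ?thesis unfolding Suc diffs_treew by (simp add: algebra_simps)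
    qed (simp add: treew_def forest_def)
    ultimately show ?thesis by (simp add: D_def sums_iff)
  qed
  \<comment> \<open>The Cauchy product is evaluated by \<open>abel_identity\<close> with
    \<open>a = b = 1\<close>.\<close>
  have V_eq: "V y = W y * D y" if "y \<in> B" for y
  proof -
    have y: "norm y < exp (-1)" using that by (simp add: B_def)
    have "W y * D y = (\<Sum>m. \<Sum>j\<le>m. (treew j * y ^ j) * (real (m - j + 1) ^ (m - j) / fact (m - j) * y ^ (m - j)))"
      unfolding W_def D_def by (rule Cauchy_product[OF summ(4)[OF y] summ(8)[OF y]])
    also have "\<dots> = V y"
      unfolding V_def
    proof (intro suminf_cong)
      fix m
      have "(\<Sum>j\<le>m. (treew j * y ^ j) * (real (m - j + 1) ^ (m - j) / fact (m - j) * y ^ (m - j)))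
          = (\<Sum>j\<le>m. real (m choose j) * (forest j 1 * real (m - j + 1) ^ (m - j))) / fact m * y ^ m"
        unfolding sum_divide_distrib sum_distrib_right
      proof (rule sum.cong[OF refl])
        fix j assume "j \<in> {..m}"
        then have j: "j \<le> m" "y ^ m = y ^ j * y ^ (m - j)" by (auto simp: power_add[symmetric])
        show "(treew j * y ^ j) * (real (m - j + 1) ^ (m - j) / fact (m - j) * y ^ (m - j))
            = real (m choose j) * (forest j 1 * real (m - j + 1) ^ (m - j)) / fact m * y ^ m"
          unfolding j(2) treew_def binomial_fact[OF j(1)] by simp
      qed
      also have "\<dots> = diffs treew m * y ^ m"
        unfolding abel_identity diffs_treew by (simp add: add_ac)
      finally show "(\<Sum>j\<le>m. (treew j * y ^ j) * (real (m - j + 1) ^ (m - j) / fact (m - j) * y ^ (m - j))) = diffs treew m * y ^ m" .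
    qed
    finally show ?thesis ..
  qed
  have dF: "(F has_real_derivative D y) (at y)" if "y \<in> B" for y
    unfolding F D_eq[OF that] using dW[OF that] by (auto intro!: derivative_eq_intros)
  have yB: "y \<in> B" "0 \<in> B" using y by (auto simp: B_def)
  have cB: "convex B" by (simp add: B_def)
  show "isCont F y" using dF[OF yB(1)] by (rule DERIV_isCont)
  have W0: "W 0 = 1" "U 0 = 0"
    unfolding W_def U_def powser_zero by (simp_all add: treew_def treec_def forest_def)
  obtain c where c: "\<And>x. x \<in> B \<Longrightarrow> W x * exp (- F x) = c"
  proof -
    have "((\<lambda>x. W x * exp (- F x)) has_real_derivative 0) (at x within B)" if "x \<in> B" for x
    proof (rule has_field_derivative_at_within)
      show "((\<lambda>x. W x * exp (- F x)) has_real_derivative 0) (at x)"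
        using that by (auto intro!: derivative_eq_intros dW dF simp: V_eq)
    qed
    from has_field_derivative_zero_constant[OF cB this] that show thesis by blast
  qed
  from c[OF yB(2)] have "c = 1" using W0 F by simp
  with c[OF yB(1)] have "W y = exp (F y)" by (simp add: exp_minus field_simps)
  then show "F y = y * exp (F y)" using F by simp
  obtain c' where c': "\<And>x. x \<in> B \<Longrightarrow> U x - (F x - F x ^ 2 / 2) = c'"
  proof -
    have "((\<lambda>x. U x - (F x - F x ^ 2 / 2)) has_real_derivative 0) (at x within B)" if "x \<in> B" for x
    proof (rule has_field_derivative_at_within)
      have "W x - (D x - F x * D x) = 0"
        using D_eq[OF that] V_eq[OF that] F[of x] by simp
      then show "((\<lambda>x. U x - (F x - F x ^ 2 / 2)) has_real_derivative 0) (at x)"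
        using that by (auto intro!: derivative_eq_intros dU dF)
    qed
    from has_field_derivative_zero_constant[OF cB this] that show thesis by blast
  qed
  from c'[OF yB(2)] have "c' = 0" using W0 F by simp
  with c'[OF yB(1)] show "(\<Sum>k. treec k * y ^ k) = F y - F y ^ 2 / 2" by (simp add: U_def)
qed

lemma x_exp_minus_less:
  fixes s t :: real
  assumes "s < t" "t \<le> 1"
  shows "s * exp (- s) < t * exp (- t)"
proof (rule DERIV_pos_imp_increasing_open[OF assms(1)])
  fix x assume x: "s < x" "x < t"
  have "((\<lambda>x. x * exp (- x)) has_real_derivative (1 - x) * exp (- x)) (at x)"
    by (auto intro!: derivative_eq_intros simp: algebra_simps)
  moreover have "(1 - x) * exp (- x) > 0" using x assms by simp
  ultimately show "\<exists>y. ((\<lambda>x. x * exp (- x)) has_real_derivative y) (at x) \<and> y > 0" by blast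
qed (intro continuous_intros)

text \<open>For \<open>0 < y < exp (-1)\<close> the equation \<open>F = y * exp F\<close> has two
  solutions. The series is the one below 1: it starts at 0 and is continuous, and taking the value 1
  at some point would force that point to be \<open>exp (-1)\<close>.\<close>

lemma tree_sums_open:
  fixes T :: real
  assumes T: "0 < T" "T < 1"
  shows "(\<lambda>k. real k * treec k * (T * exp (- T)) ^ k) sums T"
    and "(\<lambda>k. treec k * (T * exp (- T)) ^ k) sums (T - T\<^sup>2 / 2)"
proof -
  define y where "y = T * exp (- T)"
  define F where "F = (\<lambda>y. y * (\<Sum>m. treew m * y ^ m))"
  have y: "0 < y" "y < exp (-1)" using T x_exp_minus_less[of T 1] by (auto simp: y_def)
  then have ny: "norm y < exp (-1)" by simp
  have in_disc: "\<bar>x\<bar> < exp (-1)" if "0 \<le> x" "x \<le> y" for x using that y by simp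
  have FF: "F x = x * exp (F x)" if "\<bar>x\<bar> < exp (-1)" for x
    unfolding F_def by (rule tree_functions(2)[OF that])
  have w0: "0 \<le> treew m" for m by (simp add: treew_def forest_def)
  have sW: "summable (\<lambda>m. treew m * y ^ m)" by (rule summable_if_le_exp(1)[OF tree_coeff_bounds(2) ny])
  have "F y < 1"
  proof (rule ccontr)
    assume "\<not> F y < 1"
    moreover have "F 0 = 0" by (simp add: F_def)
    moreover have "\<forall>x. 0 \<le> x \<and> x \<le> y \<longrightarrow> isCont F x"
      unfolding F_def using tree_functions(1)[OF in_disc] by blast
    ultimately obtain x where x: "0 \<le> x" "x \<le> y" "F x = 1"
      using IVT[of F 0 1 y] y by auto
    then have "1 = x * exp 1" using FF[OF in_disc[OF x(1,2)]] by simp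
    also have "\<dots> \<le> y * exp 1" using x by simp
    also have "\<dots> < exp (-1) * exp 1" using y by simp
    finally show False by (simp flip: exp_add)
  qed
  moreover have "F y * exp (- F y) = T * exp (- T)"
  proof -
    have "F y * exp (- F y) = y * (exp (F y) * exp (- F y))"
      using FF[of y] y by simp
    then show ?thesis by (simp add: y_def flip: exp_add)
  qed
  ultimately have FT: "F y = T"
    using x_exp_minus_less[of T "F y"] x_exp_minus_less[of "F y" T] T by (cases "F y" T rule: linorder_cases) auto
  have "(\<lambda>m. treew m * y ^ m) sums (\<Sum>m. treew m * y ^ m)" using sW by (rule summable_sums)
  then have "(\<lambda>m. y * (treew m * y ^ m)) sums F y" unfolding F_def by (rule sums_mult)
  then have "(\<lambda>m. real (Suc m) * treec (Suc m) * y ^ Suc m) sums T"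
    unfolding treec_Suc FT by (simp add: mult_ac)
  then show "(\<lambda>k. real k * treec k * (T * exp (- T)) ^ k) sums T"
    unfolding y_def using sums_Suc_iff[of "\<lambda>k. real k * treec k * (T * exp (- T)) ^ k" T] by simp
  have "summable (\<lambda>m. treec m * y ^ m)" by (rule summable_if_le_exp(1)[OF tree_coeff_bounds(3) ny])
  then show "(\<lambda>k. treec k * (T * exp (- T)) ^ k) sums (T - T\<^sup>2 / 2)"
    using tree_functions(3)[of y] y FT[unfolded F_def] unfolding y_def[symmetric] by (simp add: sums_iff)
qed

text \<open>Nonnegativity carries the identity to \<open>T = 1\<close>, where
  \<open>T * exp (- T)\<close> reaches the radius of convergence: partial sums are bounded by
  continuity, and the full sum dominates the sums for \<open>T < 1\<close>.\<close>

lemma sums_at_boundary: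
  fixes a :: "nat \<Rightarrow> real" and g :: "real \<Rightarrow> real"
  assumes a: "\<And>k. 0 \<le> a k" and s: "\<And>T. 0 < T \<Longrightarrow> T < 1 \<Longrightarrow> (\<lambda>k. a k * (T * exp (- T)) ^ k) sums g T"
    and g: "isCont g 1"
  shows "(\<lambda>k. a k * exp (-1) ^ k) sums g 1"
proof -
  have gl: "(g \<longlongrightarrow> g 1) (at_left 1)" using g by (simp add: isCont_def filterlim_at_split)
  have ev: "\<forall>\<^sub>F T in at_left (1::real). 0 < T \<and> T < 1"
    by (rule eventually_at_leftI[of 0]) auto
  have part: "(\<Sum>k<N. a k * exp (-1) ^ k) \<le> g 1" for N
  proof (rule tendsto_le[OF _ gl])
    have "isCont (\<lambda>T::real. \<Sum>k<N. a k * (T * exp (- T)) ^ k) 1" by (intro continuous_intros)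
    then show "((\<lambda>T. \<Sum>k<N. a k * (T * exp (- T)) ^ k) \<longlongrightarrow> (\<Sum>k<N. a k * exp (-1) ^ k)) (at_left 1)"
      by (simp add: isCont_def filterlim_at_split)
    show "\<forall>\<^sub>F T in at_left 1. (\<Sum>k<N. a k * (T * exp (- T)) ^ k) \<le> g T"
      using ev
    proof eventually_elim
      case (elim T)
      then have "(\<Sum>k<N. a k * (T * exp (- T)) ^ k) \<le> (\<Sum>k. a k * (T * exp (- T)) ^ k)"
        using s[of T] a by (intro sum_le_suminf) (auto simp: sums_iff)
      then show ?case using s[of T] elim by (simp add: sums_iff)
    qed
  qed simp
  have summ: "summable (\<lambda>k. a k * exp (-1) ^ k)"
    using a part by (intro summableI_nonneg_bounded[of _ "g 1"]) auto
  have "(\<Sum>k. a k * exp (-1) ^ k) \<le> g 1" using summ part by (rule suminf_le_const)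
  moreover have "g 1 \<le> (\<Sum>k. a k * exp (-1) ^ k)"
  proof (rule tendsto_upperbound[OF gl])
    show "\<forall>\<^sub>F T in at_left 1. g T \<le> (\<Sum>k. a k * exp (-1) ^ k)"
      using ev
    proof eventually_elim
      case (elim T)
      then have "T * exp (- T) \<le> exp (-1)" using x_exp_minus_less[of T 1] by simp
      then have "a k * (T * exp (- T)) ^ k \<le> a k * exp (-1) ^ k" for k
        using a elim by (intro mult_left_mono power_mono) auto
      then have "(\<Sum>k. a k * (T * exp (- T)) ^ k) \<le> (\<Sum>k. a k * exp (-1) ^ k)"
        using s[of T] elim summ by (intro suminf_le) (auto simp: sums_iff)
      then show ?case using s[of T] elim by (simp add: sums_iff)
    qed
  qed simp
  ultimately show ?thesis using summ by (simp add: sums_iff)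
qed

lemma tree_sums:
  fixes T :: real
  assumes T: "0 < T" "T \<le> 1"
  shows "(\<lambda>k. real k * treec k * (T * exp (- T)) ^ k) sums T"
    and "(\<lambda>k. treec k * (T * exp (- T)) ^ k) sums (T - T\<^sup>2 / 2)"
proof -
  have "(\<lambda>k. real k * treec k * exp (-1) ^ k) sums 1"
    using tree_sums_open(1) treec_nonneg by (intro sums_at_boundary[where g = "\<lambda>T. T"]) auto
  then show "(\<lambda>k. real k * treec k * (T * exp (- T)) ^ k) sums T"
    using T tree_sums_open(1)[of T] by (cases "T = 1") auto
  have "(\<lambda>k. treec k * exp (-1) ^ k) sums (1 - 1\<^sup>2 / 2)"
    using tree_sums_open(2) treec_nonneg
    by (intro sums_at_boundary[where g = "\<lambda>T. T - T\<^sup>2 / 2"]) (auto intro!: continuous_intros)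
  then show "(\<lambda>k. treec k * (T * exp (- T)) ^ k) sums (T - T\<^sup>2 / 2)"
    using T tree_sums_open(2)[of T] by (cases "T = 1") auto
qed

section \<open>Upper bounds\<close>

lemma comps_prob_le_1:
  assumes "0 \<le> p" "p \<le> 1"
  shows "comps_prob p P m \<le> 1"
proof -
  have "comps_prob p P m = subset_prob p (pairs {..<m}) (comps P {..<m})" by (simp add: subset_prob_comps)
  also have "\<dots> \<le> subset_prob p (pairs {..<m}) (\<lambda>_. True)"
    unfolding subset_prob_def using assms finite_pairs[of "{..<m}"] by (intro sum_mono2) auto
  also have "\<dots> = 1" by (simp add: subset_prob_True finite_pairs)
  finally show ?thesis .
qed

lemma comps_prob_nonneg:
  assumes "0 \<le> p" "p \<le> 1"
  shows "0 \<le> comps_prob p P m"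
proof -
  have "comps_prob p P m = subset_prob p (pairs {..<m}) (comps P {..<m})" by (simp add: subset_prob_comps)
  also have "\<dots> \<ge> 0" unfolding subset_prob_def using assms by (intro sum_nonneg) auto
  finally show ?thesis .
qed

section \<open>Stirling bounds and exponential rates\<close>

text \<open>Stirling up to the factor \<open>exp 1 * k\<close>; the inductive step is
  \<open>ln u \<le> u - 1\<close> at \<open>u = k / (k + 1)\<close>.\<close>

lemma ln_fact_le:
  assumes "k > 0"
  shows "ln (fact k) \<le> real k * ln (real k) - real k + 1 + ln (real k)"
  using assms
proof (induction k rule: nat_induct_non_zero)
  case (Suc k)
  have k: "real k > 0" using Suc by simp
  have "1 - real k / real (Suc k) \<le> - ln (real k / real (Suc k))"
    using ln_le_minus_one[of "real k / real (Suc k)"] k by simp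
  also have "\<dots> = ln (real (Suc k)) - ln (real k)" using k by (simp add: ln_div)
  finally have "real (Suc k) * (1 - real k / real (Suc k)) \<le> real (Suc k) * (ln (real (Suc k)) - ln (real k))"
    by (intro mult_left_mono) auto
  moreover have "real (Suc k) * (1 - real k / real (Suc k)) = 1" by (simp add: field_simps)
  ultimately have "1 \<le> real (Suc k) * ln (real (Suc k)) - real (Suc k) * ln (real k)"
    by (simp only: right_diff_distrib)
  moreover have "ln (fact (Suc k) :: real) = ln (real (Suc k)) + ln (fact k)"
    by (simp only: fact_Suc of_nat_mult) (simp add: ln_mult_pos del: of_nat_Suc)
  ultimately show ?case using Suc.IH by (simp add: algebra_simps)
qed simp

lemma ln_fact_ge: "real k * ln (real k) - real k \<le> ln (fact k)"
proof (cases "k = 0")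
  case False
  have "ln (real k ^ k / fact k) \<le> ln (exp (real k))"
    using power_div_fact_le_exp[of "real k" k] False by (subst ln_le_cancel_iff) auto
  then show ?thesis using False by (simp add: ln_div ln_realpow)
qed simp

lemma real_choose_two: "real (k choose 2) = real k * (real k - 1) / 2"
proof (induction k)
  case (Suc k)
  have "Suc k choose 2 = k + (k choose 2)" by (simp add: numeral_2_eq_2)
  then show ?case using Suc by (simp add: field_simps)
qed simp

lemma one_minus_ge_exp:
  assumes "0 \<le> p" "p \<le> 1 / (2::real)"
  shows "exp (- p - 2 * p\<^sup>2) \<le> 1 - p"
proof -
  have "exp (- p - 2 * p\<^sup>2) \<le> exp (ln (1 - p))"
    unfolding exp_le_cancel_iff using ln_one_minus_pos_lower_bound[of p] assms by simp
  then show ?thesis using assms by simp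
qed

definition weight :: "real \<Rightarrow> nat \<Rightarrow> nat \<Rightarrow> real" where
  "weight \<alpha> n k = conn (\<alpha> / n) k / ((1 - \<alpha> / n) ^ (k choose 2) * fact k)"

definition bulk_coeff :: "real \<Rightarrow> nat \<Rightarrow> real \<Rightarrow> nat \<Rightarrow> real" where
  "bulk_coeff \<alpha> n r = expc (\<lambda>k. if real k \<le> r then weight \<alpha> n k else 0)"

text \<open>Rate of \<open>n ^ l\<close> times the coefficient of the small part at
  \<open>l = x * n\<close>: \<open>x - x * ln x\<close> stems from \<open>n ^ l / l!\<close>, the
  quadratic term from dividing by \<open>(1 - \<alpha> / n) ^ (l choose 2)\<close>, and the
  \<open>Psi\<close> term is the cost of having no large component.\<close>

definition bulk_rate :: "real \<Rightarrow> real \<Rightarrow> real" where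
  "bulk_rate \<alpha> x = x - x * ln x + \<alpha> * x\<^sup>2 / 2 + x * Psi (\<alpha> * x)"

text \<open>Rate of \<open>n ^ k * weight \<alpha> n k\<close> at \<open>k = x * n\<close>; the term
  \<open>1 - exp (- (\<alpha> * x))\<close> is the base of the connection probability.\<close>

definition comp_rate :: "real \<Rightarrow> real \<Rightarrow> real" where
  "comp_rate \<alpha> x = x * (ln ((1 - exp (- (\<alpha> * x))) / x) + \<alpha> * x / 2 + 1)"

text \<open>The expression under the minimum has derivative \<open>- (1 - 1 / t)\<^sup>2 / 2\<close>
  and vanishes at 1, so the minimum switches exactly there.\<close>

lemma Psi_cases:
  "0 < t \<Longrightarrow> t \<le> 1 \<Longrightarrow> Psi t = 0" "1 \<le> t \<Longrightarrow> Psi t = ln t - (t - 1 / t) / 2"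
proof -
  define h where "h t = ln t - (t - 1 / t) / 2" for t :: real
  have d: "(h has_real_derivative - ((1 - 1 / t)\<^sup>2 / 2)) (at t)" if "t > 0" for t
    unfolding h_def using that
    by (auto intro!: derivative_eq_intros simp: power2_eq_square field_simps)
  have h: "h s \<ge> h t" if "0 < s" "s \<le> t" for s t
  proof (rule DERIV_nonpos_imp_nonincreasing[OF that(2)])
    fix x assume "s \<le> x" "x \<le> t"
    then show "\<exists>y. (h has_real_derivative y) (at x) \<and> y \<le> 0" using d[of x] that by force
  qed
  have h1: "h 1 = 0" by (simp add: h_def)
  show "Psi t = 0" if "0 < t" "t \<le> 1" using h[OF that] h1 that by (simp add: Psi_def h_def)
  show "Psi t = ln t - (t - 1 / t) / 2" if "1 \<le> t" using h[of 1 t] h1 that by (simp add: Psi_def h_def)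
qed

lemma bulk_rate_low: "\<alpha> > 0 \<Longrightarrow> 0 \<le> x \<Longrightarrow> \<alpha> * x \<le> 1 \<Longrightarrow> bulk_rate \<alpha> x = x - x * ln x + \<alpha> * x\<^sup>2 / 2"
  by (cases "x = 0") (auto simp: bulk_rate_def Psi_cases)

text \<open>The terms in \<open>x * ln x\<close> and \<open>x\<^sup>2\<close> cancel. What is left
  is the tangent of the subcritical rate at \<open>1 / \<alpha>\<close>.\<close>

lemma bulk_rate_high:
  assumes "\<alpha> > 0" "\<alpha> * x \<ge> 1"
  shows "bulk_rate \<alpha> x = x * (ln \<alpha> + 1) + 1 / (2 * \<alpha>)"
proof -
  have x: "x > 0" using assms by (metis less_eq_real_def linorder_not_less mult_nonneg_nonpos not_one_le_zero order_trans)
  show ?thesis unfolding bulk_rate_def Psi_cases(2)[OF assms(2)] using assms x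
    by (simp add: ln_mult_pos field_simps power2_eq_square)
qed

section \<open>Estimates for a single n\<close>

context
  fixes \<alpha> :: real and n :: nat
  assumes \<alpha>: "\<alpha> > 0" and n: "real n \<ge> 2 * \<alpha>" "n > 0"
begin

lemma p_bounds: "0 < \<alpha> / n" "\<alpha> / n \<le> 1 / 2" "0 \<le> \<alpha> / n" "\<alpha> / n \<le> 1" "\<alpha> / n < 1"
  using \<alpha> n by (auto simp: field_simps)

lemma q_pow_le: "(1 - \<alpha> / n) ^ k \<le> exp (- (\<alpha> * (real k / n)))"
proof -
  have "(1 - \<alpha> / n) ^ k \<le> exp (- (\<alpha> / n)) ^ k"
    using exp_ge_add_one_self[of "- (\<alpha> / n)"] p_bounds by (intro power_mono) auto
  then show ?thesis by (simp add: exp_of_nat_mult[symmetric] mult_ac)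
qed

lemma q_pow_ge: "exp (- (\<alpha> * (real k / n)) - 2 * \<alpha>\<^sup>2 * k / (real n)\<^sup>2) \<le> (1 - \<alpha> / n) ^ k"
proof -
  have "exp (- (\<alpha> / n) - 2 * (\<alpha> / n)\<^sup>2) ^ k \<le> (1 - \<alpha> / n) ^ k"
    using one_minus_ge_exp[OF p_bounds(3,2)] by (intro power_mono) auto
  moreover have "exp (- (\<alpha> / n) - 2 * (\<alpha> / n)\<^sup>2) ^ k = exp (- (\<alpha> * (real k / n)) - 2 * \<alpha>\<^sup>2 * k / (real n)\<^sup>2)"
    by (simp add: exp_of_nat_mult[symmetric] power_divide algebra_simps)
  ultimately show ?thesis by simp
qed

text \<open>The constant \<open>\<alpha>\<^sup>2\<close> pays for the second-order term of
  \<open>ln (1 - p)\<close>: \<open>2 * p\<^sup>2 * (k choose 2)\<close> stays bounded because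
  \<open>k \<le> n\<close>.\<close>

lemma inverse_q_choose_le:
  assumes "k \<le> n"
  shows "1 / (1 - \<alpha> / n) ^ (k choose 2) \<le> exp (\<alpha> * (real k)\<^sup>2 / (2 * n) + \<alpha>\<^sup>2)"
proof -
  have kk: "real (k choose 2) \<le> (real k)\<^sup>2 / 2" by (simp add: real_choose_two power2_eq_square algebra_simps)
  have "\<alpha> * (real (k choose 2) / n) \<le> \<alpha> * (((real k)\<^sup>2 / 2) / n)"
    using kk \<alpha> n by (intro mult_left_mono divide_right_mono) auto
  moreover have "2 * \<alpha>\<^sup>2 * real (k choose 2) / (real n)\<^sup>2 \<le> \<alpha>\<^sup>2"
  proof -
    have "(real k)\<^sup>2 \<le> (real n)\<^sup>2" using assms by (intro power_mono) auto
    then have "2 * real (k choose 2) \<le> (real n)\<^sup>2" using kk by linarith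
    then have "\<alpha>\<^sup>2 * (2 * real (k choose 2)) \<le> \<alpha>\<^sup>2 * (real n)\<^sup>2" by (intro mult_left_mono) auto
    then show ?thesis using n by (simp add: divide_le_eq mult_ac)
  qed
  ultimately have le: "\<alpha> * (real (k choose 2) / n) + 2 * \<alpha>\<^sup>2 * real (k choose 2) / (real n)\<^sup>2
      \<le> \<alpha> * (real k)\<^sup>2 / (2 * n) + \<alpha>\<^sup>2"
    by (simp add: algebra_simps)
  have "1 / (1 - \<alpha> / n) ^ (k choose 2) \<le> 1 / exp (- (\<alpha> * (real (k choose 2) / n)) - 2 * \<alpha>\<^sup>2 * real (k choose 2) / (real n)\<^sup>2)"
    using q_pow_ge[of "k choose 2"] p_bounds by (intro divide_left_mono) auto
  also have "\<dots> = exp (\<alpha> * (real (k choose 2) / n) + 2 * \<alpha>\<^sup>2 * real (k choose 2) / (real n)\<^sup>2)"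
    by (simp add: exp_minus[symmetric] inverse_eq_divide[symmetric])
  also have "\<dots> \<le> exp (\<alpha> * (real k)\<^sup>2 / (2 * n) + \<alpha>\<^sup>2)" using le by simp
  finally show ?thesis .
qed

text \<open>\<open>\<alpha> / 2\<close> covers the gap between \<open>k\<^sup>2 / 2\<close> and
  \<open>k choose 2\<close>.\<close>

lemma inverse_q_choose_ge:
  assumes "k \<le> n"
  shows "exp (\<alpha> * (real k)\<^sup>2 / (2 * n) - \<alpha> / 2) \<le> 1 / (1 - \<alpha> / n) ^ (k choose 2)"
proof -
  have "\<alpha> * (real k)\<^sup>2 / (2 * n) - \<alpha> / 2 \<le> \<alpha> * (real (k choose 2) / n)"
  proof -
    have "\<alpha> * real k / (2 * n) \<le> \<alpha> / 2" using assms \<alpha> n by (simp add: field_simps)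
    moreover have "\<alpha> * (real (k choose 2) / n) = \<alpha> * (real k)\<^sup>2 / (2 * n) - \<alpha> * real k / (2 * n)"
      by (simp add: real_choose_two power2_eq_square diff_divide_distrib algebra_simps)
    ultimately show ?thesis by linarith
  qed
  then have "exp (\<alpha> * (real k)\<^sup>2 / (2 * n) - \<alpha> / 2) \<le> 1 / exp (- (\<alpha> * (real (k choose 2) / n)))"
    by (simp add: exp_minus inverse_eq_divide)
  also have "\<dots> \<le> 1 / (1 - \<alpha> / n) ^ (k choose 2)"
    using q_pow_le[of "k choose 2"] p_bounds by (intro divide_left_mono) auto
  finally show ?thesis .
qed

lemma power_div_fact_upper: "real n ^ k / fact k \<le> exp (real k - real k * ln (real k / n))"
proof (cases "k = 0")
  case False
  have "ln (real n ^ k / fact k) = real k * ln n - ln (fact k)"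
    using n by (simp add: ln_div ln_realpow)
  also have "\<dots> \<le> real k - real k * ln (real k / n)"
    using ln_fact_ge[of k] n False by (simp add: ln_div algebra_simps)
  finally have "exp (ln (real n ^ k / fact k)) \<le> exp (real k - real k * ln (real k / n))" by simp
  then show ?thesis using n by simp
qed simp

lemma power_div_fact_lower:
  assumes "k > 0"
  shows "exp (real k - real k * ln (real k / n)) / (exp 1 * k) \<le> real n ^ k / fact k"
proof -
  have "ln (exp (real k - real k * ln (real k / n)) / (exp 1 * k)) = real k - real k * ln (real k / n) - 1 - ln k"
    using assms by (simp add: ln_div ln_mult_pos)
  also have "\<dots> \<le> real k * ln n - ln (fact k)"
    using ln_fact_le[OF assms] n assms by (simp add: ln_div algebra_simps)
  also have "\<dots> = ln (real n ^ k / fact k)"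
    using n by (simp add: ln_div ln_realpow)
  finally show ?thesis using n assms by (subst (asm) ln_le_cancel_iff) auto
qed

lemma exp_n_comp_rate:
  assumes "k > 0"
  shows "exp (n * comp_rate \<alpha> (real k / n)) = (1 - exp (- (\<alpha> * (real k / n)))) ^ k
    * exp (real k - real k * ln (real k / n)) * exp (\<alpha> * (real k)\<^sup>2 / (2 * n))"
proof -
  define e where "e = 1 - exp (- (\<alpha> * (real k / n)))"
  have e: "e > 0" using \<alpha> n assms by (simp add: e_def)
  have "n * comp_rate \<alpha> (real k / n) = real k * ln e + (real k - real k * ln (real k / n)) + \<alpha> * (real k)\<^sup>2 / (2 * n)"
  proof -
    have "ln (e / (real k / n)) = ln e - ln (real k / n)" using e n assms by (subst ln_div) auto
    then have "n * comp_rate \<alpha> (real k / n) = real k * (ln e - ln (real k / n) + \<alpha> * (real k / n) / 2 + 1)"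
      unfolding comp_rate_def e_def[symmetric] using n by simp
    then show ?thesis by (simp add: algebra_simps power2_eq_square)
  qed
  then show ?thesis using e by (simp add: exp_add exp_of_nat_mult e_def)
qed

lemma weight_nonneg: "0 \<le> weight \<alpha> n k"
  unfolding weight_def using conn_nonneg[OF p_bounds(3,4)] p_bounds by simp

text \<open>One factor \<open>1 / k\<close> is the ballot factor of \<open>conn_ge\<close>, the
  other, together with \<open>exp (-1)\<close>, is Stirling's; \<open>exp (- \<alpha> / 2)\<close>
  comes from \<open>inverse_q_choose_ge\<close>.\<close>

lemma weight_ge:
  assumes "0 < k" "k \<le> n"
  shows "exp (n * comp_rate \<alpha> (real k / n)) * exp (- \<alpha> / 2 - 1) / (real k)\<^sup>2 \<le> real n ^ k * weight \<alpha> n k"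
proof -
  define e where "e = 1 - exp (- (\<alpha> * (real k / n)))"
  have e: "0 \<le> e" "e \<le> 1 - (1 - \<alpha> / n) ^ k" using \<alpha> n q_pow_le[of k] by (auto simp: e_def)
  have "e ^ k / k \<le> (1 - (1 - \<alpha> / n) ^ k) ^ k / k"
    using e by (intro divide_right_mono power_mono) auto
  also have "\<dots> \<le> (1 - (1 - \<alpha> / n) ^ k) ^ (k - 1) / k"
    using e p_bounds by (intro divide_right_mono power_decreasing) auto
  also have "\<dots> \<le> conn (\<alpha> / n) k" using p_bounds assms by (intro conn_ge) auto
  finally have c: "e ^ k / k \<le> conn (\<alpha> / n) k" .
  have "exp (n * comp_rate \<alpha> (real k / n)) * exp (- \<alpha> / 2 - 1) / (real k)\<^sup>2
      = e ^ k / k * exp (\<alpha> * (real k)\<^sup>2 / (2 * n) - \<alpha> / 2) * (exp (real k - real k * ln (real k / n)) / (exp 1 * k))"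
    unfolding exp_n_comp_rate[OF assms(1)] e_def[symmetric]
  proof -
    have "exp (\<alpha> * (real k)\<^sup>2 / (2 * n)) * exp (- \<alpha> / 2 - 1) = exp (\<alpha> * (real k)\<^sup>2 / (2 * n) - \<alpha> / 2) / exp 1"
      by (simp flip: exp_add exp_diff)
    then have "e ^ k * X * exp (\<alpha> * (real k)\<^sup>2 / (2 * n)) * exp (- \<alpha> / 2 - 1) / (real k)\<^sup>2
        = e ^ k * X * (exp (\<alpha> * (real k)\<^sup>2 / (2 * n) - \<alpha> / 2) / exp 1) / (real k)\<^sup>2" for X
      by (simp only: mult.assoc)
    from this[of "exp (real k - real k * ln (real k / n))"]
    show "e ^ k * exp (real k - real k * ln (real k / n)) * exp (\<alpha> * (real k)\<^sup>2 / (2 * n)) * exp (- \<alpha> / 2 - 1) / (real k)\<^sup>2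
      = e ^ k / k * exp (\<alpha> * (real k)\<^sup>2 / (2 * n) - \<alpha> / 2) * (exp (real k - real k * ln (real k / n)) / (exp 1 * k))"
      by (simp add: power2_eq_square mult_ac)
  qed
  also have "\<dots> \<le> conn (\<alpha> / n) k * (1 / (1 - \<alpha> / n) ^ (k choose 2)) * (real n ^ k / fact k)"
    using c e inverse_q_choose_ge[OF assms(2)] power_div_fact_lower[OF assms(1)] p_bounds conn_nonneg[OF p_bounds(3,4)]
    by (intro mult_mono) auto
  finally show ?thesis by (simp add: weight_def mult_ac)
qed

text \<open>For \<open>k\<close> of order \<open>n\<close> the two bases differ by a relative error
  of at most \<open>t / d\<close> with \<open>k * t\<close> bounded, so the \<open>k\<close>-th
  powers differ by a constant factor. The lower bound \<open>d\<close> on the base is the reason for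
  \<open>\<delta> * n \<le> k\<close>.\<close>

lemma one_minus_q_pow_le:
  fixes \<delta> :: real
  assumes "0 < \<delta>" "\<delta> * n \<le> k" "k \<le> n"
  shows "(1 - (1 - \<alpha> / n) ^ k) ^ k \<le> exp (2 * \<alpha>\<^sup>2 / (1 - exp (- (\<alpha> * \<delta>)))) * (1 - exp (- (\<alpha> * (real k / n)))) ^ k"
proof -
  define e where "e = 1 - exp (- (\<alpha> * (real k / n)))"
  define d where "d = 1 - exp (- (\<alpha> * \<delta>))"
  define t where "t = 2 * \<alpha>\<^sup>2 * k / (real n)\<^sup>2"
  have d: "d > 0" using \<alpha> assms by (simp add: d_def)
  have de: "d \<le> e" using \<alpha> assms n by (simp add: d_def e_def field_simps)
  have t0: "t \<ge> 0" by (simp add: t_def)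
  have "(1 - e) * (1 - t) \<le> (1 - e) * exp (- t)"
    using exp_ge_add_one_self[of "- t"] by (intro mult_left_mono) (auto simp: e_def)
  also have "\<dots> = exp (- (\<alpha> * (real k / n)) - t)" by (simp add: e_def exp_diff exp_minus field_simps)
  also have "\<dots> \<le> (1 - \<alpha> / n) ^ k" unfolding t_def by (rule q_pow_ge)
  finally have "1 - (1 - \<alpha> / n) ^ k \<le> e + (1 - e) * t" by (simp add: algebra_simps)
  also have "\<dots> \<le> e + t" using t0 \<alpha> n by (simp add: e_def mult_left_le_one_le)
  also have "\<dots> \<le> e * (1 + t / d)"
  proof -
    have "t \<le> e * (t / d)" using de d t0 mult_right_mono[of d e "t / d"] by simp
    then show ?thesis by (simp add: algebra_simps)
  qed
  also have "\<dots> \<le> e * exp (t / d)"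
    using de d exp_ge_add_one_self[of "t / d"] by (intro mult_left_mono) auto
  finally have "(1 - (1 - \<alpha> / n) ^ k) ^ k \<le> (e * exp (t / d)) ^ k"
    using p_bounds by (intro power_mono) (auto simp: power_le_one)
  also have "\<dots> = exp (real k * (t / d)) * e ^ k"
    by (simp add: power_mult_distrib exp_of_nat_mult[symmetric])
  also have "\<dots> \<le> exp (2 * \<alpha>\<^sup>2 / d) * e ^ k"
  proof (rule mult_right_mono)
    have "real k * t \<le> 2 * \<alpha>\<^sup>2"
    proof -
      have "real k * real k \<le> real n * real n" using assms by (intro mult_mono) auto
      then have "2 * \<alpha>\<^sup>2 * (real k * real k) \<le> 2 * \<alpha>\<^sup>2 * (real n * real n)" by (intro mult_left_mono) auto
      then show ?thesis unfolding t_def using n by (simp add: divide_le_eq power2_eq_square mult_ac)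
    qed
    then show "exp (real k * (t / d)) \<le> exp (2 * \<alpha>\<^sup>2 / d)" using d by (simp add: divide_right_mono)
    show "0 \<le> e ^ k" using de d by simp
  qed
  finally show ?thesis by (simp add: e_def d_def)
qed

text \<open>Dividing by a lower bound of the base raises the exponent from \<open>k - 1\<close> to
  \<open>k\<close>, as needed to recognise a binomial term in
  \<open>comps_prob_gt_le\<close>.\<close>

lemma conn_le_macro:
  fixes \<delta> :: real
  assumes "0 < \<delta>" "\<delta> * n \<le> k" "k \<le> n" "0 < k"
  shows "conn (\<alpha> / n) k \<le> (1 - (1 - \<alpha> / n) ^ k) ^ k / (1 - exp (- (\<alpha> * \<delta>)))"
proof -
  define d where "d = 1 - exp (- (\<alpha> * \<delta>))"
  have d: "d > 0" using \<alpha> assms by (simp add: d_def)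
  have "exp (- (\<alpha> * (real k / n))) \<le> exp (- (\<alpha> * \<delta>))" using \<alpha> assms n by (simp add: field_simps)
  then have de: "d \<le> 1 - (1 - \<alpha> / n) ^ k" using q_pow_le[of k] unfolding d_def by linarith
  have "conn (\<alpha> / n) k * d \<le> (1 - (1 - \<alpha> / n) ^ k) ^ (k - 1) * (1 - (1 - \<alpha> / n) ^ k)"
    using de d conn_le_power[OF p_bounds(3,4), of k] conn_nonneg[OF p_bounds(3,4)] p_bounds
    by (intro mult_mono) (auto simp: power_le_one)
  also have "\<dots> = (1 - (1 - \<alpha> / n) ^ k) ^ k" using assms by (cases k) auto
  finally show ?thesis using d by (simp add: d_def field_simps)
qed

lemma weight_le:
  fixes \<delta> :: real
  assumes "0 < \<delta>" "\<delta> * n \<le> k" "k \<le> n" "0 < k"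
  defines "d \<equiv> 1 - exp (- (\<alpha> * \<delta>))"
  shows "real n ^ k * weight \<alpha> n k \<le> exp (2 * \<alpha>\<^sup>2 / d + \<alpha>\<^sup>2) / d * exp (n * comp_rate \<alpha> (real k / n))"
proof -
  define e where "e = 1 - exp (- (\<alpha> * (real k / n)))"
  have d: "d > 0" using \<alpha> assms by (simp add: d_def)
  have "conn (\<alpha> / n) k \<le> (1 - (1 - \<alpha> / n) ^ k) ^ k / d"
    unfolding d_def using assms by (intro conn_le_macro) auto
  also have "\<dots> \<le> exp (2 * \<alpha>\<^sup>2 / d) * e ^ k / d"
    unfolding d_def e_def using assms d by (intro divide_right_mono one_minus_q_pow_le) (auto simp: d_def)
  finally have c: "conn (\<alpha> / n) k \<le> exp (2 * \<alpha>\<^sup>2 / d) * e ^ k / d" .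
  have e: "0 \<le> e" using \<alpha> n by (simp add: e_def)
  have "real n ^ k * weight \<alpha> n k = conn (\<alpha> / n) k * (1 / (1 - \<alpha> / n) ^ (k choose 2)) * (real n ^ k / fact k)"
    by (simp add: weight_def mult_ac)
  also have "\<dots> \<le> exp (2 * \<alpha>\<^sup>2 / d) * e ^ k / d * exp (\<alpha> * (real k)\<^sup>2 / (2 * n) + \<alpha>\<^sup>2)
      * exp (real k - real k * ln (real k / n))"
    using c e d inverse_q_choose_le[OF assms(3)] power_div_fact_upper[of k] p_bounds conn_nonneg[OF p_bounds(3,4)]
    by (intro mult_mono) auto
  also have "\<dots> = exp (2 * \<alpha>\<^sup>2 / d + \<alpha>\<^sup>2) / d * exp (n * comp_rate \<alpha> (real k / n))"
    unfolding exp_n_comp_rate[OF assms(4)] e_def[symmetric] by (simp add: exp_add)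
  finally show ?thesis .
qed

lemma bulk_coeff_nonneg: "0 \<le> bulk_coeff \<alpha> n r l"
  unfolding bulk_coeff_def using weight_nonneg by (intro expc_nonneg) auto

lemma comps_prob_bulk_coeff: "comps_prob (\<alpha> / n) (\<lambda>k. real k \<le> r) l = fact l * (1 - \<alpha> / n) ^ (l choose 2) * bulk_coeff \<alpha> n r l"
  unfolding bulk_coeff_def weight_def by (rule comps_prob_eq_expc[OF p_bounds(5)])

text \<open>Below criticality the trivial bound by one is used; above it, the generating function
  of trees is evaluated at its radius of convergence.\<close>

lemma bulk_coeff_le_bulk_rate:
  fixes \<delta> :: real
  assumes \<delta>: "0 < \<delta>" and l: "l \<le> n"
  shows "real n ^ l * bulk_coeff \<alpha> n (\<delta> * n) l \<le> exp (n * bulk_rate \<alpha> (real l / n) + \<alpha>\<^sup>2 + \<alpha> * \<delta> * n)"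
proof (cases "\<alpha> * (real l / n) \<le> 1")
  case True
  have "n * bulk_rate \<alpha> (real l / n) = (real l - real l * ln (real l / n)) + \<alpha> * (real l)\<^sup>2 / (2 * n)"
    using \<alpha> n True by (subst bulk_rate_low) (auto simp: field_simps power2_eq_square)
  moreover have "real n ^ l * bulk_coeff \<alpha> n (\<delta> * n) l \<le> exp (real l - real l * ln (real l / n)) * exp (\<alpha> * (real l)\<^sup>2 / (2 * n) + \<alpha>\<^sup>2)"
  proof -
    have "fact l * (1 - \<alpha> / n) ^ (l choose 2) * bulk_coeff \<alpha> n (\<delta> * n) l \<le> 1"
      unfolding comps_prob_bulk_coeff[symmetric] using p_bounds by (intro comps_prob_le_1) auto
    then have "bulk_coeff \<alpha> n (\<delta> * n) l \<le> 1 / (fact l * (1 - \<alpha> / n) ^ (l choose 2))"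
      using p_bounds by (simp add: field_simps)
    then have "real n ^ l * bulk_coeff \<alpha> n (\<delta> * n) l \<le> real n ^ l * (1 / (fact l * (1 - \<alpha> / n) ^ (l choose 2)))"
      by (intro mult_left_mono) auto
    also have "\<dots> = real n ^ l / fact l * (1 / (1 - \<alpha> / n) ^ (l choose 2))" by simp
    also have "\<dots> \<le> exp (real l - real l * ln (real l / n)) * exp (\<alpha> * (real l)\<^sup>2 / (2 * n) + \<alpha>\<^sup>2)"
      using power_div_fact_upper[of l] inverse_q_choose_le[OF l] p_bounds by (intro mult_mono) auto
    finally show ?thesis .
  qed
  moreover have "\<dots> \<le> exp (n * bulk_rate \<alpha> (real l / n) + \<alpha>\<^sup>2 + \<alpha> * \<delta> * n)"
    using \<alpha> \<delta> calculation(1) by (simp flip: exp_add)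
  ultimately show ?thesis by linarith
next
  case False
  \<comment> \<open>\<open>n / \<alpha> * exp (-1)\<close> is the critical point for the tree bound
    on \<open>conn\<close>; the extra \<open>exp (- \<alpha> * \<delta>)\<close> absorbs the factor
    for absent edges, at most \<open>exp (\<alpha> * \<delta>) ^ k\<close> for
    \<open>k \<le> \<delta> * n\<close>.\<close>
  define x where "x = n / \<alpha> * exp (- 1 - \<alpha> * \<delta>)"
  have x: "x > 0" using \<alpha> n by (simp add: x_def)
  define w where "w k = (if real k \<le> \<delta> * n then weight \<alpha> n k else 0)" for k
  have wx: "w k * x ^ k \<le> n / \<alpha> * (treec k * exp (-1) ^ k)" if k: "k > 0" for k
  proof (cases "real k \<le> \<delta> * n")
    case True
    have q: "1 / (1 - \<alpha> / n) ^ (k choose 2) \<le> exp (\<alpha> * \<delta>) ^ k"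
    proof -
      define p where "p = \<alpha> / n"
      have "exp (- 2 * p) \<le> exp (- p - 2 * p\<^sup>2)"
        using p_bounds(2,3) mult_left_mono[of p "1/2" "2 * p"] unfolding p_def[symmetric]
        by (simp add: power2_eq_square)
      also have "\<dots> \<le> 1 - p" unfolding p_def using p_bounds by (intro one_minus_ge_exp) auto
      finally have "exp (- 2 * p) ^ (k choose 2) \<le> (1 - p) ^ (k choose 2)" by (intro power_mono) auto
      then have "1 / (1 - p) ^ (k choose 2) \<le> 1 / exp (- 2 * p) ^ (k choose 2)"
        using p_bounds unfolding p_def[symmetric] by (intro divide_left_mono) auto
      also have "\<dots> = exp (real (k choose 2) * (2 * p))"
        by (simp add: exp_of_nat_mult[symmetric] exp_minus field_simps)
      also have "\<dots> \<le> exp (real k * (\<alpha> * \<delta>))"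
      proof -
        have "real k * (real k - 1) \<le> real k * (\<delta> * n)" using True by (intro mult_left_mono) auto
        then have "real k * (real k - 1) * p \<le> real k * (\<delta> * n) * p"
          using p_bounds by (intro mult_right_mono) (auto simp: p_def)
        moreover have "real (k choose 2) * (2 * p) = real k * (real k - 1) * p" by (simp add: real_choose_two)
        moreover have "real k * (\<delta> * n) * p = real k * (\<alpha> * \<delta>)" using n by (simp add: p_def)
        ultimately have "real (k choose 2) * (2 * p) \<le> real k * (\<alpha> * \<delta>)" by linarith
        then show ?thesis by (simp only: exp_le_cancel_iff)
      qed
      also have "\<dots> = exp (\<alpha> * \<delta>) ^ k" by (simp add: exp_of_nat_mult)
      finally show ?thesis by (simp add: p_def)
    qed
    have "w k * x ^ k = conn (\<alpha> / n) k * (1 / (1 - \<alpha> / n) ^ (k choose 2)) * (x ^ k / fact k)"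
      using True by (simp add: w_def weight_def)
    also have "\<dots> \<le> (real k ^ (k - 2) * (\<alpha> / n) ^ (k - 1)) * exp (\<alpha> * \<delta>) ^ k * (x ^ k / fact k)"
      using conn_le_trees[OF p_bounds(3,4) k] q x \<alpha> conn_nonneg[OF p_bounds(3,4)] p_bounds
      by (intro mult_mono) auto
    also have "\<dots> = treec k * ((\<alpha> / n) ^ (k - 1) * (exp (\<alpha> * \<delta>) * x) ^ k)"
      using k by (simp add: treec_def power_mult_distrib)
    also have "exp (\<alpha> * \<delta>) * x = n / \<alpha> * exp (-1)"
      by (simp add: x_def exp_diff exp_minus field_simps)
    \<comment> \<open>A tree on \<open>k\<close> vertices has \<open>k - 1\<close> edges, so one of
      the \<open>k\<close> factors \<open>n / \<alpha>\<close> survives.\<close>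
    also have "(\<alpha> / n) ^ (k - 1) * (n / \<alpha> * exp (-1)) ^ k = n / \<alpha> * exp (-1) ^ k"
    proof -
      have "(\<alpha> / n) ^ (k - 1) * (n / \<alpha>) ^ k = (\<alpha> / n * (n / \<alpha>)) ^ (k - 1) * (n / \<alpha>)"
        using k unfolding power_mult_distrib by (cases k) auto
      then have "(\<alpha> / n) ^ (k - 1) * (n / \<alpha>) ^ k = n / \<alpha>" using \<alpha> n by simp
      then show ?thesis by (simp only: power_mult_distrib mult.assoc[symmetric])
    qed
    finally show ?thesis by (simp add: mult_ac)
  qed (use \<alpha> treec_nonneg in \<open>simp add: w_def\<close>)
  have "x ^ l * expc w l \<le> exp (\<Sum>k\<in>{1..l}. w k * x ^ k)"
    using x weight_nonneg by (intro expc_le_exp) (auto simp: w_def)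
  also have "\<dots> \<le> exp (n / \<alpha> * (1 / 2))"
  proof -
    have s: "(\<lambda>k. treec k * exp (-1) ^ k) sums (1 / 2)" using tree_sums(2)[of 1] by simp
    have "(\<Sum>k\<in>{1..l}. w k * x ^ k) \<le> n / \<alpha> * (\<Sum>k\<in>{1..l}. treec k * exp (-1) ^ k)"
      unfolding sum_distrib_left using wx by (intro sum_mono) auto
    also have "\<dots> \<le> n / \<alpha> * (\<Sum>k. treec k * exp (-1) ^ k)"
      using s treec_nonneg \<alpha> by (intro mult_left_mono sum_le_suminf) (auto simp: sums_iff)
    finally show ?thesis using sums_unique[OF s] by (simp only: exp_le_cancel_iff)
  qed
  finally have "x ^ l * bulk_coeff \<alpha> n (\<delta> * n) l \<le> exp (n / (2 * \<alpha>))"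
    unfolding bulk_coeff_def w_def by (simp add: mult.commute)
  then have "(n / x) ^ l * (x ^ l * bulk_coeff \<alpha> n (\<delta> * n) l) \<le> (n / x) ^ l * exp (n / (2 * \<alpha>))"
    using x by (intro mult_left_mono) auto
  also have "(n / x) ^ l * (x ^ l * bulk_coeff \<alpha> n (\<delta> * n) l) = real n ^ l * bulk_coeff \<alpha> n (\<delta> * n) l"
    using x by (simp add: power_divide)
  also have "n / x = exp (ln \<alpha> + 1 + \<alpha> * \<delta>)"
    using \<alpha> n by (simp add: x_def exp_add exp_diff exp_minus field_simps)
  also have "exp (ln \<alpha> + 1 + \<alpha> * \<delta>) ^ l * exp (n / (2 * \<alpha>)) = exp (real l * (ln \<alpha> + 1) + n / (2 * \<alpha>) + \<alpha> * \<delta> * l)"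
    by (simp add: exp_of_nat_mult[symmetric] exp_add[symmetric] algebra_simps)
  also have "\<dots> \<le> exp (n * bulk_rate \<alpha> (real l / n) + \<alpha>\<^sup>2 + \<alpha> * \<delta> * n)"
  proof -
    have "n * bulk_rate \<alpha> (real l / n) = real l * (ln \<alpha> + 1) + n / (2 * \<alpha>)"
      using False \<alpha> n by (subst bulk_rate_high) (auto simp: field_simps)
    moreover have "\<alpha> * \<delta> * l \<le> \<alpha> * \<delta> * n" using \<alpha> \<delta> l by (intro mult_left_mono) auto
    moreover have "0 \<le> \<alpha>\<^sup>2" by simp
    ultimately show ?thesis unfolding exp_le_cancel_iff by linarith
  qed
  finally show ?thesis .
qed

text \<open>There are at most \<open>m / (\<epsilon> * n)\<close> components, and splitting off each
  costs a factor \<open>n / d\<close>: at most \<open>n\<close> sizes, and \<open>1 / d\<close> from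
  \<open>conn_le_macro\<close>. The rest is one term of a binomial expansion of
  \<open>(1 - q ^ m) ^ m\<close>.\<close>

lemma comps_prob_gt_le:
  fixes \<epsilon> :: real
  assumes \<epsilon>: "0 < \<epsilon>" and m: "m \<le> n"
  defines "d \<equiv> 1 - exp (- (\<alpha> * \<epsilon>))"
  shows "comps_prob (\<alpha> / n) (\<lambda>k. \<epsilon> * n < real k) m \<le> (n / d) powr (m / (\<epsilon> * n)) * (1 - (1 - \<alpha> / n) ^ m) ^ m"
  using m
proof (induction m rule: less_induct)
  case (less m)
  define q where "q = 1 - \<alpha> / n"
  define N where "N = n / d"
  have q: "0 < q" "q \<le> 1" using p_bounds by (auto simp: q_def)
  have q1: "0 \<le> 1 - q ^ k" for k using q by (simp add: power_le_one)
  have d: "0 < d" "d \<le> 1" using \<alpha> \<epsilon> by (auto simp: d_def)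
  have "1 \<le> real n" using n by simp
  then have N: "N \<ge> 1" unfolding N_def using d by (simp add: le_divide_eq)
  show ?case
  proof (cases "m = 0")
    case False
    have t: "real ((m - 1) choose j) * (if \<epsilon> * n < real (Suc j) then conn (\<alpha> / n) (Suc j) else 0)
        * q ^ (Suc j * (m - Suc j)) * comps_prob (\<alpha> / n) (\<lambda>k. \<epsilon> * n < real k) (m - Suc j)
        \<le> 1 / d * (N powr (m / (\<epsilon> * n) - 1) * (1 - q ^ m) ^ m)" if j: "j < m" for j
    proof (cases "\<epsilon> * n < real (Suc j)")
      case True
      define k where "k = Suc j"
      have k: "0 < k" "k \<le> m" "\<epsilon> * n < real k" "\<epsilon> * n \<le> real k" using j True by (auto simp: k_def)
      have "m choose k = ((m - 1) choose j) + ((m - 1) choose k)"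
        using False j by (cases m) (auto simp: k_def)
      then have c: "real ((m - 1) choose j) \<le> real (m choose k)" by simp
      have cn: "conn (\<alpha> / n) k \<le> (1 - q ^ k) ^ k / d"
        unfolding d_def q_def using k \<epsilon> less.prems by (intro conn_le_macro) auto
      have "comps_prob (\<alpha> / n) (\<lambda>k. \<epsilon> * n < real k) (m - k) \<le> N powr (real (m - k) / (\<epsilon> * n)) * (1 - q ^ (m - k)) ^ (m - k)"
        unfolding N_def q_def using k less.prems by (intro less.IH) auto
      also have "\<dots> \<le> N powr (m / (\<epsilon> * n) - 1) * (1 - q ^ (m - k)) ^ (m - k)"
      proof (rule mult_right_mono)
        have "real (m - k) / (\<epsilon> * n) \<le> m / (\<epsilon> * n) - 1"
        proof -
          have "1 \<le> real k / (\<epsilon> * n)" using k \<epsilon> n by simp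
          then show ?thesis using k by (simp add: of_nat_diff diff_divide_distrib)
        qed
        then show "N powr (real (m - k) / (\<epsilon> * n)) \<le> N powr (m / (\<epsilon> * n) - 1)" using N by (intro powr_mono) auto
      qed (use q1 in auto)
      finally have g: "comps_prob (\<alpha> / n) (\<lambda>k. \<epsilon> * n < real k) (m - k) \<le> N powr (m / (\<epsilon> * n) - 1) * (1 - q ^ (m - k)) ^ (m - k)" .
      have bin: "real (m choose k) * (1 - q ^ k) ^ k * (q ^ k * (1 - q ^ (m - k))) ^ (m - k) \<le> (1 - q ^ m) ^ m"
      proof -
        have "real (m choose k) * (1 - q ^ k) ^ k * (q ^ k * (1 - q ^ (m - k))) ^ (m - k)
            \<le> (\<Sum>k'\<le>m. real (m choose k') * (1 - q ^ k) ^ k' * (q ^ k * (1 - q ^ (m - k))) ^ (m - k'))"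
          using q q1 k by (intro member_le_sum[of k "{..m}" "\<lambda>k'. real (m choose k') * (1 - q ^ k) ^ k' * (q ^ k * (1 - q ^ (m - k))) ^ (m - k')"]) auto
        also have "\<dots> = ((1 - q ^ k) + q ^ k * (1 - q ^ (m - k))) ^ m" by (simp only: binomial_ring)
        also have "(1 - q ^ k) + q ^ k * (1 - q ^ (m - k)) = 1 - q ^ m"
          using k by (simp add: algebra_simps power_add[symmetric])
        finally show ?thesis .
      qed
      have "real ((m - 1) choose j) * conn (\<alpha> / n) k * q ^ (k * (m - k)) * comps_prob (\<alpha> / n) (\<lambda>k. \<epsilon> * n < real k) (m - k)
          \<le> real (m choose k) * ((1 - q ^ k) ^ k / d) * q ^ (k * (m - k)) * (N powr (m / (\<epsilon> * n) - 1) * (1 - q ^ (m - k)) ^ (m - k))"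
        using c cn g q q1 d comps_prob_nonneg[OF p_bounds(3,4)] conn_nonneg[OF p_bounds(3,4)]
        by (intro mult_mono mult_nonneg_nonneg divide_nonneg_nonneg) auto
      also have "\<dots> = 1 / d * (N powr (m / (\<epsilon> * n) - 1) * (real (m choose k) * (1 - q ^ k) ^ k * (q ^ k * (1 - q ^ (m - k))) ^ (m - k)))"
        by (simp add: power_mult_distrib power_mult mult_ac)
      also have "\<dots> \<le> 1 / d * (N powr (m / (\<epsilon> * n) - 1) * (1 - q ^ m) ^ m)"
        using bin d by (intro mult_left_mono) auto
      finally show ?thesis using True by (simp add: k_def)
    next
      case False
      then show ?thesis using d q1 by simp
    qed
    have "comps_prob (\<alpha> / n) (\<lambda>k. \<epsilon> * n < real k) m \<le> (\<Sum>j<m. 1 / d * (N powr (m / (\<epsilon> * n) - 1) * (1 - q ^ m) ^ m))"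
    proof -
      have "comps_prob (\<alpha> / n) (\<lambda>k. \<epsilon> * n < real k) m
        = (\<Sum>j<m. real ((m - 1) choose j) * (if \<epsilon> * n < real (Suc j) then conn (\<alpha> / n) (Suc j) else 0)
        * q ^ (Suc j * (m - Suc j)) * comps_prob (\<alpha> / n) (\<lambda>k. \<epsilon> * n < real k) (m - Suc j))"
        unfolding q_def by (subst comps_prob.simps) (simp only: False if_False)
      also have "\<dots> \<le> (\<Sum>j<m. 1 / d * (N powr (m / (\<epsilon> * n) - 1) * (1 - q ^ m) ^ m))"
        by (intro sum_mono t) simp
      finally show ?thesis .
    qed
    also have "\<dots> = real m / d * (N powr (m / (\<epsilon> * n) - 1) * (1 - q ^ m) ^ m)" by simp
    also have "\<dots> \<le> N * (N powr (m / (\<epsilon> * n) - 1) * (1 - q ^ m) ^ m)"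
      unfolding N_def using less.prems d q1 by (intro mult_right_mono divide_right_mono) auto
    also have "\<dots> = N powr (m / (\<epsilon> * n)) * (1 - q ^ m) ^ m"
      using N by (simp add: powr_diff)
    finally show ?thesis by (simp add: N_def q_def)
  qed (use d n in \<open>simp add: comps_prob.simps\<close>)
qed

text \<open>Only connected graphs are kept, that is the last summand of the recursion.\<close>

lemma comps_prob_gt_ge:
  fixes \<epsilon> :: real
  assumes "\<epsilon> * n < real m" "0 < m" "m \<le> n"
  shows "(1 - exp (- (\<alpha> * (real m / n)))) ^ m / m \<le> comps_prob (\<alpha> / n) (\<lambda>k. \<epsilon> * n < real k) m"
proof -
  define e where "e = 1 - exp (- (\<alpha> * (real m / n)))"
  have e: "0 \<le> e" "e \<le> 1 - (1 - \<alpha> / n) ^ m" using \<alpha> n q_pow_le[of m] by (auto simp: e_def)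
  have "e ^ m / m \<le> (1 - (1 - \<alpha> / n) ^ m) ^ m / m"
    using e by (intro divide_right_mono power_mono) auto
  also have "\<dots> \<le> (1 - (1 - \<alpha> / n) ^ m) ^ (m - 1) / m"
    using e p_bounds by (intro divide_right_mono power_decreasing) auto
  also have "\<dots> \<le> conn (\<alpha> / n) m" using p_bounds assms by (intro conn_ge) auto
  also have "\<dots> \<le> comps_prob (\<alpha> / n) (\<lambda>k. \<epsilon> * n < real k) m"
  proof -
    define h where "h j = real ((m - 1) choose j) * (if \<epsilon> * n < real (Suc j) then conn (\<alpha> / n) (Suc j) else 0)
        * (1 - \<alpha> / n) ^ (Suc j * (m - Suc j)) * comps_prob (\<alpha> / n) (\<lambda>k. \<epsilon> * n < real k) (m - Suc j)" for j
    have "conn (\<alpha> / n) m = h (m - 1)" using assms by (simp add: h_def comps_prob.simps[of _ _ 0])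
    also have "\<dots> \<le> (\<Sum>j<m. h j)"
      using assms p_bounds comps_prob_nonneg[OF p_bounds(3,4)] conn_nonneg[OF p_bounds(3,4)]
      by (intro member_le_sum) (auto simp: h_def)
    also have "\<dots> = comps_prob (\<alpha> / n) (\<lambda>k. \<epsilon> * n < real k) m"
      using assms by (subst comps_prob.simps) (simp add: h_def)
    finally show ?thesis .
  qed
  finally show ?thesis by (simp add: e_def)
qed

end

section \<open>Lower bound for small components\<close>

text \<open>At 0 the product has the value 0, and \<open>2 * sqrt x\<close> dominates it nearby.
  Densities that tend to 0 can thus be treated like all others.\<close>

lemma continuous_on_x_ln_x: "continuous_on {0..} (\<lambda>x::real. x * ln x)"
  unfolding continuous_on_eq_continuous_within
proof
  fix x :: real assume "x \<in> {0..}"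
  then consider "x > 0" | "x = 0" by fastforce
  then show "continuous (at x within {0..}) (\<lambda>x. x * ln x)"
  proof cases
    case 1
    then show ?thesis by (intro continuous_intros) auto
  next
    case 2
    have bound: "\<bar>x * ln x\<bar> \<le> 2 * sqrt x" if "0 < x" "x < 1" for x :: real
    proof -
      have "- ln (sqrt x) \<le> 1 / sqrt x - 1"
        using ln_le_minus_one[of "1 / sqrt x"] that by (simp add: ln_div)
      then have "- ln x \<le> 2 * (1 / sqrt x)" using that by (simp add: ln_sqrt)
      then have "x * (- ln x) \<le> x * (2 * (1 / sqrt x))" using that by (intro mult_left_mono) auto
      also have "\<dots> = 2 * (x / sqrt x)" by simp
      also have "\<dots> = 2 * sqrt x" using that by (subst real_div_sqrt) auto
      finally show ?thesis using that by (simp add: abs_mult)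
    qed
    have "((\<lambda>x::real. x * ln x) \<longlongrightarrow> 0) (at 0 within {0..})"
    proof (rule Lim_null_comparison)
      have "\<forall>\<^sub>F x in at (0::real) within {0..}. x < 1"
        by (rule order_tendstoD[OF tendsto_ident_at]) simp
      moreover have "\<forall>\<^sub>F x in at (0::real) within {0..}. x \<in> {0..} \<and> x \<noteq> 0"
        by (simp add: eventually_at_filter)
      ultimately show "\<forall>\<^sub>F x in at (0::real) within {0..}. norm (x * ln x) \<le> 2 * sqrt x"
        by eventually_elim (use bound in auto)
      have "((\<lambda>x. 2 * sqrt x) \<longlongrightarrow> 2 * sqrt 0) (at (0::real) within {0..})" by (intro tendsto_intros)
      then show "((\<lambda>x. 2 * sqrt x) \<longlongrightarrow> 0) (at (0::real) within {0..})" by simp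
    qed
    then show ?thesis using 2 by (simp add: continuous_within)
  qed
qed

text \<open>Stirling in the variable \<open>c n / n\<close>; the continuity of
  \<open>x * ln x\<close> at 0 includes \<open>\<nu> = 0\<close>, where \<open>c n\<close> may be
  bounded or zero.\<close>

lemma fact_asymp:
  fixes c :: "nat \<Rightarrow> nat"
  assumes c: "(\<lambda>n. real (c n) / n) \<longlonglongrightarrow> \<nu>"
  shows "(\<lambda>n. (ln (fact (c n)) - real (c n) * ln n) / n) \<longlonglongrightarrow> \<nu> * ln \<nu> - \<nu>"
proof -
  have "\<nu> \<ge> 0" using c by (rule LIMSEQ_le_const) auto
  then have xlx: "(\<lambda>n. real (c n) / n * ln (real (c n) / n)) \<longlonglongrightarrow> \<nu> * ln \<nu>"
    by (intro continuous_on_tendsto_compose[OF continuous_on_x_ln_x c]) auto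
  define A where "A n = real (c n) / n * ln (real (c n) / n) - real (c n) / n" for n
  have A: "A \<longlonglongrightarrow> \<nu> * ln \<nu> - \<nu>" unfolding A_def by (intro tendsto_intros xlx c)
  have Aeq: "A n = (real (c n) * ln (c n) - real (c n) - real (c n) * ln n) / n" if "n > 0" for n
  proof (cases "c n = 0")
    case False
    then have "ln (real (c n) / n) = ln (c n) - ln n" using that by (subst ln_div) auto
    then show ?thesis unfolding A_def by (simp only:) (simp add: algebra_simps diff_divide_distrib add_divide_distrib)
  qed (simp add: A_def)
  have ev: "\<forall>\<^sub>F n in sequentially. real (c n) / n < \<nu> + 1 \<and> n > 0"
    using order_tendstoD(2)[OF c, of "\<nu> + 1"] eventually_gt_at_top[of 0] by (auto elim: eventually_conj)
  \<comment> \<open>The error \<open>1 + ln (c n)\<close> of \<open>ln_fact_le\<close>, with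
    \<open>c n \<le> (\<nu> + 2) * n\<close> eventually.\<close>
  define D where "D n = (1 + ln (\<nu> + 2) + ln n) / n" for n :: nat
  have "(\<lambda>n. (1 + ln (\<nu> + 2)) / real n + ln n / n) \<longlonglongrightarrow> 0 + 0"
    by (intro tendsto_add lim_const_over_n lim_ln_over_n)
  then have D: "D \<longlonglongrightarrow> 0" by (simp add: D_def[abs_def] add_divide_distrib)
  show ?thesis
  proof (rule tendsto_sandwich[OF _ _ A])
    show "(\<lambda>n. A n + D n) \<longlonglongrightarrow> \<nu> * ln \<nu> - \<nu>" using tendsto_add[OF A D] by simp
    show "\<forall>\<^sub>F n in sequentially. A n \<le> (ln (fact (c n)) - real (c n) * ln n) / n"
      using eventually_gt_at_top[of 0]
    proof eventually_elim
      case (elim n)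
      show ?case unfolding Aeq[OF elim] using ln_fact_ge[of "c n"] by (intro divide_right_mono) auto
    qed
    show "\<forall>\<^sub>F n in sequentially. (ln (fact (c n)) - real (c n) * ln n) / n \<le> A n + D n"
      using ev
    proof eventually_elim
      case (elim n)
      have "ln (fact (c n)) \<le> real (c n) * ln (c n) - c n + (1 + ln (\<nu> + 2) + ln n)"
      proof (cases "c n = 0")
        case True
        then show ?thesis using elim \<open>\<nu> \<ge> 0\<close> by simp
      next
        case False
        have "real (c n) \<le> (\<nu> + 1) * n" using elim by (auto simp: pos_divide_less_eq)
        also have "\<dots> \<le> (\<nu> + 2) * n" by (intro mult_right_mono) auto
        finally have "ln (c n) \<le> ln ((\<nu> + 2) * n)" using False by (intro ln_mono) auto
        also have "\<dots> = ln (\<nu> + 2) + ln n" using elim \<open>\<nu> \<ge> 0\<close> by (simp add: ln_mult_pos)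
        finally show ?thesis using ln_fact_le[of "c n"] False by simp
      qed
      then have "(ln (fact (c n)) - real (c n) * ln n) / n
          \<le> ((real (c n) * ln (c n) - c n - real (c n) * ln n) + (1 + ln (\<nu> + 2) + ln n)) / n"
        by (intro divide_right_mono) auto
      then show ?case using Aeq elim by (simp add: D_def add_divide_distrib[symmetric])
    qed
  qed
qed

lemma eventually_large: "\<forall>\<^sub>F n in sequentially. real n \<ge> C \<and> n > 0"
  using filterlim_at_top[THEN iffD1, OF filterlim_real_sequentially, rule_format, of C] eventually_gt_at_top[of 0]
  by eventually_elim auto

lemma nat_floor_ratio_tendsto:
  fixes \<kappa> :: real
  assumes "0 \<le> \<kappa>"
  shows "(\<lambda>n. real (nat \<lfloor>\<kappa> * real n\<rfloor>) / n) \<longlonglongrightarrow> \<kappa>"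
proof (rule tendsto_sandwich[of "\<lambda>n. \<kappa> - 1 / real n" _ _ "\<lambda>n. \<kappa>"])
  have "(\<lambda>n. \<kappa> - 1 / real n) \<longlonglongrightarrow> \<kappa> - 0" by (intro tendsto_intros lim_const_over_n)
  then show "(\<lambda>n. \<kappa> - 1 / real n) \<longlonglongrightarrow> \<kappa>" by simp
  have *: "\<kappa> * real n - 1 \<le> nat \<lfloor>\<kappa> * real n\<rfloor> \<and> nat \<lfloor>\<kappa> * real n\<rfloor> \<le> \<kappa> * real n" for n :: nat
  proof -
    have "0 \<le> \<lfloor>\<kappa> * real n\<rfloor>" using assms by simp
    then show ?thesis by linarith
  qed
  show "\<forall>\<^sub>F n in sequentially. \<kappa> - 1 / real n \<le> real (nat \<lfloor>\<kappa> * real n\<rfloor>) / n"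
    using eventually_gt_at_top[of 0]
  proof eventually_elim
    case (elim n)
    then have "\<kappa> - 1 / real n = (\<kappa> * real n - 1) / n" by (simp add: field_simps)
    also have "\<dots> \<le> real (nat \<lfloor>\<kappa> * real n\<rfloor>) / n" using * by (intro divide_right_mono) auto
    finally show ?case .
  qed
  show "\<forall>\<^sub>F n in sequentially. real (nat \<lfloor>\<kappa> * real n\<rfloor>) / n \<le> \<kappa>"
    using eventually_gt_at_top[of 0] by eventually_elim (use * in \<open>simp add: divide_le_eq\<close>)
qed auto

section \<open>Components of bounded size\<close>

text \<open>A lower bound for \<open>n ^ (k - 1) * weight \<alpha> n k\<close>, from
  \<open>1 - exp (- x) \<ge> x / (1 + x)\<close>. For fixed \<open>k\<close> it is positive and
  converges to the weight of trees.\<close>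

definition tree_weight_lb :: "real \<Rightarrow> nat \<Rightarrow> nat \<Rightarrow> real" where
  "tree_weight_lb \<alpha> n k = (\<alpha> * k / (1 + \<alpha> * k / n)) ^ (k - 1) / (k * fact k)"

lemma weight_ge_tree:
  assumes "\<alpha> > 0" "real n \<ge> 2 * \<alpha>" "n > 0" "k > 0"
  shows "n * tree_weight_lb \<alpha> n k \<le> real n ^ k * weight \<alpha> n k"
proof -
  note p = p_bounds[OF assms(1-3)]
  define x where "x = \<alpha> * (real k / n)"
  have x: "x > 0" using assms by (simp add: x_def)
  have "x / (1 + x) \<le> 1 - exp (- x)"
    using exp_ge_add_one_self[of x] x by (simp add: exp_minus field_simps)
  also have "\<dots> \<le> 1 - (1 - \<alpha> / n) ^ k" using q_pow_le[OF assms(1-3), of k] by (simp add: x_def)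
  finally have "(x / (1 + x)) ^ (k - 1) / k \<le> (1 - (1 - \<alpha> / n) ^ k) ^ (k - 1) / k"
    using x by (intro divide_right_mono power_mono) auto
  also have "\<dots> \<le> conn (\<alpha> / n) k" using p assms by (intro conn_ge) auto
  finally have c: "(x / (1 + x)) ^ (k - 1) / k \<le> conn (\<alpha> / n) k" .
  have q: "(1 - \<alpha> / n) ^ (k choose 2) * fact k \<le> fact k" "0 < (1 - \<alpha> / n) ^ (k choose 2)"
    using p by (auto simp: power_le_one mult_left_le_one_le)
  have "n * tree_weight_lb \<alpha> n k = real n ^ k * ((x / (1 + x)) ^ (k - 1) / k / fact k)"
  proof -
    have "\<alpha> * k / (1 + \<alpha> * k / n) = n * (x / (1 + x))" using assms by (simp add: x_def)
    moreover have "real n ^ k = n * n ^ (k - 1)" using assms by (cases k) auto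
    ultimately show ?thesis by (simp add: tree_weight_lb_def power_mult_distrib power_divide)
  qed
  also have "\<dots> \<le> real n ^ k * (conn (\<alpha> / n) k / fact k)"
    using c by (intro mult_left_mono divide_right_mono) auto
  also have "\<dots> \<le> real n ^ k * weight \<alpha> n k"
    unfolding weight_def using q conn_nonneg[OF p(3,4)] by (intro mult_left_mono divide_left_mono) auto
  finally show ?thesis .
qed

lemma tree_weight_lb_pos: "\<alpha> > 0 \<Longrightarrow> n > 0 \<Longrightarrow> k > 0 \<Longrightarrow> tree_weight_lb \<alpha> n k > 0"
  unfolding tree_weight_lb_def by (intro divide_pos_pos zero_less_power mult_pos_pos add_pos_nonneg) auto

lemma tree_weight_lb_tendsto:
  assumes "k > 0"
  shows "(\<lambda>n. tree_weight_lb \<alpha> n k) \<longlonglongrightarrow> treec k * \<alpha> ^ (k - 1)"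
proof -
  have "(\<lambda>n. (\<alpha> * k / (1 + \<alpha> * k / real n)) ^ (k - 1) / (k * fact k)) \<longlonglongrightarrow> (\<alpha> * k / (1 + 0)) ^ (k - 1) / (k * fact k)"
    using assms by (intro tendsto_intros lim_const_over_n) auto
  moreover have "(\<alpha> * k / (1 + 0)) ^ (k - 1) / (k * fact k) = treec k * \<alpha> ^ (k - 1)"
  proof (cases "k = 1")
    case False
    with assms have "k - 1 = Suc (k - 2)" by simp
    then have "real k ^ (k - 1) = k * real k ^ (k - 2)" by (metis power_Suc)
    then show ?thesis using assms by (simp add: treec_def power_mult_distrib)
  qed (simp add: treec_def)
  ultimately show ?thesis unfolding tree_weight_lb_def by simp
qed

lemma treec_pos: "k > 0 \<Longrightarrow> treec k > 0"
  by (simp add: treec_def)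

lemma ln_treec_ge:
  assumes "R \<ge> 2"
  shows "real R - 1 - 3 * ln R \<le> ln (treec R)"
proof -
  have "ln (treec R) = (real R - 2) * ln R - ln (fact R)"
    using assms by (simp add: treec_def ln_div ln_realpow of_nat_diff)
  then show ?thesis using ln_fact_le[of R] assms by (simp add: algebra_simps)
qed

text \<open>Only the configuration with \<open>c k\<close> tree components of each size \<open>k \<le> R\<close> is kept.\<close>

lemma bulk_coeff_ge_config:
  fixes l :: "nat \<Rightarrow> nat" and \<nu> :: "nat \<Rightarrow> real" and \<alpha> \<epsilon> \<eta> x :: real
  assumes \<alpha>: "\<alpha> > 0" and \<epsilon>: "\<epsilon> > 0" and \<eta>: "\<eta> > 0" and l: "(\<lambda>n. real (l n) / n) \<longlonglongrightarrow> x"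
    and R: "R \<ge> 2" and \<nu>: "\<And>k. 1 \<le> k \<Longrightarrow> k \<le> R \<Longrightarrow> \<nu> k > 0" and x: "(\<Sum>k\<in>{1..R}. real k * \<nu> k) = x"
  shows "\<forall>\<^sub>F n in sequentially. exp (n * ((\<Sum>k\<in>{1..R}. \<nu> k * ln (treec k * \<alpha> ^ (k - 1)) - (\<nu> k * ln (\<nu> k) - \<nu> k)) - \<eta>))
    \<le> real n ^ l n * bulk_coeff \<alpha> n (\<epsilon> * n) (l n)"
proof -
  define f where "f n k = nat \<lfloor>\<nu> k * real n\<rfloor>" for n :: nat and k
  \<comment> \<open>Isolated vertices absorb the rounding, so that the sizes add up to exactly
    \<open>l n\<close>; \<open>\<nu> 1 > 0\<close> keeps the truncated subtraction exact for large
    \<open>n\<close>.\<close>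
  define c where "c n k = (if k = 1 then l n - (\<Sum>j\<in>{2..R}. j * f n j) else f n k)" for n k
  have split: "{1..R} = insert 1 {2..R}" using R by auto
  have flim: "(\<lambda>n. real (f n k) / n) \<longlonglongrightarrow> \<nu> k" if k: "1 \<le> k" "k \<le> R" for k
    unfolding f_def using \<nu>[OF k] by (intro nat_floor_ratio_tendsto) simp
  define s where "s n = (\<Sum>j\<in>{2..R}. j * f n j)" for n
  have \<nu>1: "x - (\<Sum>j\<in>{2..R}. real j * \<nu> j) = \<nu> 1" unfolding x[symmetric] split by simp
  have dlim: "(\<lambda>n. real (l n) / n - real (s n) / n) \<longlonglongrightarrow> \<nu> 1"
  proof -
    have "(\<lambda>n. real (l n) / n - (\<Sum>j\<in>{2..R}. real j * (real (f n j) / n))) \<longlonglongrightarrow> x - (\<Sum>j\<in>{2..R}. real j * \<nu> j)"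
      by (intro tendsto_intros l flim) auto
    then show ?thesis by (simp add: \<nu>1 s_def sum_divide_distrib)
  qed
  have \<nu>1_pos: "\<nu> 1 > 0" using \<nu>[of 1] R by simp
  have ev_s: "\<forall>\<^sub>F n in sequentially. s n \<le> l n"
    using order_tendstoD(1)[OF dlim \<nu>1_pos] eventually_gt_at_top[of 0]
  proof eventually_elim
    case (elim n)
    then have "real (s n) < real (l n)" using R by (auto simp: field_simps)
    then show ?case by simp
  qed
  have clim: "(\<lambda>n. real (c n k) / n) \<longlonglongrightarrow> \<nu> k" if k: "1 \<le> k" "k \<le> R" for k
  proof (cases "k = 1")
    case True
    have "\<forall>\<^sub>F n in sequentially. real (l n) / n - real (s n) / n = real (c n k) / n"
      using ev_s by eventually_elim (use True in \<open>simp add: c_def s_def of_nat_diff diff_divide_distrib\<close>)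
    then show ?thesis using tendsto_cong[THEN iffD1, OF _ dlim] True by simp
  next
    case False
    then show ?thesis using flim[OF k] by (simp add: c_def)
  qed
  \<comment> \<open>Each component brings a factor \<open>n\<close> through its weight, so
    \<open>n ^ c n k\<close> meets the factorial of \<open>c n k\<close>; hence the combination
    treated in \<open>fact_asymp\<close>.\<close>
  define A where "A n = (\<Sum>k\<in>{1..R}. real (c n k) / n * ln (tree_weight_lb \<alpha> n k)
      - (ln (fact (c n k)) - real (c n k) * ln n) / n)" for n
  have "A \<longlonglongrightarrow> (\<Sum>k\<in>{1..R}. \<nu> k * ln (treec k * \<alpha> ^ (k - 1)) - (\<nu> k * ln (\<nu> k) - \<nu> k))"
    unfolding A_def
  proof (intro tendsto_sum tendsto_diff tendsto_mult fact_asymp clim tendsto_ln tree_weight_lb_tendsto)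
    fix k assume "k \<in> {1..R}"
    then show "treec k * \<alpha> ^ (k - 1) \<noteq> 0" using treec_pos[of k] \<alpha> by simp
  qed auto
  from order_tendstoD(1)[OF this, of "(\<Sum>k\<in>{1..R}. \<nu> k * ln (treec k * \<alpha> ^ (k - 1)) - (\<nu> k * ln (\<nu> k) - \<nu> k)) - \<eta>"]
  have evA: "\<forall>\<^sub>F n in sequentially. (\<Sum>k\<in>{1..R}. \<nu> k * ln (treec k * \<alpha> ^ (k - 1)) - (\<nu> k * ln (\<nu> k) - \<nu> k)) - \<eta> < A n"
    using \<eta> by simp
  show ?thesis
    using evA ev_s eventually_large[of "max (2 * \<alpha>) (R / \<epsilon>)"]
  proof eventually_elim
    case (elim n)
    then have n: "real n \<ge> 2 * \<alpha>" "n > 0" "real R \<le> \<epsilon> * n" using \<epsilon> by (auto simp: field_simps)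
    have lsum: "l n = (\<Sum>k\<in>{1..R}. k * c n k)"
    proof -
      have "(\<Sum>k\<in>{2..R}. k * c n k) = s n" unfolding s_def by (intro sum.cong) (auto simp: c_def)
      moreover have "c n 1 = l n - s n" by (simp add: c_def s_def)
      ultimately show ?thesis unfolding split using elim by simp
    qed
    have "exp (n * A n) = (\<Prod>k\<in>{1..R}. (n * tree_weight_lb \<alpha> n k) ^ c n k / fact (c n k))"
    proof -
      have "n * A n = (\<Sum>k\<in>{1..R}. real (c n k) * ln (tree_weight_lb \<alpha> n k) - (ln (fact (c n k)) - real (c n k) * ln n))"
        unfolding A_def sum_distrib_left right_diff_distrib using n by (intro sum.cong) auto
      also have "\<dots> = (\<Sum>k\<in>{1..R}. ln ((n * tree_weight_lb \<alpha> n k) ^ c n k / fact (c n k)))"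
      proof (rule sum.cong[OF refl])
        fix k assume "k \<in> {1..R}"
        then have "tree_weight_lb \<alpha> n k > 0" using tree_weight_lb_pos[OF \<alpha>, of n k] n by simp
        then show "real (c n k) * ln (tree_weight_lb \<alpha> n k) - (ln (fact (c n k)) - real (c n k) * ln n)
            = ln ((n * tree_weight_lb \<alpha> n k) ^ c n k / fact (c n k))"
          using n by (simp add: ln_div ln_realpow ln_mult_pos algebra_simps)
      qed
      finally have "exp (n * A n) = (\<Prod>k\<in>{1..R}. exp (ln ((n * tree_weight_lb \<alpha> n k) ^ c n k / fact (c n k))))"
        by (simp add: exp_sum)
      also have "\<dots> = (\<Prod>k\<in>{1..R}. (n * tree_weight_lb \<alpha> n k) ^ c n k / fact (c n k))"
        using tree_weight_lb_pos[OF \<alpha>, of n] n by (intro prod.cong) auto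
      finally show ?thesis .
    qed
    also have "\<dots> \<le> (\<Prod>k\<in>{1..R}. (real n ^ k * weight \<alpha> n k) ^ c n k / fact (c n k))"
    proof (rule prod_mono)
      fix k assume "k \<in> {1..R}"
      then have "0 < tree_weight_lb \<alpha> n k" "n * tree_weight_lb \<alpha> n k \<le> real n ^ k * weight \<alpha> n k"
        using tree_weight_lb_pos[OF \<alpha>, of n k] weight_ge_tree[OF \<alpha> n(1,2), of k] n by auto
      then show "0 \<le> (n * tree_weight_lb \<alpha> n k) ^ c n k / fact (c n k) \<and>
          (n * tree_weight_lb \<alpha> n k) ^ c n k / fact (c n k) \<le> (real n ^ k * weight \<alpha> n k) ^ c n k / fact (c n k)"
        by (auto intro!: divide_right_mono power_mono)
    qed
    also have "\<dots> = real n ^ l n * (\<Prod>k\<in>{1..R}. weight \<alpha> n k ^ c n k / fact (c n k))"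
      unfolding lsum by (simp add: power_sum power_mult power_mult_distrib prod.distrib prod_dividef)
    also have "(\<Prod>k\<in>{1..R}. weight \<alpha> n k ^ c n k / fact (c n k))
        = (\<Prod>k\<in>{1..R}. (if real k \<le> \<epsilon> * n then weight \<alpha> n k else 0) ^ c n k / fact (c n k))"
      using n by (intro prod.cong refl) auto
    also have "real n ^ l n * \<dots> \<le> real n ^ l n * bulk_coeff \<alpha> n (\<epsilon> * n) (l n)"
      unfolding bulk_coeff_def by (subst (2) lsum, intro mult_left_mono expc_ge_term)
        (use weight_nonneg[OF \<alpha> n(1,2)] in auto)
    finally have "exp (n * A n) \<le> real n ^ l n * bulk_coeff \<alpha> n (\<epsilon> * n) (l n)" .
    moreover have "exp (n * ((\<Sum>k\<in>{1..R}. \<nu> k * ln (treec k * \<alpha> ^ (k - 1)) - (\<nu> k * ln (\<nu> k) - \<nu> k)) - \<eta>)) \<le> exp (n * A n)"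
      using elim by (simp add: mult_left_mono)
    ultimately show ?case by linarith
  qed
qed

text \<open>Capping \<open>T\<close> at the critical value 1 unites both regimes. The left side is
  the rate for tree densities \<open>treec k * y ^ k / \<alpha>\<close> with
  \<open>y = T * exp (- T)\<close>: \<open>ln (\<alpha> / y)\<close> per vertex, plus the total
  number of components \<open>(T - T\<^sup>2 / 2) / \<alpha>\<close>.\<close>

lemma bulk_rate_eq_tree:
  assumes "\<alpha> > 0" "x > 0"
  defines "T \<equiv> min (\<alpha> * x) 1"
  shows "x * ln (\<alpha> / (T * exp (- T))) + (T - T\<^sup>2 / 2) / \<alpha> = bulk_rate \<alpha> x"
proof (cases "\<alpha> * x \<le> 1")
  case True
  then have T: "T = \<alpha> * x" by (simp add: T_def)
  have h1: "ln (\<alpha> / (T * exp (- T))) = - ln x + \<alpha> * x"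
    unfolding T using assms by (simp add: ln_div ln_mult_pos)
  have h2: "(T - T\<^sup>2 / 2) / \<alpha> = x - \<alpha> * x\<^sup>2 / 2"
    unfolding T using assms by (simp add: field_simps power2_eq_square)
  have "bulk_rate \<alpha> x = x - x * ln x + \<alpha> * x\<^sup>2 / 2" using True assms by (intro bulk_rate_low) auto
  then show ?thesis unfolding h1 h2 by (simp add: algebra_simps power2_eq_square)
next
  case False
  then have T: "T = 1" by (simp add: T_def)
  show ?thesis unfolding T using False assms
    by (simp add: bulk_rate_high ln_div)
qed

text \<open>The densities \<open>treec k * y ^ k / \<alpha>\<close> are the Lagrange maximisers of
  the rate in \<open>bulk_coeff_ge_config\<close>. Their total mass \<open>T / \<alpha>\<close> may
  fall short of \<open>x\<close>, and only sizes up to \<open>R\<close> are allowed; all missing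
  mass is put on trees of size \<open>R\<close>, and then \<open>R\<close> is taken large.\<close>

lemma bulk_coeff_ge_bulk_rate:
  fixes l :: "nat \<Rightarrow> nat" and \<alpha> \<epsilon> \<eta> x :: real
  assumes \<alpha>: "\<alpha> > 0" and \<epsilon>: "\<epsilon> > 0" and \<eta>: "\<eta> > 0" and l: "(\<lambda>n. real (l n) / n) \<longlonglongrightarrow> x"
  shows "\<forall>\<^sub>F n in sequentially. exp (n * (bulk_rate \<alpha> x - \<eta>)) \<le> real n ^ l n * bulk_coeff \<alpha> n (\<epsilon> * n) (l n)"
proof (cases "x = 0")
  \<comment> \<open>The rate is 0 here, and \<open>l n\<close> isolated vertices achieve it, as
    \<open>fact (l n) \<le> n ^ l n\<close> once \<open>l n \<le> n\<close>.\<close>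
  case True
  have "\<forall>\<^sub>F n in sequentially. real (l n) / n < 1" using order_tendstoD(2)[OF l, of 1] True by simp
  then show ?thesis
    using eventually_large[of "max (2 * \<alpha>) (1 / \<epsilon>)"]
  proof eventually_elim
    case (elim n)
    then have n: "real n \<ge> 2 * \<alpha>" "n > 0" "1 \<le> \<epsilon> * n" using \<epsilon> by (auto simp: field_simps)
    have ln: "l n \<le> n" using elim by (simp add: field_simps)
    have "exp (n * (bulk_rate \<alpha> x - \<eta>)) \<le> 1" using True \<eta> by (simp add: bulk_rate_def)
    also have "1 \<le> real n ^ l n / fact (l n)"
    proof -
      have "(fact (l n) :: real) \<le> real (l n ^ l n)" by (rule fact_le_power)
      also have "\<dots> \<le> real n ^ l n" using ln by (simp add: power_mono)
      finally show ?thesis by simp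
    qed
    also have "\<dots> = real n ^ l n * (\<Prod>k\<in>{1}. (if real k \<le> \<epsilon> * n then weight \<alpha> n k else 0) ^ l n / fact (l n))"
      using n by (simp add: weight_def numeral_2_eq_2)
    also have "\<dots> \<le> real n ^ l n * bulk_coeff \<alpha> n (\<epsilon> * n) (\<Sum>k\<in>{1}. k * l n)"
      unfolding bulk_coeff_def using weight_nonneg[OF \<alpha> n(1,2)] by (intro mult_left_mono expc_ge_term) auto
    finally show ?case by simp
  qed
next
  case False
  moreover have "x \<ge> 0" using l by (rule LIMSEQ_le_const) auto
  ultimately have x: "x > 0" by simp
  define T where "T = min (\<alpha> * x) 1"
  define y where "y = T * exp (- T)"
  define \<nu> where "\<nu> k = treec k * y ^ k / \<alpha>" for k
  have T: "0 < T" "T \<le> 1" using \<alpha> x by (auto simp: T_def)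
  have y: "y > 0" using T by (simp add: y_def)
  have \<nu>pos: "\<nu> k > 0" if "k > 0" for k using treec_pos[OF that] y \<alpha> by (simp add: \<nu>_def)
  have \<nu>0: "\<nu> 0 = 0" "\<nu> k \<ge> 0" for k using treec_nonneg[of k] y \<alpha> by (auto simp: \<nu>_def treec_def)
  have sum1: "(\<lambda>k. real k * \<nu> k) sums (T / \<alpha>)"
    using sums_divide[OF tree_sums(1)[OF T], of \<alpha>] by (simp add: \<nu>_def y_def mult.assoc)
  have sum2: "\<nu> sums ((T - T\<^sup>2 / 2) / \<alpha>)"
    using sums_divide[OF tree_sums(2)[OF T], of \<alpha>] by (simp add: \<nu>_def[abs_def] y_def)
  define a where "a R = x - (\<Sum>k<R. real k * \<nu> k)" for R
  have a_lim: "a \<longlonglongrightarrow> x - T / \<alpha>"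
    unfolding a_def using sum1 by (intro tendsto_intros) (simp add: sums_def)
  have Tx: "T / \<alpha> \<le> x" using \<alpha> by (simp add: T_def field_simps)
  have part: "(\<Sum>k<R. real k * \<nu> k) \<le> T / \<alpha>" for R
    using sum_le_suminf[of "\<lambda>k. real k * \<nu> k" "{..<R}"] sum1 \<nu>0 by (auto simp: sums_iff)
  have a_le: "a R \<le> x" for R unfolding a_def using \<nu>0 by (simp add: sum_nonneg)
  \<comment> \<open>Makes the density at the cutoff positive, so that its logarithm is
    meaningful.\<close>
  have a_ge: "real R * \<nu> R \<le> a R" for R
    using part[of "Suc R"] Tx by (simp add: a_def)
  \<comment> \<open>\<open>a R\<close> is the mass that sizes below \<open>R\<close> leave over;
    divided by \<open>R\<close> it becomes a number of components.\<close>
  define \<nu>' where "\<nu>' R k = (if k = R then a R / R else \<nu> k)" for R k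
  define G where "G R = (\<Sum>k\<in>{1..R}. \<nu>' R k * ln (treec k * \<alpha> ^ (k - 1)) - (\<nu>' R k * ln (\<nu>' R k) - \<nu>' R k))" for R
  define L where "L = ln (\<alpha> / y)"
  define H where "H R = x * L + (\<Sum>k<R. \<nu> k)
      - (a R * ((ln x + ln \<alpha> + 1) / R + 2 * (ln R / R)) + a R * (- 1 - ln y))" for R :: nat
  have H_lim: "H \<longlonglongrightarrow> bulk_rate \<alpha> x"
  proof -
    have "H \<longlonglongrightarrow> x * L + (T - T\<^sup>2 / 2) / \<alpha> - ((x - T / \<alpha>) * (0 + 2 * 0) + (x - T / \<alpha>) * (- 1 - ln y))"
      unfolding H_def by (intro tendsto_intros a_lim lim_const_over_n lim_ln_over_n) (use sum2 in \<open>simp add: sums_def\<close>)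
    \<comment> \<open>The surplus is free in the limit: below criticality the first factor vanishes,
      from criticality on the second, because then \<open>y = exp (-1)\<close>.\<close>
    moreover have "(x - T / \<alpha>) * (- 1 - ln y) = 0"
    proof (cases "T = 1")
      case True
      then show ?thesis by (simp add: y_def)
    next
      case False
      then have "T = \<alpha> * x" by (simp add: T_def min_def split: if_splits)
      then show ?thesis using \<alpha> by simp
    qed
    moreover have "x * L + (T - T\<^sup>2 / 2) / \<alpha> = bulk_rate \<alpha> x"
      unfolding L_def y_def T_def by (rule bulk_rate_eq_tree[OF \<alpha> x])
    ultimately show ?thesis by simp
  qed
  have GH: "H R \<le> G R" and sum\<nu>': "(\<Sum>k\<in>{1..R}. real k * \<nu>' R k) = x" and \<nu>'pos: "1 \<le> k \<Longrightarrow> \<nu>' R k > 0"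
    if R: "R \<ge> 2" for R k
  proof -
    have set: "{1..R} = insert R {1..<R}" using R by auto
    have lt: "(\<Sum>k\<in>{1..<R}. f k) = (\<Sum>k<R. f k)" if "f 0 = 0" for f :: "nat \<Rightarrow> real"
      using that R by (intro sum.mono_neutral_left) (auto simp: Suc_le_eq)
    have aR: "a R > 0" using a_ge[of R] \<nu>pos[of R] R by (smt (verit) mult_pos_pos of_nat_0_less_iff zero_less_numeral order_less_le_trans)
    show "\<nu>' R k > 0" if "1 \<le> k" using that aR R \<nu>pos[of k] by (auto simp: \<nu>'_def)
    have eqs: "(\<Sum>k\<in>{1..<R}. g k (\<nu>' R k)) = (\<Sum>k\<in>{1..<R}. g k (\<nu> k))" for g :: "nat \<Rightarrow> real \<Rightarrow> real"
      by (intro sum.cong) (auto simp: \<nu>'_def)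
    have lt1: "(\<Sum>k\<in>{1..<R}. real k * \<nu> k) = (\<Sum>k<R. real k * \<nu> k)" by (rule lt) simp
    have lt2: "(\<Sum>k\<in>{1..<R}. \<nu> k) = (\<Sum>k<R. \<nu> k)" by (rule lt) (simp add: \<nu>0)
    have \<nu>'R: "real R * \<nu>' R R = a R" using R by (simp add: \<nu>'_def)
    show "(\<Sum>k\<in>{1..R}. real k * \<nu>' R k) = x"
      unfolding set using eqs[of "\<lambda>k z. real k * z"] lt1 \<nu>'R by (simp add: a_def)
    have lnt: "ln (treec k * \<alpha> ^ (k - 1)) = ln (\<nu> k) + real k * L" if k: "k > 0" for k
    proof -
      have "treec k * \<alpha> ^ (k - 1) = \<nu> k * (\<alpha> / y) ^ k"
        using \<alpha> y k by (cases k) (auto simp: \<nu>_def power_divide)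
      then show ?thesis using \<nu>pos[OF k] \<alpha> y by (simp add: L_def ln_mult_pos ln_realpow)
    qed
    define r where "r = \<nu>' R R"
    have r: "r > 0" using aR R by (simp add: r_def \<nu>'_def)
    have "G R = (\<Sum>k\<in>{1..<R}. real k * \<nu> k * L + \<nu> k) + (r * (ln (\<nu> R) + real R * L) - (r * ln r - r))"
    proof -
      have "(\<Sum>k\<in>{1..<R}. \<nu>' R k * ln (treec k * \<alpha> ^ (k - 1)) - (\<nu>' R k * ln (\<nu>' R k) - \<nu>' R k))
          = (\<Sum>k\<in>{1..<R}. \<nu> k * ln (treec k * \<alpha> ^ (k - 1)) - (\<nu> k * ln (\<nu> k) - \<nu> k))"
        by (rule eqs[of "\<lambda>k z. z * ln (treec k * \<alpha> ^ (k - 1)) - (z * ln z - z)"])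
      also have "\<dots> = (\<Sum>k\<in>{1..<R}. real k * \<nu> k * L + \<nu> k)"
      proof (rule sum.cong[OF refl])
        fix k assume "k \<in> {1..<R}"
        then have "ln (treec k * \<alpha> ^ (k - 1)) = ln (\<nu> k) + real k * L" by (intro lnt) auto
        then show "\<nu> k * ln (treec k * \<alpha> ^ (k - 1)) - (\<nu> k * ln (\<nu> k) - \<nu> k) = real k * \<nu> k * L + \<nu> k"
          by (simp add: algebra_simps)
      qed
      finally show ?thesis unfolding G_def set using lnt[of R] R by (simp add: r_def)
    qed
    also have "(\<Sum>k\<in>{1..<R}. real k * \<nu> k * L + \<nu> k) = (x - a R) * L + (\<Sum>k<R. \<nu> k)"
      unfolding sum.distrib sum_distrib_right[symmetric] lt1 lt2 by (simp add: a_def)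
    finally have G_eq: "G R = x * L + (\<Sum>k<R. \<nu> k) + r - r * (ln r - ln (\<nu> R))"
      using \<nu>'R by (simp add: r_def[symmetric] algebra_simps)
    have "ln r - ln (\<nu> R) \<le> ln x + ln \<alpha> + 1 + 2 * ln R + R * (- 1 - ln y)"
    proof -
      have "ln r = ln (a R) - ln R" unfolding r_def \<nu>'_def using aR R by (simp add: ln_div)
      also have "\<dots> \<le> ln x - ln R" using a_le[of R] aR by simp
      finally have "ln r \<le> ln x - ln R" .
      moreover have "ln (\<nu> R) = ln (treec R) + R * ln y - ln \<alpha>"
        unfolding \<nu>_def using treec_pos[of R] R y \<alpha> by (simp add: ln_div ln_mult_pos ln_realpow)
      ultimately show ?thesis using ln_treec_ge[OF R] by (simp add: algebra_simps)
    qed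
    then have "r * (ln r - ln (\<nu> R)) \<le> r * (ln x + ln \<alpha> + 1 + 2 * ln R + R * (- 1 - ln y))"
      using r by (intro mult_left_mono) auto
    also have "r = a R / R" by (simp add: r_def \<nu>'_def)
    also have "a R / R * (ln x + ln \<alpha> + 1 + 2 * ln R + R * (- 1 - ln y))
        = a R * ((ln x + ln \<alpha> + 1) / R + 2 * (ln R / R)) + a R * (- 1 - ln y)"
      using R by (simp add: field_simps)
    finally show "H R \<le> G R" unfolding H_def G_eq using r \<open>r = a R / R\<close> by simp
  qed
  have "\<forall>\<^sub>F R in sequentially. bulk_rate \<alpha> x - \<eta> / 2 < H R"
    using order_tendstoD(1)[OF H_lim, of "bulk_rate \<alpha> x - \<eta> / 2"] \<eta> by simp
  then have "\<forall>\<^sub>F R in sequentially. bulk_rate \<alpha> x - \<eta> / 2 < H R \<and> R \<ge> 2"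
    using eventually_ge_at_top[of 2] by eventually_elim auto
  then obtain R where R: "bulk_rate \<alpha> x - \<eta> / 2 < H R" "R \<ge> 2"
    by (metis (no_types, lifting) eventually_sequentially order_refl)
  have "\<forall>\<^sub>F n in sequentially. exp (n * (G R - \<eta> / 2)) \<le> real n ^ l n * bulk_coeff \<alpha> n (\<epsilon> * n) (l n)"
    unfolding G_def using \<alpha> \<epsilon> \<eta> l R(2) sum\<nu>'[OF R(2)] \<nu>'pos[OF R(2)] by (intro bulk_coeff_ge_config) auto
  then show ?thesis
  proof eventually_elim
    case (elim n)
    have "bulk_rate \<alpha> x - \<eta> \<le> G R - \<eta> / 2" using R GH[OF R(2)] by simp
    then have "exp (n * (bulk_rate \<alpha> x - \<eta>)) \<le> exp (n * (G R - \<eta> / 2))" by (simp add: mult_left_mono)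
    with elim show ?case by linarith
  qed
qed

section \<open>Macroscopic components\<close>

text \<open>Concavity of \<open>1 - exp (- t)\<close> together with its zero at 0.\<close>

lemma one_minus_exp_scale:
  fixes s t :: real
  assumes "0 \<le> s" "s \<le> 1"
  shows "s * (1 - exp (- t)) \<le> 1 - exp (- (s * t))"
proof -
  have "exp ((1 - s) *\<^sub>R 0 + s *\<^sub>R (- t)) \<le> (1 - s) * exp 0 + s * exp (- t)"
    using convex_onD[OF exp_convex, of s 0 "- t"] assms by simp
  then show ?thesis by (simp add: algebra_simps)
qed

lemma isCont_comp_rate:
  assumes "\<alpha> > 0" "x > 0"
  shows "isCont (comp_rate \<alpha>) x"
proof -
  have "1 - exp (- (\<alpha> * x)) > 0" using assms by simp
  then show ?thesis unfolding comp_rate_def using assms by (intro continuous_intros) auto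
qed

text \<open>Bounds \<open>comp_rate \<alpha> x / x\<close> on \<open>0 < x \<le> 1\<close>, since
  \<open>(1 - exp (- (\<alpha> * x))) / x\<close> lies between \<open>1 - exp (- \<alpha>)\<close>
  and \<open>\<alpha>\<close> there.\<close>

definition comp_rate_const :: "real \<Rightarrow> real" where
  "comp_rate_const \<alpha> = \<bar>ln \<alpha>\<bar> + \<bar>ln (1 - exp (- \<alpha>))\<bar> + \<alpha> / 2 + 1"

lemma comp_rate_const_pos: "\<alpha> > 0 \<Longrightarrow> comp_rate_const \<alpha> > 0"
  unfolding comp_rate_const_def using abs_ge_zero[of "ln \<alpha>"] abs_ge_zero[of "ln (1 - exp (- \<alpha>))"] by linarith

lemma comp_rate_ratio_bound:
  assumes "\<alpha> > 0" "0 < x" "x \<le> 1"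
  shows "\<bar>ln ((1 - exp (- (\<alpha> * x))) / x) + \<alpha> * x / 2 + 1\<bar> \<le> comp_rate_const \<alpha>"
proof -
  define e where "e = (1 - exp (- (\<alpha> * x))) / x"
  have e0: "1 - exp (- \<alpha>) > 0" using assms by simp
  have "x * (1 - exp (- \<alpha>)) \<le> 1 - exp (- (x * \<alpha>))" using assms by (intro one_minus_exp_scale) auto
  then have lo: "1 - exp (- \<alpha>) \<le> e" using assms by (simp add: e_def field_simps)
  have "1 - exp (- (\<alpha> * x)) \<le> \<alpha> * x" using exp_ge_add_one_self[of "- (\<alpha> * x)"] by simp
  then have hi: "e \<le> \<alpha>" using assms by (simp add: e_def field_simps)
  have "ln (1 - exp (- \<alpha>)) \<le> ln e" "ln e \<le> ln \<alpha>" using lo hi e0 assms by (intro ln_mono; linarith)+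
  then have "\<bar>ln e\<bar> \<le> \<bar>ln \<alpha>\<bar> + \<bar>ln (1 - exp (- \<alpha>))\<bar>" by linarith
  moreover have "0 \<le> \<alpha> * x / 2" "\<alpha> * x / 2 \<le> \<alpha> / 2" using assms by (auto simp: mult_left_le)
  ultimately show ?thesis unfolding comp_rate_const_def e_def[symmetric] by linarith
qed

lemma comp_rate_le:
  assumes "\<alpha> > 0" "0 < x" "x \<le> 1"
  shows "comp_rate \<alpha> x \<le> comp_rate_const \<alpha> * x"
  unfolding comp_rate_def using comp_rate_ratio_bound[OF assms] assms mult_left_mono[of _ "comp_rate_const \<alpha>" x]
  by (simp add: mult.commute)

text \<open>The loss from shrinking a component is proportional to its size. Over a list it is
  therefore controlled by the total size, however many entries there are.\<close>

lemma comp_rate_scale: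
  assumes "\<alpha> > 0" "0 < x" "x \<le> 1" "0 < s" "s \<le> 1"
  shows "comp_rate \<alpha> x - (comp_rate_const \<alpha> + \<alpha> / 2) * (1 - s) * x \<le> comp_rate \<alpha> (s * x)"
proof -
  define h where "h x = ln ((1 - exp (- (\<alpha> * x))) / x) + \<alpha> * x / 2 + 1" for x
  define e where "e = (1 - exp (- (\<alpha> * x))) / x"
  have e0: "e > 0" using assms by (simp add: e_def)
  have "s * (1 - exp (- (\<alpha> * x))) \<le> 1 - exp (- (s * (\<alpha> * x)))" using assms by (intro one_minus_exp_scale) auto
  then have "e \<le> (1 - exp (- (\<alpha> * (s * x)))) / (s * x)"
    using assms divide_right_mono[of "s * (1 - exp (- (\<alpha> * x)))" _ "s * x"] by (simp add: e_def mult_ac)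
  then have "ln e \<le> ln ((1 - exp (- (\<alpha> * (s * x)))) / (s * x))" using e0 by simp
  then have "h x - (1 - s) * (\<alpha> * x / 2) \<le> h (s * x)"
  proof -
    have "\<alpha> * x / 2 - (1 - s) * (\<alpha> * x / 2) = \<alpha> * (s * x) / 2" by (simp add: field_simps)
    then show ?thesis using \<open>ln e \<le> _\<close> unfolding h_def e_def by linarith
  qed
  moreover have "(1 - s) * (\<alpha> * x / 2) \<le> (1 - s) * (\<alpha> / 2)" using assms by (intro mult_left_mono) (auto simp: mult_left_le)
  ultimately have "s * (h x - (1 - s) * (\<alpha> / 2)) \<le> s * h (s * x)" using assms by (intro mult_left_mono) auto
  moreover have "h x - (1 - s) * comp_rate_const \<alpha> \<le> s * h x"
  proof -
    have "(1 - s) * h x \<le> (1 - s) * comp_rate_const \<alpha>"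
      using comp_rate_ratio_bound[OF assms(1-3)] assms unfolding h_def by (intro mult_left_mono) auto
    then show ?thesis by (simp add: algebra_simps)
  qed
  moreover have "s * ((1 - s) * (\<alpha> / 2)) \<le> (1 - s) * (\<alpha> / 2)" using assms by (intro mult_left_le_one_le) auto
  moreover have "(comp_rate_const \<alpha> + \<alpha> / 2) * (1 - s) = (1 - s) * comp_rate_const \<alpha> + (1 - s) * (\<alpha> / 2)"
    by (simp add: algebra_simps)
  ultimately have "h x - (comp_rate_const \<alpha> + \<alpha> / 2) * (1 - s) \<le> s * h (s * x)"
    unfolding right_diff_distrib[of s "h x"] by linarith
  then have "x * (h x - (comp_rate_const \<alpha> + \<alpha> / 2) * (1 - s)) \<le> x * (s * h (s * x))"
    using assms by (intro mult_left_mono) auto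
  then show ?thesis unfolding comp_rate_def h_def[symmetric] by (simp add: algebra_simps)
qed

text \<open>Moving the factor \<open>x\<close> inside the minimum clears the singular
  \<open>1 / x\<close> of \<open>Psi\<close>, and continuity extends to 0.\<close>

lemma continuous_on_bulk_rate:
  assumes "\<alpha> > 0"
  shows "continuous_on {0..} (bulk_rate \<alpha>)"
proof -
  have "continuous_on {0..} (\<lambda>x. x - x * ln x + \<alpha> * x\<^sup>2 / 2 + min (x * ln x + x * ln \<alpha> - \<alpha> * x\<^sup>2 / 2 + 1 / (2 * \<alpha>)) 0)"
    by (intro continuous_intros continuous_on_x_ln_x) auto
  then show ?thesis
  proof (rule continuous_on_eq)
    fix x :: real assume "x \<in> {0..}"
    then consider "x = 0" | "x > 0" by fastforce
    then show "x - x * ln x + \<alpha> * x\<^sup>2 / 2 + min (x * ln x + x * ln \<alpha> - \<alpha> * x\<^sup>2 / 2 + 1 / (2 * \<alpha>)) 0 = bulk_rate \<alpha> x"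
    proof cases
      case 2
      have "x * Psi (\<alpha> * x) = min (x * (ln (\<alpha> * x) - (\<alpha> * x - 1 / (\<alpha> * x)) / 2)) (x * 0)"
        using 2 assms unfolding Psi_def by (simp add: min_mult_distrib_left)
      also have "x * (ln (\<alpha> * x) - (\<alpha> * x - 1 / (\<alpha> * x)) / 2) = x * ln x + x * ln \<alpha> - \<alpha> * x\<^sup>2 / 2 + 1 / (2 * \<alpha>)"
        using 2 assms by (simp add: ln_mult_pos field_simps power2_eq_square)
      finally show ?thesis by (simp add: bulk_rate_def)
    qed (use assms in \<open>simp add: bulk_rate_def\<close>)
  qed
qed

text \<open>The exponential rate of a configuration of macroscopic components with relative sizes
  \<open>xs\<close> among \<open>x n\<close> vertices, all other components being small.\<close>

definition configs :: "real \<Rightarrow> real \<Rightarrow> real list set" where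
  "configs \<epsilon> x = {xs. (\<forall>\<kappa>\<in>set xs. 0 < \<kappa> \<and> \<kappa> \<le> \<epsilon>) \<and> sum_list xs \<le> x}"

definition rate :: "real \<Rightarrow> real \<Rightarrow> real list \<Rightarrow> real" where
  "rate \<alpha> x xs = sum_list (map (comp_rate \<alpha>) xs) + bulk_rate \<alpha> (x - sum_list xs)"

definition best_rate :: "real \<Rightarrow> real \<Rightarrow> real \<Rightarrow> real" where
  "best_rate \<alpha> \<epsilon> x = (SUP xs\<in>configs \<epsilon> x. rate \<alpha> x xs)"

lemma sum_list_nonneg_configs: "xs \<in> configs \<epsilon> x \<Longrightarrow> 0 \<le> sum_list xs"
  by (auto simp: configs_def less_imp_le intro!: sum_list_nonneg)

lemma sum_comp_rate_le:
  assumes "\<alpha> > 0" "\<And>\<kappa>. \<kappa> \<in> set xs \<Longrightarrow> 0 < \<kappa> \<and> \<kappa> \<le> 1"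
  shows "sum_list (map (comp_rate \<alpha>) xs) \<le> comp_rate_const \<alpha> * sum_list xs"
  using assms(2)
proof (induction xs)
  case (Cons a xs)
  then show ?case using comp_rate_le[OF assms(1), of a] by (simp add: algebra_simps)
qed simp

lemma sum_comp_rate_scale:
  assumes "\<alpha> > 0" "\<And>\<kappa>. \<kappa> \<in> set xs \<Longrightarrow> 0 < \<kappa> \<and> \<kappa> \<le> 1" "0 < s" "s \<le> 1"
  shows "sum_list (map (comp_rate \<alpha>) xs) - (comp_rate_const \<alpha> + \<alpha> / 2) * (1 - s) * sum_list xs
    \<le> sum_list (map (\<lambda>\<kappa>. comp_rate \<alpha> (s * \<kappa>)) xs)"
  using assms(2)
proof (induction xs)
  case (Cons a xs)
  define C where "C = (comp_rate_const \<alpha> + \<alpha> / 2) * (1 - s)"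
  have "comp_rate \<alpha> a - C * a \<le> comp_rate \<alpha> (s * a)"
    unfolding C_def using Cons.prems[of a] by (intro comp_rate_scale[OF assms(1) _ _ assms(3,4)]) auto
  moreover have "sum_list (map (comp_rate \<alpha>) xs) - C * sum_list xs \<le> sum_list (map (\<lambda>\<kappa>. comp_rate \<alpha> (s * \<kappa>)) xs)"
    unfolding C_def using Cons by auto
  ultimately show ?case unfolding C_def[symmetric] by (simp add: distrib_left)
qed simp

section \<open>The supremum over configurations\<close>

context
  fixes \<alpha> \<epsilon> :: real
  assumes \<alpha>: "\<alpha> > 0" and \<epsilon>: "0 < \<epsilon>" "\<epsilon> \<le> 1"
begin

lemma bdd_above_rate:
  assumes "x \<le> 1"
  shows "bdd_above (rate \<alpha> x ` configs \<epsilon> x)"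
proof -
  have "compact (bulk_rate \<alpha> ` {0..1})"
    by (intro compact_continuous_image continuous_on_subset[OF continuous_on_bulk_rate[OF \<alpha>]]) auto
  then obtain M where M: "\<And>y. y \<in> {0..1} \<Longrightarrow> bulk_rate \<alpha> y \<le> M"
    using compact_imp_bounded bounded_imp_bdd_above unfolding bdd_above_def by (metis image_eqI)
  show ?thesis
  proof (rule bdd_aboveI2)
    fix xs assume xs: "xs \<in> configs \<epsilon> x"
    then have s: "0 \<le> sum_list xs" "sum_list xs \<le> x" using sum_list_nonneg_configs[OF xs] by (auto simp: configs_def)
    have "sum_list (map (comp_rate \<alpha>) xs) \<le> comp_rate_const \<alpha> * sum_list xs"
      using xs \<epsilon> by (intro sum_comp_rate_le[OF \<alpha>]) (auto simp: configs_def)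
    also have "\<dots> \<le> comp_rate_const \<alpha> * 1" using s assms comp_rate_const_pos[OF \<alpha>] by (intro mult_left_mono) auto
    finally show "rate \<alpha> x xs \<le> comp_rate_const \<alpha> + M"
      unfolding rate_def using M[of "x - sum_list xs"] s assms by simp
  qed
qed

lemma rate_le_best_rate: "x \<le> 1 \<Longrightarrow> xs \<in> configs \<epsilon> x \<Longrightarrow> rate \<alpha> x xs \<le> best_rate \<alpha> \<epsilon> x"
  unfolding best_rate_def by (intro cSUP_upper bdd_above_rate)

lemma configs_Nil: "0 \<le> x \<Longrightarrow> [] \<in> configs \<epsilon> x"
  by (simp add: configs_def)

lemma bulk_rate_le_best_rate: "0 \<le> x \<Longrightarrow> x \<le> 1 \<Longrightarrow> bulk_rate \<alpha> x \<le> best_rate \<alpha> \<epsilon> x"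
  using rate_le_best_rate[OF _ configs_Nil] by (simp add: rate_def)

text \<open>A list for \<open>x - \<kappa>\<close> extended by \<kappa> is a list for
  \<open>x\<close>. This is what allows components to be peeled off one at a time in
  \<open>bulk_coeff_le_best_rate\<close>.\<close>

lemma best_rate_step:
  assumes "0 < \<kappa>" "\<kappa> \<le> \<epsilon>" "\<kappa> \<le> x" "x \<le> 1"
  shows "comp_rate \<alpha> \<kappa> + best_rate \<alpha> \<epsilon> (x - \<kappa>) \<le> best_rate \<alpha> \<epsilon> x"
proof -
  have "best_rate \<alpha> \<epsilon> (x - \<kappa>) \<le> best_rate \<alpha> \<epsilon> x - comp_rate \<alpha> \<kappa>"
    unfolding best_rate_def[of _ _ "x - \<kappa>"]
  proof (rule cSUP_least)
    show "configs \<epsilon> (x - \<kappa>) \<noteq> {}" using configs_Nil[of "x - \<kappa>"] assms by auto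
    fix ys assume "ys \<in> configs \<epsilon> (x - \<kappa>)"
    then have "\<kappa> # ys \<in> configs \<epsilon> x" using assms by (auto simp: configs_def)
    from rate_le_best_rate[OF assms(4) this] show "rate \<alpha> (x - \<kappa>) ys \<le> best_rate \<alpha> \<epsilon> x - comp_rate \<alpha> \<kappa>"
      by (simp add: rate_def algebra_simps)
  qed
  then show ?thesis by simp
qed

text \<open>Multiplying all sizes by \<open>s = x / z n\<close> turns a list for \<open>z n\<close>
  into one for \<open>x\<close>, with a loss that is small uniformly over all lists. This replaces
  \<open>l n / n\<close> by its limit in the upper bound.\<close>

lemma best_rate_upper_limit:
  fixes z :: "nat \<Rightarrow> real"
  assumes x: "0 < x" and z: "z \<longlonglongrightarrow> x" "\<And>n. x \<le> z n" "\<And>n. z n \<le> 1" and \<eta>: "\<eta> > 0"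
  shows "\<forall>\<^sub>F n in sequentially. best_rate \<alpha> \<epsilon> (z n) \<le> best_rate \<alpha> \<epsilon> x + \<eta>"
proof -
  define C where "C = comp_rate_const \<alpha> + \<alpha> / 2"
  have C: "C > 0" using comp_rate_const_pos[OF \<alpha>] \<alpha> by (simp add: C_def)
  have x1: "x \<le> 1" using z(2)[of 0] z(3)[of 0] by simp
  have "uniformly_continuous_on {0..1} (bulk_rate \<alpha>)"
    by (intro compact_uniformly_continuous continuous_on_subset[OF continuous_on_bulk_rate[OF \<alpha>]]) auto
  then obtain d where d: "d > 0" "\<And>a b. a \<in> {0..1} \<Longrightarrow> b \<in> {0..1} \<Longrightarrow> \<bar>b - a\<bar> < d \<Longrightarrow> \<bar>bulk_rate \<alpha> b - bulk_rate \<alpha> a\<bar> < \<eta> / 2"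
    unfolding uniformly_continuous_on_def dist_real_def using \<eta> by (metis half_gt_zero)
  \<comment> \<open>The second entry limits the loss on the components to \<open>\<eta> / 2\<close>,
    the first that on the bulk.\<close>
  define e where "e = min d (\<eta> / (2 * C))"
  have e: "e > 0" using d \<eta> C by (simp add: e_def)
  have "(\<lambda>n. 1 - x / z n) \<longlonglongrightarrow> 1 - x / x" using x by (intro tendsto_intros z) auto
  then have "\<forall>\<^sub>F n in sequentially. 1 - x / z n < e" using e x order_tendstoD(2) by fastforce
  then show ?thesis
  proof eventually_elim
    case (elim n)
    define s where "s = x / z n"
    have zn: "z n > 0" "x \<le> z n" "z n \<le> 1" using x z(2)[of n] z(3)[of n] by auto
    have s: "0 < s" "s \<le> 1" "1 - s < e" "s * z n = x" using x zn elim by (auto simp: s_def)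
    have "best_rate \<alpha> \<epsilon> (z n) \<le> best_rate \<alpha> \<epsilon> x + \<eta>"
      unfolding best_rate_def[of _ _ "z n"]
    proof (rule cSUP_least)
      show "configs \<epsilon> (z n) \<noteq> {}" using configs_Nil[of "z n"] zn by auto
      fix ys assume ys: "ys \<in> configs \<epsilon> (z n)"
      then have S: "0 \<le> sum_list ys" "sum_list ys \<le> z n" using sum_list_nonneg_configs[OF ys] by (auto simp: configs_def)
      have sm: "sum_list (map ((*) s) ys) = s * sum_list ys" by (simp add: sum_list_const_mult)
      have "map ((*) s) ys \<in> configs \<epsilon> x"
      proof -
        have "s * \<kappa> \<le> \<epsilon>" if "0 < \<kappa>" "\<kappa> \<le> \<epsilon>" for \<kappa>
          using mult_right_mono[of s 1 \<kappa>] s(2) that by linarith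
        moreover have "s * sum_list ys \<le> x" using S s mult_left_mono[of "sum_list ys" "z n" s] by simp
        ultimately show ?thesis using ys s sm by (auto simp: configs_def)
      qed
      then have "rate \<alpha> x (map ((*) s) ys) \<le> best_rate \<alpha> \<epsilon> x" by (rule rate_le_best_rate[OF x1])
      moreover have "rate \<alpha> x (map ((*) s) ys) = sum_list (map (\<lambda>\<kappa>. comp_rate \<alpha> (s * \<kappa>)) ys) + bulk_rate \<alpha> (s * (z n - sum_list ys))"
        unfolding rate_def sm right_diff_distrib s(4) by (simp add: comp_def)
      moreover have "sum_list (map (comp_rate \<alpha>) ys) - \<eta> / 2 \<le> sum_list (map (\<lambda>\<kappa>. comp_rate \<alpha> (s * \<kappa>)) ys)"
      proof -
        have "C * (1 - s) * sum_list ys \<le> C * (1 - s) * 1" using C s S zn by (intro mult_left_mono) auto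
        also have "\<dots> \<le> C * (\<eta> / (2 * C)) * 1"
          using C s by (intro mult_right_mono mult_left_mono) (auto simp: e_def)
        also have "\<dots> = \<eta> / 2" using C by simp
        finally show ?thesis
          using sum_comp_rate_scale[OF \<alpha> _ s(1,2), of ys] ys \<epsilon> by (force simp: C_def configs_def)
      qed
      moreover have "\<bar>bulk_rate \<alpha> (s * (z n - sum_list ys)) - bulk_rate \<alpha> (z n - sum_list ys)\<bar> < \<eta> / 2"
      proof (rule d(2))
        define u where "u = z n - sum_list ys"
        have u: "0 \<le> u" "u \<le> 1" using S zn by (auto simp: u_def)
        show "u \<in> {0..1}" using u by simp
        show "s * u \<in> {0..1}" using u s by (auto intro: mult_le_one)
        have "s * u \<le> u" using u s by (intro mult_left_le_one_le) auto
        then have "\<bar>s * u - u\<bar> = (1 - s) * u" by (simp add: left_diff_distrib)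
        also have "\<dots> \<le> 1 - s" using u s by (intro mult_left_le) auto
        finally show "\<bar>s * u - u\<bar> < d" using s by (simp add: e_def)
      qed
      ultimately show "rate \<alpha> (z n) ys \<le> best_rate \<alpha> \<epsilon> x + \<eta>" unfolding rate_def by linarith
    qed
    then show ?case .
  qed
qed

text \<open>Components above \<open>\<delta> * n\<close> are peeled off by
  \<open>expc_split_le\<close>; there are at most \<open>l / (\<delta> * n)\<close> of them, each
  costing a factor \<open>1 + n * K\<close>. The smaller ones fall under
  \<open>bulk_coeff_le_bulk_rate\<close> and cost \<open>exp (\<alpha> * \<delta> * n)\<close>, so
  \<delta> can be chosen small before \<open>n\<close> tends to infinity.\<close>

lemma bulk_coeff_le_best_rate:
  fixes \<delta> :: real
  assumes n: "real n \<ge> 2 * \<alpha>" "n > 0" and \<delta>: "\<delta> > 0" and l: "l \<le> n"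
  defines "d \<equiv> 1 - exp (- (\<alpha> * \<delta>))"
  defines "K \<equiv> exp (2 * \<alpha>\<^sup>2 / d + \<alpha>\<^sup>2) / d"
  shows "real n ^ l * bulk_coeff \<alpha> n (\<epsilon> * n) l
    \<le> exp (\<alpha>\<^sup>2 + \<alpha> * \<delta> * n) * (1 + n * K) powr (l / (\<delta> * n)) * exp (n * best_rate \<alpha> \<epsilon> (real l / n))"
  using l
proof (induction l rule: less_induct)
  case (less l)
  define N where "N = 1 + n * K"
  define X where "X = exp (\<alpha>\<^sup>2 + \<alpha> * \<delta> * n)"
  define v where "v l = exp (n * best_rate \<alpha> \<epsilon> (real l / n))" for l
  define M where "M = {k\<in>{1..l}. \<delta> * n < real k \<and> real k \<le> \<epsilon> * n}"
  have d: "d > 0" using \<alpha> \<delta> by (simp add: d_def)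
  have K: "K > 0" using d by (simp add: K_def)
  have N: "N \<ge> 1" using K by (simp add: N_def)
  have X: "X > 0" by (simp add: X_def)
  have vpos: "v l > 0" for l by (simp add: v_def)
  have split: "bulk_coeff \<alpha> n (\<epsilon> * n) l \<le> bulk_coeff \<alpha> n (\<delta> * n) l + (\<Sum>k\<in>M. weight \<alpha> n k * bulk_coeff \<alpha> n (\<epsilon> * n) (l - k))"
    unfolding bulk_coeff_def M_def by (rule expc_split_le) (rule weight_nonneg[OF \<alpha> n])
  have bulk: "real n ^ l * bulk_coeff \<alpha> n (\<delta> * n) l \<le> X * v l"
  proof -
    have "real n ^ l * bulk_coeff \<alpha> n (\<delta> * n) l \<le> exp (n * bulk_rate \<alpha> (real l / n) + \<alpha>\<^sup>2 + \<alpha> * \<delta> * n)"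
      by (rule bulk_coeff_le_bulk_rate[OF \<alpha> n \<delta> less.prems])
    also have "\<dots> \<le> exp (n * best_rate \<alpha> \<epsilon> (real l / n) + \<alpha>\<^sup>2 + \<alpha> * \<delta> * n)"
      using bulk_rate_le_best_rate[of "real l / n"] less.prems n by (simp add: mult_left_mono)
    also have "\<dots> = X * v l" by (simp add: X_def v_def exp_add mult_ac)
    finally show ?thesis .
  qed
  have part: "real n ^ l * (weight \<alpha> n k * bulk_coeff \<alpha> n (\<epsilon> * n) (l - k)) \<le> K * (X * N powr (l / (\<delta> * n) - 1) * v l)"
    if "k \<in> M" for k
  proof -
    have k: "0 < k" "k \<le> l" "\<delta> * n < real k" "real k \<le> \<epsilon> * n" using that by (auto simp: M_def)
    have "real n ^ l * (weight \<alpha> n k * bulk_coeff \<alpha> n (\<epsilon> * n) (l - k))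
        = (real n ^ k * weight \<alpha> n k) * (real n ^ (l - k) * bulk_coeff \<alpha> n (\<epsilon> * n) (l - k))"
    proof -
      have "real n ^ l = real n ^ k * real n ^ (l - k)" using k by (simp add: power_add[symmetric])
      then show ?thesis by simp
    qed
    also have "\<dots> \<le> (K * exp (n * comp_rate \<alpha> (real k / n))) * (X * N powr (real (l - k) / (\<delta> * n)) * v (l - k))"
    proof (rule mult_mono)
      show "real n ^ k * weight \<alpha> n k \<le> K * exp (n * comp_rate \<alpha> (real k / n))"
        unfolding K_def d_def using k less.prems by (intro weight_le[OF \<alpha> n \<delta>]) auto
      show "real n ^ (l - k) * bulk_coeff \<alpha> n (\<epsilon> * n) (l - k) \<le> X * N powr (real (l - k) / (\<delta> * n)) * v (l - k)"
        unfolding X_def N_def v_def using k less.prems by (intro less.IH) auto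
    qed (use K bulk_coeff_nonneg[OF \<alpha> n] in auto)
    also have "\<dots> = K * (X * N powr (real (l - k) / (\<delta> * n)) * (exp (n * comp_rate \<alpha> (real k / n)) * v (l - k)))"
      by (simp add: mult_ac)
    also have "\<dots> \<le> K * (X * N powr (l / (\<delta> * n) - 1) * v l)"
    proof (intro mult_left_mono mult_mono)
      have "1 \<le> real k / (\<delta> * n)" using k \<delta> n by simp
      then have "real (l - k) / (\<delta> * n) \<le> l / (\<delta> * n) - 1"
        using k by (simp add: of_nat_diff diff_divide_distrib)
      then show "N powr (real (l - k) / (\<delta> * n)) \<le> N powr (l / (\<delta> * n) - 1)" using N by (intro powr_mono) auto
      have "real (l - k) / n = real l / n - real k / n" using k by (simp add: of_nat_diff diff_divide_distrib)
      moreover have "comp_rate \<alpha> (real k / n) + best_rate \<alpha> \<epsilon> (real l / n - real k / n) \<le> best_rate \<alpha> \<epsilon> (real l / n)"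
        using k less.prems n by (intro best_rate_step) (auto simp: field_simps)
      ultimately have "n * (comp_rate \<alpha> (real k / n) + best_rate \<alpha> \<epsilon> (real (l - k) / n)) \<le> n * best_rate \<alpha> \<epsilon> (real l / n)"
        by (intro mult_left_mono) auto
      then show "exp (n * comp_rate \<alpha> (real k / n)) * v (l - k) \<le> v l"
        by (simp add: v_def distrib_left flip: exp_add)
    qed (use K X vpos in \<open>auto intro!: mult_nonneg_nonneg less_imp_le\<close>)
    finally show ?thesis .
  qed
  have "real n ^ l * bulk_coeff \<alpha> n (\<epsilon> * n) l \<le> real n ^ l * (bulk_coeff \<alpha> n (\<delta> * n) l + (\<Sum>k\<in>M. weight \<alpha> n k * bulk_coeff \<alpha> n (\<epsilon> * n) (l - k)))"
    using split by (intro mult_left_mono) auto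
  also have "\<dots> = real n ^ l * bulk_coeff \<alpha> n (\<delta> * n) l + (\<Sum>k\<in>M. real n ^ l * (weight \<alpha> n k * bulk_coeff \<alpha> n (\<epsilon> * n) (l - k)))"
    by (simp add: distrib_left sum_distrib_left)
  also have "\<dots> \<le> X * v l + (\<Sum>k\<in>M. K * (X * N powr (l / (\<delta> * n) - 1) * v l))"
    by (intro add_mono bulk sum_mono part)
  also have "\<dots> \<le> X * N powr (l / (\<delta> * n)) * v l"
  proof (cases "M = {}")
    case True
    have "1 \<le> N powr (l / (\<delta> * n))" using N \<delta> by (intro ge_one_powr_ge_zero) auto
    then have "X * 1 * v l \<le> X * N powr (l / (\<delta> * n)) * v l" using X vpos[of l] by (intro mult_mono) auto
    then show ?thesis using True by simp
  next
    case False
    then obtain k where "k \<in> M" by auto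
    then have "\<delta> * n < real l" by (auto simp: M_def)
    \<comment> \<open>Some component exceeds \<open>\<delta> * n\<close>, so the exponent leaves
      room for one more factor \<open>1 + n * K\<close>: the 1 pays for the bulk term,
      \<open>n * K\<close> for at most \<open>n\<close> sizes.\<close>
    then have t: "1 \<le> l / (\<delta> * n)" using \<delta> n by simp
    define P where "P = N powr (l / (\<delta> * n) - 1)"
    have P: "P \<ge> 1" unfolding P_def using N t by (intro ge_one_powr_ge_zero) auto
    have "card M \<le> card {1..l}" unfolding M_def by (intro card_mono) auto
    then have cM: "card M \<le> n" using less.prems by simp
    have "1 + card M * K * P \<le> P + n * K * P"
      using P K cM by (intro add_mono mult_right_mono) auto
    also have "\<dots> = N * P" by (simp add: N_def algebra_simps)
    also have "\<dots> = N powr (l / (\<delta> * n))" unfolding P_def using N by (simp add: powr_diff)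
    finally have "(1 + card M * K * P) * (X * v l) \<le> N powr (l / (\<delta> * n)) * (X * v l)"
      using X vpos[of l] by (intro mult_right_mono) auto
    then show ?thesis unfolding P_def[symmetric] by (simp add: algebra_simps)
  qed
  finally show ?case by (simp add: X_def N_def v_def)
qed

end

section \<open>Limits in n\<close>

lemma eventually_exp_le_poly:
  fixes c \<eta> :: real
  assumes "\<eta> > 0"
  shows "\<forall>\<^sub>F n in sequentially. exp (- (real n * \<eta>)) \<le> exp c / (real n)\<^sup>2"
proof -
  have "(\<lambda>n. - c / real n + 2 * (ln n / n)) \<longlonglongrightarrow> 0 + 2 * 0"
    by (intro tendsto_intros lim_const_over_n lim_ln_over_n)
  then have "\<forall>\<^sub>F n in sequentially. - c / real n + 2 * (ln n / n) < \<eta>"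
    using assms order_tendstoD(2) by fastforce
  then show ?thesis
    using eventually_gt_at_top[of 0]
  proof eventually_elim
    case (elim n)
    then have "- c + 2 * ln n < n * \<eta>" by (simp add: field_simps)
    then have "exp (- (real n * \<eta>)) \<le> exp (c - 2 * ln n)" by simp
    also have "\<dots> = exp c / (real n)\<^sup>2"
      using elim by (simp add: exp_diff exp_double)
    finally show ?case .
  qed
qed

text \<open>Induction on the list, with one component split off by \<open>expc_ge_part\<close>.
  Rounding its size down preserves \<open>x * n \<le> l n\<close> for the remainder, and this
  invariant guarantees that enough vertices are left for it.\<close>

lemma bulk_coeff_ge_rate:
  fixes l :: "nat \<Rightarrow> nat" and \<alpha> \<epsilon> \<eta> x :: real
  assumes \<alpha>: "\<alpha> > 0" and \<epsilon>: "0 < \<epsilon>" "\<epsilon> \<le> 1"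
    and "xs \<in> configs \<epsilon> x" "(\<lambda>n. real (l n) / n) \<longlonglongrightarrow> x" "\<And>n. x * real n \<le> l n" "\<And>n. l n \<le> n" "\<eta> > 0"
  shows "\<forall>\<^sub>F n in sequentially. exp (n * (rate \<alpha> x xs - \<eta>)) \<le> real n ^ l n * bulk_coeff \<alpha> n (\<epsilon> * n) (l n)"
  using assms(4-)
proof (induction xs arbitrary: x l \<eta>)
  case Nil
  then show ?case using bulk_coeff_ge_bulk_rate[OF \<alpha> \<epsilon>(1) Nil.prems(5) Nil.prems(2)] by (simp add: rate_def)
next
  case (Cons \<kappa> xs)
  define k where "k n = nat \<lfloor>\<kappa> * real n\<rfloor>" for n :: nat
  define l' where "l' n = l n - k n" for n
  have \<kappa>: "0 < \<kappa>" "\<kappa> \<le> \<epsilon>" using Cons.prems by (auto simp: configs_def)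
  have cfg: "xs \<in> configs \<epsilon> (x - \<kappa>)" using Cons.prems by (auto simp: configs_def)
  then have \<kappa>x: "\<kappa> \<le> x" using sum_list_nonneg_configs[OF cfg] by (auto simp: configs_def)
  have k_le: "real (k n) \<le> \<kappa> * n" for n
  proof -
    have "0 \<le> \<lfloor>\<kappa> * real n\<rfloor>" using \<kappa> by simp
    then show ?thesis unfolding k_def by linarith
  qed
  have kl: "k n \<le> l n" for n
  proof -
    have "real (k n) \<le> \<kappa> * n" by (rule k_le)
    also have "\<dots> \<le> x * n" using \<kappa>x by (intro mult_right_mono) auto
    also have "\<dots> \<le> l n" by (rule Cons.prems)
    finally show ?thesis by simp
  qed
  have k_lim: "(\<lambda>n. real (k n) / n) \<longlonglongrightarrow> \<kappa>"
    unfolding k_def using \<kappa> by (intro nat_floor_ratio_tendsto) simp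
  have l'_lim: "(\<lambda>n. real (l' n) / n) \<longlonglongrightarrow> x - \<kappa>"
    using tendsto_diff[OF Cons.prems(2) k_lim] kl by (simp add: l'_def of_nat_diff diff_divide_distrib)
  have l'_ge: "(x - \<kappa>) * real n \<le> l' n" for n
    using Cons.prems(3)[of n] k_le[of n] kl[of n] by (simp add: l'_def of_nat_diff left_diff_distrib)
  have l'_le: "l' n \<le> n" for n using Cons.prems(4)[of n] by (simp add: l'_def)
  have \<eta>3: "\<eta> / 3 > 0" using Cons.prems by simp
  have comp_rate_lim: "(\<lambda>n. comp_rate \<alpha> (real (k n) / n)) \<longlonglongrightarrow> comp_rate \<alpha> \<kappa>"
    by (rule isCont_tendsto_compose[OF isCont_comp_rate[OF \<alpha> \<kappa>(1)] k_lim])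
  have ev_comp_rate: "\<forall>\<^sub>F n in sequentially. comp_rate \<alpha> \<kappa> - \<eta> / 3 < comp_rate \<alpha> (real (k n) / n)"
    by (rule order_tendstoD(1)[OF comp_rate_lim]) (use \<eta>3 in simp)
  have "\<forall>\<^sub>F n in sequentially. 0 < real (k n) / n"
    by (rule order_tendstoD(1)[OF k_lim \<kappa>(1)])
  then show ?case
    using Cons.IH[OF cfg l'_lim l'_ge l'_le \<eta>3] eventually_exp_le_poly[OF \<eta>3, of "- \<alpha> / 2 - 1"]
      eventually_large[of "2 * \<alpha>"] ev_comp_rate
  proof eventually_elim
    case (elim n)
    define c where "c = exp (- \<alpha> / 2 - 1)"
    have n: "real n \<ge> 2 * \<alpha>" "n > 0" and k0: "k n > 0" using elim by (auto simp: zero_less_divide_iff)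
    have l: "k n \<le> l n" "l n \<le> n" "l n > 0" using kl[of n] Cons.prems(4)[of n] k0 by auto
    have k\<epsilon>: "real (k n) \<le> \<epsilon> * n" using k_le[of n] mult_right_mono[OF \<kappa>(2), of "real n"] by simp
    \<comment> \<open>The three shares \<open>\<eta> / 3\<close> go to the polynomial factors, to
      the rate of the component split off, and to the remaining list.\<close>
    have "exp (n * (rate \<alpha> x (\<kappa> # xs) - \<eta>))
        = exp (- (real n * (\<eta> / 3))) * exp (n * (comp_rate \<alpha> \<kappa> - \<eta> / 3)) * exp (n * (rate \<alpha> (x - \<kappa>) xs - \<eta> / 3))"
      unfolding exp_add[symmetric] by (simp add: rate_def algebra_simps)
    also have "\<dots> \<le> (c / (real n)\<^sup>2) * exp (n * comp_rate \<alpha> (real (k n) / n)) * (real n ^ l' n * bulk_coeff \<alpha> n (\<epsilon> * n) (l' n))"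
      using elim unfolding c_def by (intro mult_mono) auto
    also have "\<dots> \<le> (c / (real (l n) * real (k n))) * exp (n * comp_rate \<alpha> (real (k n) / n)) * (real n ^ l' n * bulk_coeff \<alpha> n (\<epsilon> * n) (l' n))"
    proof (intro mult_right_mono)
      have "real (l n) * real (k n) \<le> real n * real n" using l by (intro mult_mono) auto
      then show "c / (real n)\<^sup>2 \<le> c / (real (l n) * real (k n))"
        unfolding c_def power2_eq_square using k0 l by (intro divide_left_mono) auto
    qed (use bulk_coeff_nonneg[OF \<alpha> n] in auto)
    also have "\<dots> = (real (k n) / real (l n)) * (exp (n * comp_rate \<alpha> (real (k n) / n)) * c / (real (k n))\<^sup>2)
        * (real n ^ l' n * bulk_coeff \<alpha> n (\<epsilon> * n) (l' n))"
      using k0 by (simp add: power2_eq_square)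
    also have "\<dots> \<le> (real (k n) / real (l n)) * (real n ^ k n * weight \<alpha> n (k n))
        * (real n ^ l' n * bulk_coeff \<alpha> n (\<epsilon> * n) (l' n))"
      unfolding c_def using k0 l bulk_coeff_nonneg[OF \<alpha> n]
      by (intro mult_right_mono mult_left_mono weight_ge[OF \<alpha> n]) auto
    also have "\<dots> = real n ^ l n * (real (k n) / real (l n) * weight \<alpha> n (k n) * bulk_coeff \<alpha> n (\<epsilon> * n) (l n - k n))"
    proof -
      have "real n ^ l n = real n ^ k n * real n ^ l' n" using l by (simp add: l'_def power_add[symmetric])
      then show ?thesis by (simp add: l'_def)
    qed
    also have "\<dots> \<le> real n ^ l n * bulk_coeff \<alpha> n (\<epsilon> * n) (l n)"
    proof (rule mult_left_mono)
      define w where "w k = (if real k \<le> \<epsilon> * n then weight \<alpha> n k else 0)" for k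
      have "real (k n) / real (l n) * w (k n) * expc w (l n - k n) \<le> expc w (l n)"
        using weight_nonneg[OF \<alpha> n] k0 l by (intro expc_ge_part) (auto simp: w_def)
      then show "real (k n) / real (l n) * weight \<alpha> n (k n) * bulk_coeff \<alpha> n (\<epsilon> * n) (l n - k n) \<le> bulk_coeff \<alpha> n (\<epsilon> * n) (l n)"
        unfolding bulk_coeff_def w_def using k\<epsilon> by simp
    qed simp
    finally show ?case .
  qed
qed

text \<open>A near-optimal list gives the lower bound; the upper bound is
  \<open>bulk_coeff_le_best_rate\<close> followed by \<open>best_rate_upper_limit\<close>. The
  rescaling in the latter breaks down at \<open>x = 0\<close>, hence the separate demand on
  \<open>l\<close> in that case.\<close>

lemma bulk_coeff_limit:
  fixes l :: "nat \<Rightarrow> nat" and \<alpha> \<epsilon> x :: real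
  assumes \<alpha>: "\<alpha> > 0" and \<epsilon>: "0 < \<epsilon>" "\<epsilon> \<le> 1" and x: "0 \<le> x" "x \<le> 1"
    and l: "(\<lambda>n. real (l n) / n) \<longlonglongrightarrow> x" "\<And>n. x * real n \<le> l n" "\<And>n. l n \<le> n" "x = 0 \<Longrightarrow> \<forall>n. l n = 0"
  shows "\<forall>\<^sub>F n in sequentially. 0 < bulk_coeff \<alpha> n (\<epsilon> * n) (l n)"
    and "(\<lambda>n. ln (real n ^ l n * bulk_coeff \<alpha> n (\<epsilon> * n) (l n)) / n) \<longlonglongrightarrow> best_rate \<alpha> \<epsilon> x"
proof -
  define Q where "Q n = real n ^ l n * bulk_coeff \<alpha> n (\<epsilon> * n) (l n)" for n
  have lower: "\<forall>\<^sub>F n in sequentially. exp (n * (rate \<alpha> x xs - \<eta>)) \<le> Q n" if "xs \<in> configs \<epsilon> x" "\<eta> > 0" for xs \<eta>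
    unfolding Q_def by (rule bulk_coeff_ge_rate[OF \<alpha> \<epsilon> that(1) l(1-3) that(2)])
  have "\<forall>\<^sub>F n in sequentially. exp (n * (rate \<alpha> x [] - 1)) \<le> Q n"
    by (rule lower) (use x in \<open>auto simp: configs_def\<close>)
  then have Qpos: "\<forall>\<^sub>F n in sequentially. 0 < Q n"
    by eventually_elim (auto intro: less_le_trans[OF exp_gt_zero])
  then show "\<forall>\<^sub>F n in sequentially. 0 < bulk_coeff \<alpha> n (\<epsilon> * n) (l n)"
    by eventually_elim (auto simp: Q_def zero_less_mult_iff)
  have "(\<lambda>n. ln (Q n) / n) \<longlonglongrightarrow> best_rate \<alpha> \<epsilon> x"
  proof (rule order_tendstoI)
    fix a assume a: "a < best_rate \<alpha> \<epsilon> x"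
    have "configs \<epsilon> x \<noteq> {}" using x by (auto simp: configs_def intro!: exI[of _ "[]"])
    then obtain xs where xs: "xs \<in> configs \<epsilon> x" "a < rate \<alpha> x xs"
      using a unfolding best_rate_def using less_cSUP_iff[OF _ bdd_above_rate[OF \<alpha> \<epsilon> x(2)]] by blast
    define \<eta> where "\<eta> = (rate \<alpha> x xs - a) / 2"
    have \<eta>: "\<eta> > 0" using xs by (simp add: \<eta>_def)
    show "\<forall>\<^sub>F n in sequentially. a < ln (Q n) / n"
      using lower[OF xs(1) \<eta>] eventually_gt_at_top[of 0]
    proof eventually_elim
      case (elim n)
      then have "n * (rate \<alpha> x xs - \<eta>) \<le> ln (Q n)" by (metis exp_gt_zero less_le_trans ln_exp ln_mono)
      then have "rate \<alpha> x xs - \<eta> \<le> ln (Q n) / n" using elim by (simp add: le_divide_eq mult.commute)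
      moreover have "a < rate \<alpha> x xs - \<eta>" using xs by (simp add: \<eta>_def field_simps)
      ultimately show ?case by linarith
    qed
  next
    fix a assume a: "best_rate \<alpha> \<epsilon> x < a"
    define e where "e = (a - best_rate \<alpha> \<epsilon> x) / 4"
    have e: "e > 0" using a by (simp add: e_def)
    \<comment> \<open>The gap to \<open>a\<close> is \<open>4 * e\<close>. The bulk error
      \<open>\<alpha> * \<delta>\<close>, the passage from \<open>l n / n\<close> to
      \<open>x\<close> and the polynomial factors use one \<open>e\<close> each.\<close>
    define \<delta> where "\<delta> = e / \<alpha>"
    have \<delta>: "\<delta> > 0" "\<alpha> * \<delta> = e" using e \<alpha> by (auto simp: \<delta>_def)
    define d where "d = 1 - exp (- (\<alpha> * \<delta>))"
    define K where "K = exp (2 * \<alpha>\<^sup>2 / d + \<alpha>\<^sup>2) / d"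
    have "d > 0" using e \<delta> by (simp add: d_def)
    then have K: "K > 0" by (simp add: K_def)
    \<comment> \<open>At \<open>n = 0\<close> the quotient is 0 and would violate
      \<open>x \<le> z n\<close>.\<close>
    define z where "z n = (if n = 0 then x else real (l n) / n)" for n
    have ev_v: "\<forall>\<^sub>F n in sequentially. best_rate \<alpha> \<epsilon> (z n) \<le> best_rate \<alpha> \<epsilon> x + e"
    proof (cases "x = 0")
      case True
      then show ?thesis using l(4) e by (simp add: z_def)
    next
      case False
      show ?thesis
      proof (rule best_rate_upper_limit[OF \<alpha> \<epsilon>])
        show "z \<longlonglongrightarrow> x"
          by (rule Lim_transform_eventually[OF l(1)])
             (use eventually_gt_at_top[of 0] in \<open>eventually_elim, simp add: z_def\<close>)
        show "x \<le> z n" for n using l(2)[of n] by (simp add: z_def le_divide_eq)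
        show "z n \<le> 1" for n using l(3)[of n] x by (simp add: z_def)
      qed (use x False e in auto)
    qed
    have "(\<lambda>n. \<alpha>\<^sup>2 / real n + (1 / \<delta>) * (ln (1 + K) / n + ln n / n)) \<longlonglongrightarrow> 0 + (1 / \<delta>) * (0 + 0)"
      by (intro tendsto_intros lim_const_over_n lim_ln_over_n)
    then have ev_e: "\<forall>\<^sub>F n in sequentially. \<alpha>\<^sup>2 / real n + (1 / \<delta>) * (ln (1 + K) / n + ln n / n) < e"
      using e order_tendstoD(2) by fastforce
    show "\<forall>\<^sub>F n in sequentially. ln (Q n) / n < a"
      using ev_v ev_e Qpos eventually_large[of "2 * \<alpha>"]
    proof eventually_elim
      case (elim n)
      then have n: "real n \<ge> 2 * \<alpha>" "n > 0" by auto
      have "Q n \<le> exp (\<alpha>\<^sup>2 + \<alpha> * \<delta> * n) * (1 + n * K) powr (l n / (\<delta> * n)) * exp (n * best_rate \<alpha> \<epsilon> (real (l n) / n))"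
        unfolding Q_def K_def d_def by (rule bulk_coeff_le_best_rate[OF \<alpha> \<epsilon> n \<delta>(1) l(3)])
      then have "ln (Q n) \<le> ln (exp (\<alpha>\<^sup>2 + \<alpha> * \<delta> * n) * (1 + n * K) powr (l n / (\<delta> * n)) * exp (n * best_rate \<alpha> \<epsilon> (real (l n) / n)))"
        using elim by (intro ln_mono) auto
      also have "\<dots> = \<alpha>\<^sup>2 + e * n + l n / (\<delta> * n) * ln (1 + n * K) + n * best_rate \<alpha> \<epsilon> (z n)"
      proof -
        have "1 + n * K > 0" using K by (simp add: add_pos_nonneg)
        then show ?thesis using n \<delta>(2) by (simp add: ln_mult_pos ln_powr z_def)
      qed
      also have "\<dots> \<le> \<alpha>\<^sup>2 + e * n + 1 / \<delta> * (ln (1 + K) + ln n) + n * (best_rate \<alpha> \<epsilon> x + e)"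
      proof -
        have "1 + n * K \<le> (1 + K) * n" using n by (simp add: algebra_simps)
        then have "ln (1 + n * K) \<le> ln ((1 + K) * n)" using K by (intro ln_mono) (auto intro: add_pos_nonneg)
        also have "\<dots> = ln (1 + K) + ln n" using K n by (simp add: ln_mult_pos)
        finally have ln_le: "ln (1 + n * K) \<le> ln (1 + K) + ln n" .
        have "l n / (\<delta> * n) \<le> 1 / \<delta>" using l(3)[of n] n \<delta> by (simp add: field_simps)
        then have "l n / (\<delta> * n) * ln (1 + n * K) \<le> 1 / \<delta> * (ln (1 + K) + ln n)"
          using ln_le K \<delta> by (intro mult_mono) auto
        moreover have "n * best_rate \<alpha> \<epsilon> (z n) \<le> n * (best_rate \<alpha> \<epsilon> x + e)" using elim by (intro mult_left_mono) auto
        ultimately show ?thesis by linarith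
      qed
      finally have "ln (Q n) / n \<le> (\<alpha>\<^sup>2 + e * n + 1 / \<delta> * (ln (1 + K) + ln n) + n * (best_rate \<alpha> \<epsilon> x + e)) / n"
        by (intro divide_right_mono) auto
      also have "\<dots> = \<alpha>\<^sup>2 / real n + (1 / \<delta>) * (ln (1 + K) / n + ln n / n) + best_rate \<alpha> \<epsilon> x + 2 * e"
        using n by (simp add: add_divide_distrib algebra_simps)
      also have "\<dots> < a"
      proof -
        have "a = best_rate \<alpha> \<epsilon> x + 4 * e" by (simp add: e_def field_simps)
        then show ?thesis using elim e by linarith
      qed
      finally show ?case .
    qed
  qed
  then show "(\<lambda>n. ln (real n ^ l n * bulk_coeff \<alpha> n (\<epsilon> * n) (l n)) / n) \<longlonglongrightarrow> best_rate \<alpha> \<epsilon> x"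
    by (simp add: Q_def)
qed

text \<open>The two bounds differ by a subexponential factor, because
  \<open>m n / (\<epsilon> * n)\<close> stays bounded for fixed \<epsilon>. The condition
  \<open>\<epsilon> < \<rho>\<close> lets one component on all \<open>m n\<close> vertices count as
  large.\<close>

lemma comps_prob_gt_limit:
  fixes m :: "nat \<Rightarrow> nat" and \<alpha> \<epsilon> \<rho> :: real
  assumes \<alpha>: "\<alpha> > 0" and \<epsilon>: "0 < \<epsilon>" "\<epsilon> < \<rho>"
    and m: "(\<lambda>n. real (m n) / n) \<longlonglongrightarrow> \<rho>" "\<And>n. m n \<le> n"
  shows "\<forall>\<^sub>F n in sequentially. 0 < comps_prob (\<alpha> / n) (\<lambda>k. \<epsilon> * n < real k) (m n)"
    and "(\<lambda>n. ln (comps_prob (\<alpha> / n) (\<lambda>k. \<epsilon> * n < real k) (m n)) / n) \<longlonglongrightarrow> \<rho> * ln (1 - exp (- (\<alpha> * \<rho>)))"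
proof -
  define Z where "Z n = comps_prob (\<alpha> / n) (\<lambda>k. \<epsilon> * n < real k) (m n)" for n
  define e where "e n = 1 - exp (- (\<alpha> * (real (m n) / n)))" for n
  define d where "d = 1 - exp (- (\<alpha> * \<epsilon>))"
  have \<rho>: "\<rho> > 0" using \<epsilon> by simp
  have d: "d > 0" using \<alpha> \<epsilon> by (simp add: d_def)
  have "1 - exp (- (\<alpha> * \<rho>)) > 0" using \<alpha> \<rho> by simp
  then have main: "(\<lambda>n. real (m n) / n * ln (e n)) \<longlonglongrightarrow> \<rho> * ln (1 - exp (- (\<alpha> * \<rho>)))"
    unfolding e_def by (intro tendsto_intros m) auto
  have ev: "\<forall>\<^sub>F n in sequentially. \<epsilon> < real (m n) / n" by (rule order_tendstoD(1)[OF m(1) \<epsilon>(2)])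
  have bounds: "\<forall>\<^sub>F n in sequentially. 0 < Z n \<and> real (m n) / n * ln (e n) - ln n / n \<le> ln (Z n) / n \<and>
      ln (Z n) / n \<le> real (m n) / n / \<epsilon> * (ln n / n - ln d / n) + (2 * \<alpha>\<^sup>2 / d) / n + real (m n) / n * ln (e n)"
    using ev eventually_large[of "2 * \<alpha>"]
  proof eventually_elim
    case (elim n)
    then have n: "real n \<ge> 2 * \<alpha>" "n > 0" by auto
    have m\<epsilon>: "\<epsilon> * n < real (m n)" using elim n by (simp add: field_simps)
    have "0 < \<epsilon> * n" using \<epsilon> n by simp
    then have m0: "m n > 0" using m\<epsilon> by linarith
    have en: "e n > 0" using \<alpha> n m0 by (simp add: e_def)
    have lo: "e n ^ m n / m n \<le> Z n" unfolding Z_def e_def by (rule comps_prob_gt_ge[OF \<alpha> n m\<epsilon> m0 m(2)])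
    have pos: "0 < e n ^ m n / m n" using en m0 by simp
    then have Zpos: "0 < Z n" using lo by linarith
    have "Z n \<le> (n / d) powr (m n / (\<epsilon> * n)) * (1 - (1 - \<alpha> / n) ^ m n) ^ m n"
      unfolding Z_def d_def by (rule comps_prob_gt_le[OF \<alpha> n \<epsilon>(1) m(2)])
    also have "\<dots> \<le> (n / d) powr (m n / (\<epsilon> * n)) * (exp (2 * \<alpha>\<^sup>2 / d) * e n ^ m n)"
      unfolding d_def e_def using m\<epsilon> m(2) by (intro mult_left_mono one_minus_q_pow_le[OF \<alpha> n \<epsilon>(1)]) auto
    finally have hi: "ln (Z n) \<le> ln ((n / d) powr (m n / (\<epsilon> * n)) * (exp (2 * \<alpha>\<^sup>2 / d) * e n ^ m n))"
      using Zpos by (intro ln_mono)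
    also have "\<dots> = m n / (\<epsilon> * n) * (ln n - ln d) + 2 * \<alpha>\<^sup>2 / d + m n * ln (e n)"
      using n d en by (simp add: ln_mult_pos ln_powr ln_div ln_realpow)
    finally have "ln (Z n) / n \<le> (m n / (\<epsilon> * n) * (ln n - ln d) + 2 * \<alpha>\<^sup>2 / d + m n * ln (e n)) / n"
      by (intro divide_right_mono) auto
    also have "\<dots> = real (m n) / n / \<epsilon> * (ln n / n - ln d / n) + (2 * \<alpha>\<^sup>2 / d) / n + real (m n) / n * ln (e n)"
      by (simp add: add_divide_distrib diff_divide_distrib algebra_simps)
    finally have upper: "ln (Z n) / n \<le> real (m n) / n / \<epsilon> * (ln n / n - ln d / n) + (2 * \<alpha>\<^sup>2 / d) / n + real (m n) / n * ln (e n)" .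
    have "m n * ln (e n) - ln n \<le> m n * ln (e n) - ln (m n)" using m0 m(2)[of n] by simp
    also have "\<dots> = ln (e n ^ m n / m n)" using en m0 by (simp add: ln_div ln_realpow)
    also have "\<dots> \<le> ln (Z n)" using lo pos by (intro ln_mono)
    finally have "(m n * ln (e n) - ln n) / n \<le> ln (Z n) / n" by (intro divide_right_mono) auto
    then have "real (m n) / n * ln (e n) - ln n / n \<le> ln (Z n) / n" by (simp add: diff_divide_distrib)
    with Zpos upper show ?case by blast
  qed
  then show "\<forall>\<^sub>F n in sequentially. 0 < comps_prob (\<alpha> / n) (\<lambda>k. \<epsilon> * n < real k) (m n)"
    unfolding Z_def by eventually_elim simp
  have "(\<lambda>n. ln (Z n) / n) \<longlonglongrightarrow> \<rho> * ln (1 - exp (- (\<alpha> * \<rho>)))"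
  proof (rule tendsto_sandwich)
    show "\<forall>\<^sub>F n in sequentially. real (m n) / n * ln (e n) - ln n / n \<le> ln (Z n) / n"
      using bounds by eventually_elim simp
    show "\<forall>\<^sub>F n in sequentially. ln (Z n) / n
        \<le> real (m n) / n / \<epsilon> * (ln n / n - ln d / n) + (2 * \<alpha>\<^sup>2 / d) / n + real (m n) / n * ln (e n)"
      using bounds by eventually_elim simp
    show "(\<lambda>n. real (m n) / n * ln (e n) - ln n / n) \<longlonglongrightarrow> \<rho> * ln (1 - exp (- (\<alpha> * \<rho>)))"
      using tendsto_diff[OF main lim_ln_over_n] by simp
    have "(\<lambda>n. real (m n) / n / \<epsilon> * (ln n / n - ln d / n) + (2 * \<alpha>\<^sup>2 / d) / n + real (m n) / n * ln (e n))
        \<longlonglongrightarrow> \<rho> / \<epsilon> * (0 - 0) + 0 + \<rho> * ln (1 - exp (- (\<alpha> * \<rho>)))"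
      using \<epsilon> by (intro tendsto_add tendsto_mult tendsto_diff tendsto_divide tendsto_const m main lim_ln_over_n lim_const_over_n) auto
    then show "(\<lambda>n. real (m n) / n / \<epsilon> * (ln n / n - ln d / n) + (2 * \<alpha>\<^sup>2 / d) / n + real (m n) / n * ln (e n))
        \<longlonglongrightarrow> \<rho> * ln (1 - exp (- (\<alpha> * \<rho>)))" by simp
  qed
  then show "(\<lambda>n. ln (comps_prob (\<alpha> / n) (\<lambda>k. \<epsilon> * n < real k) (m n)) / n) \<longlonglongrightarrow> \<rho> * ln (1 - exp (- (\<alpha> * \<rho>)))"
    by (simp add: Z_def)
qed

lemma n_ln_q_tendsto:
  assumes "\<alpha> > 0"
  shows "(\<lambda>n. real n * ln (1 - \<alpha> / real n)) \<longlonglongrightarrow> - \<alpha>"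
proof (rule tendsto_sandwich[of "\<lambda>n. - \<alpha> - 2 * \<alpha>\<^sup>2 / real n" _ _ "\<lambda>n. - \<alpha>"])
  have "(\<lambda>n. - \<alpha> - 2 * \<alpha>\<^sup>2 / real n) \<longlonglongrightarrow> - \<alpha> - 0" by (intro tendsto_intros lim_const_over_n)
  then show "(\<lambda>n. - \<alpha> - 2 * \<alpha>\<^sup>2 / real n) \<longlonglongrightarrow> - \<alpha>" by simp
  show "\<forall>\<^sub>F n in sequentially. - \<alpha> - 2 * \<alpha>\<^sup>2 / real n \<le> real n * ln (1 - \<alpha> / real n)"
    using eventually_large[of "2 * \<alpha>"]
  proof eventually_elim
    case (elim n)
    then have p: "0 \<le> \<alpha> / n" "\<alpha> / n \<le> 1 / 2" using assms by (auto simp: field_simps)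
    have "real n * (- (\<alpha> / n) - 2 * (\<alpha> / n)\<^sup>2) \<le> real n * ln (1 - \<alpha> / n)"
      using ln_one_minus_pos_lower_bound[OF p] by (intro mult_left_mono) auto
    moreover have "real n * (- (\<alpha> / n) - 2 * (\<alpha> / n)\<^sup>2) = - \<alpha> - 2 * \<alpha>\<^sup>2 / real n"
      using elim by (simp add: power2_eq_square right_diff_distrib)
    ultimately show ?case by simp
  qed
  show "\<forall>\<^sub>F n in sequentially. real n * ln (1 - \<alpha> / real n) \<le> - \<alpha>"
    using eventually_large[of "2 * \<alpha>"]
  proof eventually_elim
    case (elim n)
    then have p: "\<alpha> / n \<le> 1 / 2" using assms by (auto simp: field_simps)
    have "real n * ln (1 - \<alpha> / n) \<le> real n * (- (\<alpha> / n))"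
      using ln_le_minus_one[of "1 - \<alpha> / n"] p by (intro mult_left_mono) auto
    then show ?case using elim by simp
  qed
qed auto

section \<open>The limit for fixed epsilon and the rate for small epsilon\<close>

lemma P_event_limit:
  fixes \<alpha> \<epsilon> \<rho> :: real
  assumes \<alpha>: "\<alpha> > 0" and \<rho>: "0 \<le> \<rho>" "\<rho> \<le> 1" and \<epsilon>: "0 < \<epsilon>" "\<epsilon> \<le> 1" "\<rho> > 0 \<Longrightarrow> \<epsilon> < \<rho>"
  shows "(\<lambda>n. P_event n \<alpha> (\<lambda>E. int (card (bigV n E (\<epsilon> * real n))) = \<lfloor>\<rho> * real n\<rfloor>) powr (1 / real n))
    \<longlonglongrightarrow> exp (- (\<rho> * ln \<rho>) - (1 - \<rho>) - \<alpha> * (\<rho> * (1 - \<rho>) + (1 - \<rho>)\<^sup>2 / 2)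
          + \<rho> * ln (1 - exp (- (\<alpha> * \<rho>))) + best_rate \<alpha> \<epsilon> (1 - \<rho>))"
proof -
  define m where "m n = nat \<lfloor>\<rho> * real n\<rfloor>" for n :: nat
  define l where "l n = n - m n" for n
  define P where "P n = P_event n \<alpha> (\<lambda>E. int (card (bigV n E (\<epsilon> * real n))) = \<lfloor>\<rho> * real n\<rfloor>)" for n
  define Z where "Z n = comps_prob (\<alpha> / n) (\<lambda>k. \<epsilon> * n < real k) (m n)" for n
  define b where "b n = bulk_coeff \<alpha> n (\<epsilon> * n) (l n)" for n
  have fl: "0 \<le> \<lfloor>\<rho> * real n\<rfloor>" for n :: nat using \<rho> by simp
  have m_le\<rho>: "real (m n) \<le> \<rho> * n" for n unfolding m_def using fl[of n] by linarith
  have m_le: "m n \<le> n" for n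
  proof -
    have "\<rho> * n \<le> 1 * real n" using \<rho> by (intro mult_right_mono) auto
    then show ?thesis using m_le\<rho>[of n] by linarith
  qed
  have m_lim: "(\<lambda>n. real (m n) / n) \<longlonglongrightarrow> \<rho>" unfolding m_def using \<rho> by (intro nat_floor_ratio_tendsto)
  have l_real: "real (l n) = real n - real (m n)" for n using m_le[of n] by (simp add: l_def of_nat_diff)
  have l_lim: "(\<lambda>n. real (l n) / n) \<longlonglongrightarrow> 1 - \<rho>"
  proof (rule Lim_transform_eventually)
    show "(\<lambda>n. 1 - real (m n) / n) \<longlonglongrightarrow> 1 - \<rho>" by (intro tendsto_intros m_lim)
    show "\<forall>\<^sub>F n in sequentially. 1 - real (m n) / n = real (l n) / n"
      using eventually_gt_at_top[of 0] by eventually_elim (simp add: l_real diff_divide_distrib)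
  qed
  have l0: "\<forall>n. l n = 0" if "1 - \<rho> = 0" using that by (simp add: l_def m_def)
  have l_ge: "(1 - \<rho>) * real n \<le> l n" for n using m_le\<rho>[of n] by (simp add: l_real left_diff_distrib)
  have l_le: "l n \<le> n" for n by (simp add: l_def)
  have \<rho>1: "0 \<le> 1 - \<rho>" "1 - \<rho> \<le> 1" using \<rho> by auto
  have b: "\<forall>\<^sub>F n in sequentially. 0 < b n" "(\<lambda>n. ln (real n ^ l n * b n) / n) \<longlonglongrightarrow> best_rate \<alpha> \<epsilon> (1 - \<rho>)"
    unfolding b_def by (rule bulk_coeff_limit[OF \<alpha> \<epsilon>(1,2) \<rho>1 l_lim l_ge l_le l0]; assumption)+
  have Z: "(\<forall>\<^sub>F n in sequentially. 0 < Z n) \<and> (\<lambda>n. ln (Z n) / n) \<longlonglongrightarrow> \<rho> * ln (1 - exp (- (\<alpha> * \<rho>)))"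
  proof (cases "\<rho> = 0")
    \<comment> \<open>With no vertex to cover, \<open>Z n = 1\<close>.\<close>
    case True
    then show ?thesis by (simp add: Z_def m_def comps_prob.simps)
  next
    case False
    then have "\<epsilon> < \<rho>" using \<rho> \<epsilon> by simp
    then show ?thesis unfolding Z_def using comps_prob_gt_limit[OF \<alpha> \<epsilon>(1) _ m_lim m_le] by blast
  qed
  have q_lim: "(\<lambda>n. (real (m n) / n * (real (l n) / n) + real (l n) / n * (real (l n) / n - 1 / n) / 2) * (real n * ln (1 - \<alpha> / n)))
      \<longlonglongrightarrow> (\<rho> * (1 - \<rho>) + (1 - \<rho>) * ((1 - \<rho>) - 0) / 2) * (- \<alpha>)"
    by (intro tendsto_intros m_lim l_lim lim_const_over_n n_ln_q_tendsto[OF \<alpha>]) auto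
  have "(\<lambda>n. real n / real n) \<longlonglongrightarrow> 1"
    by (rule tendsto_eventually) (use eventually_gt_at_top[of 0] in \<open>eventually_elim, simp\<close>)
  from fact_asymp[OF this] have n_lim: "(\<lambda>n. (ln (fact n) - real n * ln n) / n) \<longlonglongrightarrow> - 1" by simp
  note fm_lim = fact_asymp[OF m_lim]
  \<comment> \<open>The factorial of \<open>l n\<close> in the small part cancels against the
    binomial coefficient. The powers of \<open>n\<close> that normalise the remaining terms cancel
    because \<open>n = m n + l n\<close>.\<close>
  define A where "A n = (ln (fact n) - real n * ln n) / n - (ln (fact (m n)) - real (m n) * ln n) / n
      + (real (m n) / n * (real (l n) / n) + real (l n) / n * (real (l n) / n - 1 / n) / 2) * (real n * ln (1 - \<alpha> / n))
      + ln (Z n) / n + ln (real n ^ l n * b n) / n" for n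
  have "A \<longlonglongrightarrow> - 1 - (\<rho> * ln \<rho> - \<rho>) + (\<rho> * (1 - \<rho>) + (1 - \<rho>) * ((1 - \<rho>) - 0) / 2) * (- \<alpha>)
      + \<rho> * ln (1 - exp (- (\<alpha> * \<rho>))) + best_rate \<alpha> \<epsilon> (1 - \<rho>)"
    unfolding A_def by (intro tendsto_add tendsto_diff n_lim fm_lim q_lim b conjunct2[OF Z])
  also have "- 1 - (\<rho> * ln \<rho> - \<rho>) + (\<rho> * (1 - \<rho>) + (1 - \<rho>) * ((1 - \<rho>) - 0) / 2) * (- \<alpha>)
      + \<rho> * ln (1 - exp (- (\<alpha> * \<rho>))) + best_rate \<alpha> \<epsilon> (1 - \<rho>)
      = - (\<rho> * ln \<rho>) - (1 - \<rho>) - \<alpha> * (\<rho> * (1 - \<rho>) + (1 - \<rho>)\<^sup>2 / 2)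
          + \<rho> * ln (1 - exp (- (\<alpha> * \<rho>))) + best_rate \<alpha> \<epsilon> (1 - \<rho>)" (is "_ = ?C")
    by (simp add: power2_eq_square field_simps)
  finally have "(\<lambda>n. exp (A n)) \<longlonglongrightarrow> exp ?C" by (rule tendsto_exp)
  moreover have "\<forall>\<^sub>F n in sequentially. exp (A n) = P n powr (1 / real n)"
    using b(1) conjunct1[OF Z] eventually_large[of "2 * \<alpha>"]
  proof eventually_elim
    case (elim n)
    then have n: "real n \<ge> 2 * \<alpha>" "n > 0" by auto
    define q where "q = 1 - \<alpha> / n"
    have q: "q > 0" using p_bounds[OF \<alpha> n] by (simp add: q_def)
    have "P n = P_event n \<alpha> (\<lambda>E. card (bigV n E (\<epsilon> * real n)) = m n)"
      unfolding P_def m_def using fl[of n] by (auto intro!: arg_cong[of _ _ "P_event n \<alpha>"])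
    also have "\<dots> = real (n choose m n) * q ^ (m n * l n) * Z n * (fact (l n) * q ^ (l n choose 2) * b n)"
      unfolding bigV_prob[OF m_le] Z_def b_def q_def l_def comps_prob_bulk_coeff[OF \<alpha> n] ..
    also have "\<dots> = fact n / fact (m n) * q ^ (m n * l n + (l n choose 2)) * Z n * b n"
      using m_le[of n] by (simp add: binomial_fact l_def power_add)
    finally have P: "P n = fact n / fact (m n) * q ^ (m n * l n + (l n choose 2)) * Z n * b n" .
    have Ppos: "P n > 0" unfolding P using elim q by simp
    have "ln (P n) = ln (fact n) - ln (fact (m n)) + (real (m n) * real (l n) + real (l n) * (real (l n) - 1) / 2) * ln q + ln (Z n) + ln (b n)"
      unfolding P using elim q by (simp add: ln_mult_pos ln_div ln_realpow real_choose_two)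
    moreover have "ln (real n ^ l n * b n) = real (l n) * ln n + ln (b n)"
      using elim by (simp add: ln_mult_pos ln_realpow)
    moreover have "(real (m n) / n * (real (l n) / n) + real (l n) / n * (real (l n) / n - 1 / n) / 2) * (real n * ln q)
        = (real (m n) * real (l n) + real (l n) * (real (l n) - 1) / 2) * ln q / n"
      using n by (simp add: field_simps)
    ultimately have "A n = ln (P n) / n"
      unfolding A_def q_def[symmetric] by (simp add: l_real add_divide_distrib[symmetric] diff_divide_distrib[symmetric] algebra_simps)
    then show ?case using Ppos n by (simp add: powr_def)
  qed
  ultimately show ?thesis unfolding P_def by (rule Lim_transform_eventually)
qed

text \<open>The empty list gives one inequality. For the other, \<open>best_rate\<close> is known to
  be the limit of a normalised logarithm, and \<open>bulk_coeff_le_bulk_rate\<close> with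
  \<open>\<delta> = \<epsilon>\<close> bounds the same logarithm; no optimisation over lists is
  carried out.\<close>

lemma best_rate_tendsto_bulk_rate:
  assumes \<alpha>: "\<alpha> > 0" and x: "0 \<le> x" "x \<le> 1"
  shows "((\<lambda>\<epsilon>. best_rate \<alpha> \<epsilon> x) \<longlongrightarrow> bulk_rate \<alpha> x) (at_right 0)"
proof (rule tendsto_sandwich[of "\<lambda>_. bulk_rate \<alpha> x" _ _ "\<lambda>\<epsilon>. bulk_rate \<alpha> x + \<alpha> * \<epsilon>"])
  have ev: "\<forall>\<^sub>F \<epsilon> in at_right (0::real). 0 < \<epsilon> \<and> \<epsilon> \<le> 1"
    by (rule eventually_at_rightI[of 0 1]) auto
  show "\<forall>\<^sub>F \<epsilon> in at_right 0. bulk_rate \<alpha> x \<le> best_rate \<alpha> \<epsilon> x"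
    using ev by eventually_elim (use bulk_rate_le_best_rate[OF \<alpha> _ _ x] in auto)
  show "\<forall>\<^sub>F \<epsilon> in at_right 0. best_rate \<alpha> \<epsilon> x \<le> bulk_rate \<alpha> x + \<alpha> * \<epsilon>"
    using ev
  proof eventually_elim
    case (elim \<epsilon>)
    \<comment> \<open>Rounded up, because \<open>bulk_coeff_limit\<close> asks for
      \<open>x * n \<le> l n\<close>.\<close>
    define l where "l n = nat \<lceil>x * real n\<rceil>" for n :: nat
    have l_ge: "x * real n \<le> l n" for n unfolding l_def by linarith
    have l_le: "l n \<le> n" for n
    proof -
      have "x * real n \<le> real n" using x by (simp add: mult_left_le_one_le)
      then have "\<lceil>x * real n\<rceil> \<le> int n" by (simp add: ceiling_le_iff)
      then show ?thesis unfolding l_def by linarith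
    qed
    have l_lim: "(\<lambda>n. real (l n) / n) \<longlonglongrightarrow> x"
    proof (rule tendsto_sandwich[of "\<lambda>_. x" _ _ "\<lambda>n. x + 1 / real n"])
      have "(\<lambda>n. x + 1 / real n) \<longlonglongrightarrow> x + 0" by (intro tendsto_intros lim_const_over_n)
      then show "(\<lambda>n. x + 1 / real n) \<longlonglongrightarrow> x" by simp
      show "\<forall>\<^sub>F n in sequentially. x \<le> real (l n) / n"
        using eventually_gt_at_top[of 0] by eventually_elim (use l_ge in \<open>simp add: le_divide_eq\<close>)
      show "\<forall>\<^sub>F n in sequentially. real (l n) / n \<le> x + 1 / real n"
        using eventually_gt_at_top[of 0]
      proof eventually_elim
        case (elim n)
        have "0 \<le> \<lceil>x * real n\<rceil>" using x by (simp add: order_less_le_trans[of _ 0])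
        then have "real (l n) \<le> x * real n + 1" unfolding l_def by linarith
        then show ?case using elim by (simp add: field_simps)
      qed
    qed auto
    have l0: "\<forall>n. l n = 0" if "x = 0" using that by (simp add: l_def)
    note lim = bulk_coeff_limit[OF \<alpha> _ _ x l_lim l_ge l_le l0, of \<epsilon>]
    have B_lim: "(\<lambda>n. bulk_rate \<alpha> (real (l n) / n)) \<longlonglongrightarrow> bulk_rate \<alpha> x"
      using x by (intro continuous_on_tendsto_compose[OF continuous_on_bulk_rate[OF \<alpha>] l_lim]) auto
    have "(\<lambda>n. bulk_rate \<alpha> (real (l n) / n) + \<alpha>\<^sup>2 / real n + \<alpha> * \<epsilon>) \<longlonglongrightarrow> bulk_rate \<alpha> x + 0 + \<alpha> * \<epsilon>"
      by (intro tendsto_intros B_lim lim_const_over_n)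
    moreover have "\<forall>\<^sub>F n in sequentially. ln (real n ^ l n * bulk_coeff \<alpha> n (\<epsilon> * n) (l n)) / n
        \<le> bulk_rate \<alpha> (real (l n) / n) + \<alpha>\<^sup>2 / real n + \<alpha> * \<epsilon>"
    proof -
      have pos: "\<forall>\<^sub>F n in sequentially. 0 < bulk_coeff \<alpha> n (\<epsilon> * n) (l n)" using lim(1) elim by simp
      show ?thesis
        using pos eventually_large[of "2 * \<alpha>"]
      proof eventually_elim
        case (elim n)
        then have n: "real n \<ge> 2 * \<alpha>" "n > 0" by auto
        have "ln (real n ^ l n * bulk_coeff \<alpha> n (\<epsilon> * n) (l n)) \<le> ln (exp (n * bulk_rate \<alpha> (real (l n) / n) + \<alpha>\<^sup>2 + \<alpha> * \<epsilon> * n))"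
          using elim \<open>0 < \<epsilon> \<and> \<epsilon> \<le> 1\<close> n l_le by (intro ln_mono bulk_coeff_le_bulk_rate[OF \<alpha> n]) auto
        then have "ln (real n ^ l n * bulk_coeff \<alpha> n (\<epsilon> * n) (l n)) / n \<le> (n * bulk_rate \<alpha> (real (l n) / n) + \<alpha>\<^sup>2 + \<alpha> * \<epsilon> * n) / n"
          by (intro divide_right_mono) auto
        also have "\<dots> = bulk_rate \<alpha> (real (l n) / n) + \<alpha>\<^sup>2 / real n + \<alpha> * \<epsilon>" using n by (simp add: add_divide_distrib)
        finally show ?case .
      qed
    qed
    ultimately show ?case
      using lim(2) elim by (auto intro: tendsto_le[OF sequentially_bot])
  qed
  have "((\<lambda>\<epsilon>. bulk_rate \<alpha> x + \<alpha> * \<epsilon>) \<longlongrightarrow> bulk_rate \<alpha> x + \<alpha> * 0) (at_right 0)" by (intro tendsto_intros)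
  then show "((\<lambda>\<epsilon>. bulk_rate \<alpha> x + \<alpha> * \<epsilon>) \<longlongrightarrow> bulk_rate \<alpha> x) (at_right 0)" by simp
qed auto

text \<open>For \<open>\<alpha> > 0\<close> every infinite logarithm in \<open>Phi\<close> has
  coefficient 0, so \<open>Phi\<close> is finite. The explicit terms \<open>1 - \<rho>\<close> and
  \<open>\<alpha> * (1 - \<rho>)\<^sup>2 / 2\<close> cancel against those in
  \<open>bulk_rate\<close>.\<close>

lemma exp_neg_Phi:
  assumes \<alpha>: "\<alpha> > 0" and \<rho>: "0 \<le> \<rho>" "\<rho> \<le> 1"
  shows "exp_neg (Phi \<rho> \<alpha>) = exp (- (\<rho> * ln \<rho>) - (1 - \<rho>) - \<alpha> * (\<rho> * (1 - \<rho>) + (1 - \<rho>)\<^sup>2 / 2)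
          + \<rho> * ln (1 - exp (- (\<alpha> * \<rho>))) + bulk_rate \<alpha> (1 - \<rho>))"
proof -
  have "S_ent \<rho> = ereal (\<rho> * ln \<rho> + (1 - \<rho>) * ln (1 - \<rho>))"
    by (simp add: S_ent_def xlogy_def)
  moreover have "xlogy \<rho> (pi1 (\<alpha> * \<rho>)) = ereal (\<rho> * ln (1 - exp (- (\<alpha> * \<rho>))))"
    using \<alpha> \<rho> by (auto simp: xlogy_def pi1_def)
  moreover have "xlogy (1 - \<rho>) (1 - pi1 (\<alpha> * \<rho>)) = ereal (- ((1 - \<rho>) * (\<alpha> * \<rho>)))"
    by (simp add: xlogy_def pi1_def)
  ultimately have "Phi \<rho> \<alpha> = ereal (\<rho> * ln \<rho> + (1 - \<rho>) * ln (1 - \<rho>) - \<rho> * ln (1 - exp (- (\<alpha> * \<rho>)))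
      + (1 - \<rho>) * (\<alpha> * \<rho>) - (1 - \<rho>) * Psi (\<alpha> * (1 - \<rho>)))"
    by (simp add: Phi_def)
  then show ?thesis
    by (simp add: exp_neg_def bulk_rate_def algebra_simps)
qed

section \<open>The case without edges and the conclusion\<close>

lemma P_event_no_edges:
  "P_event n 0 Q = (if Q {} then 1 else 0)"
proof -
  define S where "S = {E. E \<subseteq> all_pairs n \<and> Q E}"
  have fin: "finite (all_pairs n)"
    using finite_pairs[of "vertices n"] by (simp add: all_pairs_def pairs_def vertices_def)
  then have "finite S" by (simp add: S_def)
  have "graph_prob n 0 E = 0" if "E \<in> S - {{}}" for E
  proof -
    have "finite E" using that fin finite_subset by (auto simp: S_def)
    then show ?thesis using that by (auto simp: graph_prob_def card_eq_0_iff)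
  qed
  then have "(\<Sum>E\<in>S. graph_prob n 0 E) = (\<Sum>E\<in>S \<inter> {{}}. graph_prob n 0 E)"
    using \<open>finite S\<close> by (intro sum.mono_neutral_right) auto
  also have "\<dots> = (if Q {} then 1 else 0)"
    by (auto simp: S_def graph_prob_def)
  finally show ?thesis by (simp add: P_event_def S_def)
qed

lemma bigV_no_edges:
  assumes "real n * \<epsilon> \<ge> 1"
  shows "bigV n {} (\<epsilon> * real n) = {}"
proof -
  have "component {} v = {v}" for v by (auto simp: component_def adj_def)
  then show ?thesis using assms by (auto simp: bigV_def mult.commute)
qed

text \<open>\<open>lim\<close> carries information only for convergent sequences, so the existence
  of the inner limit for all small \<epsilon> is part of the claim. For small \<open>n\<close> the
  parameter \<open>\<alpha> / n\<close> may exceed 1; both limits see only large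
  \<open>n\<close>.\<close>

theorem theorem2p1:
  fixes \<alpha> \<rho> :: real
  assumes "\<alpha> \<ge> 0" and "0 \<le> \<rho>" and "\<rho> \<le> 1"
  defines "L \<equiv> \<lambda>\<epsilon> n. P_event n \<alpha>
             (\<lambda>E. int (card (bigV n E (\<epsilon> * real n))) = \<lfloor>\<rho> * real n\<rfloor>) powr (1 / real n)"
  shows "(\<forall>\<^sub>F \<epsilon> in at_right 0. convergent (L \<epsilon>))
       \<and> ((\<lambda>\<epsilon>. lim (L \<epsilon>)) \<longlongrightarrow> exp_neg (Phi \<rho> \<alpha>)) (at_right 0)"
proof (cases "\<alpha> = 0")
  case True
  have L: "L \<epsilon> \<longlonglongrightarrow> exp_neg (Phi \<rho> \<alpha>)" if \<epsilon>: "\<epsilon> > 0" for \<epsilon>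
  proof (rule tendsto_eventually)
    show "\<forall>\<^sub>F n in sequentially. L \<epsilon> n = exp_neg (Phi \<rho> \<alpha>)"
      \<comment> \<open>Beyond \<open>1 / \<epsilon>\<close> no isolated vertex is counted; beyond
        \<open>1 / \<rho>\<close> the prescribed number of vertices is positive. For
        \<open>\<rho> = 0\<close> the second bound is 0.\<close>
      using eventually_large[of "max (1 / \<epsilon>) (1 / \<rho>)"]
    proof eventually_elim
      case (elim n)
      then have V: "bigV n {} (\<epsilon> * real n) = {}" using \<epsilon> by (intro bigV_no_edges) (auto simp: field_simps)
      show ?case
      proof (cases "\<rho> = 0")
        case True
        then show ?thesis
          using V \<open>\<alpha> = 0\<close> elim
          by (simp add: L_def P_event_no_edges Phi_def S_ent_def xlogy_def pi1_def Psi_def exp_neg_def zero_ereal_def[symmetric])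
      next
        case False
        then have "\<rho> * real n \<ge> 1" using elim assms by (simp add: field_simps)
        then have "\<lfloor>\<rho> * real n\<rfloor> \<noteq> 0" by linarith
        then have "L \<epsilon> n = 0" using V True by (simp add: L_def P_event_no_edges)
        \<comment> \<open>Since \<open>pi1 0 = 0\<close>, the logarithm with coefficient \<rho> is
          infinite, in agreement with probability 0.\<close>
        moreover have "Phi \<rho> \<alpha> = \<infinity>"
          using False True by (simp add: Phi_def S_ent_def xlogy_def pi1_def Psi_def)
        ultimately show ?thesis by (simp add: exp_neg_def)
      qed
    qed
  qed
  have ev: "\<forall>\<^sub>F \<epsilon> in at_right (0::real). 0 < \<epsilon>" by (rule eventually_at_right_less)
  have "\<forall>\<^sub>F \<epsilon> in at_right 0. convergent (L \<epsilon>)"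
    using ev by eventually_elim (use L convergentI in blast)
  moreover have "((\<lambda>\<epsilon>. lim (L \<epsilon>)) \<longlongrightarrow> exp_neg (Phi \<rho> \<alpha>)) (at_right 0)"
    by (rule tendsto_eventually) (use ev in \<open>eventually_elim, use L limI in blast\<close>)
  ultimately show ?thesis ..
next
  case False
  then have \<alpha>: "\<alpha> > 0" using assms by simp
  define C where "C = - (\<rho> * ln \<rho>) - (1 - \<rho>) - \<alpha> * (\<rho> * (1 - \<rho>) + (1 - \<rho>)\<^sup>2 / 2) + \<rho> * ln (1 - exp (- (\<alpha> * \<rho>)))"
  \<comment> \<open>The range of \<epsilon> in which \<open>P_event_limit\<close> applies: below
    \<rho> if \<open>\<rho> > 0\<close>, and at most 1 in any case.\<close>
  define e where "e = (if \<rho> = 0 then 1 else \<rho>)"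
  have "e > 0" "e \<le> 1" using assms by (auto simp: e_def)
  then have ev: "\<forall>\<^sub>F \<epsilon> in at_right (0::real). 0 < \<epsilon> \<and> \<epsilon> < e"
    by (intro eventually_at_rightI[of 0 e]) auto
  have L: "L \<epsilon> \<longlonglongrightarrow> exp (C + best_rate \<alpha> \<epsilon> (1 - \<rho>))" if \<epsilon>: "0 < \<epsilon> \<and> \<epsilon> < e" for \<epsilon>
    unfolding L_def C_def using \<epsilon> \<open>e \<le> 1\<close> assms
    by (intro P_event_limit[OF \<alpha>]) (auto simp: e_def split: if_splits)
  have "\<forall>\<^sub>F \<epsilon> in at_right 0. convergent (L \<epsilon>)"
    using ev by eventually_elim (use L convergentI in blast)
  moreover have "((\<lambda>\<epsilon>. lim (L \<epsilon>)) \<longlongrightarrow> exp_neg (Phi \<rho> \<alpha>)) (at_right 0)"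
  proof (rule Lim_transform_eventually)
    have "((\<lambda>\<epsilon>. exp (C + best_rate \<alpha> \<epsilon> (1 - \<rho>))) \<longlongrightarrow> exp (C + bulk_rate \<alpha> (1 - \<rho>))) (at_right 0)"
      using assms by (intro tendsto_intros best_rate_tendsto_bulk_rate[OF \<alpha>]) auto
    then show "((\<lambda>\<epsilon>. exp (C + best_rate \<alpha> \<epsilon> (1 - \<rho>))) \<longlongrightarrow> exp_neg (Phi \<rho> \<alpha>)) (at_right 0)"
      unfolding exp_neg_Phi[OF \<alpha> assms(2,3)] C_def .
    show "\<forall>\<^sub>F \<epsilon> in at_right 0. exp (C + best_rate \<alpha> \<epsilon> (1 - \<rho>)) = lim (L \<epsilon>)"
      using ev by eventually_elim (use L limI in metis)
  qed
  ultimately show ?thesis ..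
qed

end
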